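(* Let $k$ be an algebraically closed field of characteristic $2$. Let $n=2\nu$ or $n=2\nu+1$, and let $m\le 2\nu$. Then the algebra $R_{n\times m}^{O(n)}$ is generated by the $\binom{m+1}{2}$ algebraically independent invariants $Q^{(i)}$ ($1\le i\le m$) and $B^{(ij)}$ ($1\le i<j\le m$). When $m<2\nu=n$, we have $R_{2\nu\times m}^{SO(2\nu)}=R_{2\nu\times m}^{O(2\nu)}$.
   Context: $k$ is an algebraically closed field of characteristic $2$. Coordinates on $k^n$ are $x_1,\dots,x_\nu,y_1,\dots,y_\nu$ if $n=2\nu$, and $x_1,\dots,x_\nu,y_1,\dots,y_\nu,z$ if $n=2\nu+1$. The standard quadratic form is $q=\sum_{t=1}^\nu x_ty_t$ if $n=2\nu$ and $q=\sum_{t=1}^\nu x_ty_t+z^2$ if $n=2\nu+1$; its polar form is $\beta(v,w)=q(v+w)-q(v)-q(w)$. $O(n)$ is the group of linear automorphisms of $k^n$ preserving $q$; $SO(n)$ is the connected component of the identity in the algebraic group $O(n)$ (for even $n$ it has index $2$ in $O(n)$). $R_{n\times m}$ is the algebra of polynomials over $k$ in the coordinates of $m$ indeterminate vectors $v^{(1)},\dots,v^{(m)}$ in $k^n$; $O(n)$ acts diagonally, and a superscript group denotes the subalgebra of invariants. $Q^{(i)}=q(v^{(i)})$ and $B^{(ij)}=\beta(v^{(i)},v^{(j)})$. *)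

theory Defs
  imports
    "HOL-Library.Poly_Mapping"
    "HOL-Computational_Algebra.Polynomial"
    "HOL-Analysis.Abstract_Topology_2"
    "Jordan_Normal_Form.Matrix"
begin

section \<open>Polynomials in several indeterminates\<close>

text \<open>
  A polynomial over \<open>'k\<close> in the indeterminates \<open>x :: 'v\<close> is a finitely supported map from
  monomials (themselves finitely supported exponent maps) to coefficients; multiplication is the
  convolution product of \<open>HOL-Library.Poly_Mapping\<close>.
\<close>

type_synonym ('v, 'k) mpoly = "('v \<Rightarrow>\<^sub>0 nat) \<Rightarrow>\<^sub>0 'k"

definition Const :: "'k::zero \<Rightarrow> ('v, 'k) mpoly"
  where "Const c = Poly_Mapping.single 0 c"

definition Var :: "'v \<Rightarrow> ('v, 'k::zero_neq_one) mpoly"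
  where "Var x = Poly_Mapping.single (Poly_Mapping.single x 1) 1"

definition mvars :: "('v, 'k::zero) mpoly \<Rightarrow> 'v set"
  where "mvars p = (\<Union>t\<in>Poly_Mapping.keys p. Poly_Mapping.keys t)"

text \<open>
  The value of \<open>p\<close> at \<open>\<sigma>\<close> in a commutative algebra with structure map \<open>c\<close>: this is evaluation at
  a point for \<open>c = id\<close>, and substitution of polynomials for the indeterminates for \<open>c = Const\<close>.
\<close>

definition meval :: "('k::zero \<Rightarrow> 'b) \<Rightarrow> ('v \<Rightarrow> 'b) \<Rightarrow> ('v, 'k) mpoly \<Rightarrow> 'b::comm_semiring_1"
  where "meval c \<sigma> p = (\<Sum>t\<in>Poly_Mapping.keys p.
           c (Poly_Mapping.lookup p t) * (\<Prod>x\<in>Poly_Mapping.keys t. \<sigma> x ^ Poly_Mapping.lookup t x))"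

inductive_set subalgebra_generated :: "('v, 'k::comm_ring_1) mpoly set \<Rightarrow> ('v, 'k) mpoly set"
  for S :: "('v, 'k) mpoly set" where
  gen: "f \<in> S \<Longrightarrow> f \<in> subalgebra_generated S"
| const: "Const c \<in> subalgebra_generated S"
| add: "f \<in> subalgebra_generated S \<Longrightarrow> g \<in> subalgebra_generated S \<Longrightarrow> f + g \<in> subalgebra_generated S"
| mult: "f \<in> subalgebra_generated S \<Longrightarrow> g \<in> subalgebra_generated S \<Longrightarrow> f * g \<in> subalgebra_generated S"

definition algebraically_independent :: "'i set \<Rightarrow> ('i \<Rightarrow> ('v, 'k::comm_ring_1) mpoly) \<Rightarrow> bool"
  where "algebraically_independent I g \<longleftrightarrow>
           (\<forall>P :: ('i, 'k) mpoly. mvars P \<subseteq> I \<longrightarrow> meval Const g P = 0 \<longrightarrow> P = 0)"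


section \<open>The Zariski topology on the space of square matrices\<close>

definition matrix_zero_locus :: "nat \<Rightarrow> (nat \<times> nat, 'k::field) mpoly set \<Rightarrow> 'k mat set"
  where "matrix_zero_locus n P =
           {A \<in> carrier_mat n n. \<forall>p\<in>P. meval id (\<lambda>ij. A $$ ij) p = 0}"

definition zariski_open :: "nat \<Rightarrow> 'k::field mat set \<Rightarrow> bool"
  where "zariski_open n U \<longleftrightarrow>
           (\<exists>P. (\<forall>p\<in>P. mvars p \<subseteq> {..<n} \<times> {..<n}) \<and> U = carrier_mat n n - matrix_zero_locus n P)"

definition zariski_topology :: "nat \<Rightarrow> 'k::field mat topology"
  where "zariski_topology n = topology (zariski_open n)"

text \<open>The remaining lemmas of this section show that this is indeed a topology.\<close>

definition mono_eval :: "('v \<Rightarrow> 'b) \<Rightarrow> ('v \<Rightarrow>\<^sub>0 nat) \<Rightarrow> 'b::comm_semiring_1"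
  where "mono_eval \<sigma> t = (\<Prod>x\<in>Poly_Mapping.keys t. \<sigma> x ^ Poly_Mapping.lookup t x)"

lemma mono_eval_superset:
  assumes "finite X" "Poly_Mapping.keys t \<subseteq> X"
  shows "mono_eval \<sigma> t = (\<Prod>x\<in>X. \<sigma> x ^ Poly_Mapping.lookup t x)"
  unfolding mono_eval_def
  by (rule prod.mono_neutral_left) (use assms in \<open>auto simp: in_keys_iff\<close>)

lemma mono_eval_add: "mono_eval \<sigma> (s + t) = mono_eval \<sigma> s * mono_eval \<sigma> t"
proof -
  let ?X = "Poly_Mapping.keys s \<union> Poly_Mapping.keys t"
  have "mono_eval \<sigma> (s + t) = (\<Prod>x\<in>?X. \<sigma> x ^ Poly_Mapping.lookup (s + t) x)"
    by (rule mono_eval_superset) (use Poly_Mapping.keys_add[of s t] in auto)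
  moreover have "mono_eval \<sigma> s = (\<Prod>x\<in>?X. \<sigma> x ^ Poly_Mapping.lookup s x)"
    by (rule mono_eval_superset) auto
  moreover have "mono_eval \<sigma> t = (\<Prod>x\<in>?X. \<sigma> x ^ Poly_Mapping.lookup t x)"
    by (rule mono_eval_superset) auto
  ultimately show ?thesis
    by (simp add: lookup_add power_add prod.distrib)
qed

lemma meval_id_superset:
  assumes "finite T" "Poly_Mapping.keys p \<subseteq> T"
  shows "meval id \<sigma> p = (\<Sum>t\<in>T. Poly_Mapping.lookup p t * mono_eval \<sigma> t)"
  unfolding meval_def mono_eval_def id_apply
  by (rule sum.mono_neutral_left) (use assms in \<open>auto simp: in_keys_iff\<close>)

lemma meval_id_single: "meval id \<sigma> (Poly_Mapping.single t c) = c * mono_eval \<sigma> t"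
  by (subst meval_id_superset[of "{t}"]) auto

lemma meval_id_add: "meval id \<sigma> (p + q) = meval id \<sigma> p + meval id \<sigma> q"
proof -
  let ?T = "Poly_Mapping.keys p \<union> Poly_Mapping.keys q"
  have "meval id \<sigma> (p + q) = (\<Sum>t\<in>?T. Poly_Mapping.lookup (p + q) t * mono_eval \<sigma> t)"
    by (rule meval_id_superset) (use Poly_Mapping.keys_add[of p q] in auto)
  moreover have "meval id \<sigma> p = (\<Sum>t\<in>?T. Poly_Mapping.lookup p t * mono_eval \<sigma> t)"
    by (rule meval_id_superset) auto
  moreover have "meval id \<sigma> q = (\<Sum>t\<in>?T. Poly_Mapping.lookup q t * mono_eval \<sigma> t)"
    by (rule meval_id_superset) auto
  ultimately show ?thesis
    by (simp add: lookup_add sum.distrib algebra_simps)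
qed

lemma mpoly_induct [case_names single add]:
  assumes single: "\<And>t c. Q (Poly_Mapping.single t c)" and add: "\<And>p q. Q p \<Longrightarrow> Q q \<Longrightarrow> Q (p + q)"
  shows "Q (p :: ('v, 'k::comm_monoid_add) mpoly)"
proof (induction p rule: update_induct)
  case const
  show ?case using single[of 0 0] by simp
next
  case (update f t c)
  have "Poly_Mapping.update t c f = f + Poly_Mapping.single t c"
    using update(1) by (intro poly_mapping_eqI)
      (auto simp: lookup_update lookup_add lookup_single in_keys_iff)
  then show ?case using update add single by simp
qed

lemma meval_id_mult: "meval id \<sigma> (p * q) = meval id \<sigma> p * meval id \<sigma> q"
proof (induction p rule: mpoly_induct)
  case (single t c)
  show ?case
  proof (induction q rule: mpoly_induct)
    case (single s d)
    show ?case
      unfolding mult_single meval_id_single mono_eval_add by (simp only: ac_simps)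
  next
    case (add p q)
    then show ?case by (simp only: meval_id_add distrib_left distrib_right)
  qed
next
  case (add p q)
  then show ?case by (simp only: meval_id_add distrib_left distrib_right)
qed

lemma mvars_mult_subset: "mvars (p * q) \<subseteq> mvars p \<union> mvars q"
proof
  fix x assume "x \<in> mvars (p * q)"
  then obtain t where t: "t \<in> Poly_Mapping.keys (p * q)" "x \<in> Poly_Mapping.keys t"
    by (auto simp: mvars_def)
  from t(1) Poly_Mapping.keys_mult[of p q] obtain a b
    where ab: "t = a + b" "a \<in> Poly_Mapping.keys p" "b \<in> Poly_Mapping.keys q"
    by blast
  with t(2) Poly_Mapping.keys_add[of a b] show "x \<in> mvars p \<union> mvars q"
    by (auto simp: mvars_def)
qed

lemma istopology_zariski_open: "istopology (zariski_open n :: 'k::field mat set \<Rightarrow> bool)"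
  unfolding istopology_def
proof (intro conjI allI impI)
  fix S T :: "'k mat set"
  assume "zariski_open n S" "zariski_open n T"
  then obtain P Q
    where P: "\<forall>p\<in>P. mvars p \<subseteq> {..<n} \<times> {..<n}" "S = carrier_mat n n - matrix_zero_locus n P"
      and Q: "\<forall>p\<in>Q. mvars p \<subseteq> {..<n} \<times> {..<n}" "T = carrier_mat n n - matrix_zero_locus n Q"
    unfolding zariski_open_def by blast
  let ?PQ = "{p * q | p q. p \<in> P \<and> q \<in> Q}"
  have "(\<forall>r\<in>?PQ. meval id \<sigma> r = 0) \<longleftrightarrow> (\<forall>p\<in>P. meval id \<sigma> p = 0) \<or> (\<forall>q\<in>Q. meval id \<sigma> q = 0)"
    for \<sigma> :: "nat \<times> nat \<Rightarrow> 'k"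
  proof -
    have "(\<forall>r\<in>?PQ. meval id \<sigma> r = 0) \<longleftrightarrow> (\<forall>p\<in>P. \<forall>q\<in>Q. meval id \<sigma> (p * q) = 0)"
      by fast
    then show ?thesis
      unfolding meval_id_mult mult_eq_0_iff by blast
  qed
  then have "matrix_zero_locus n ?PQ = matrix_zero_locus n P \<union> matrix_zero_locus n Q"
    unfolding matrix_zero_locus_def by blast
  then have "S \<inter> T = carrier_mat n n - matrix_zero_locus n ?PQ"
    unfolding P(2) Q(2) by blast
  moreover have "mvars (p * q) \<subseteq> {..<n} \<times> {..<n}" if "p \<in> P" "q \<in> Q" for p q
    using mvars_mult_subset[of p q] P(1) Q(1) that by blast
  then have "\<forall>p\<in>?PQ. mvars p \<subseteq> {..<n} \<times> {..<n}" by blast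
  ultimately show "zariski_open n (S \<inter> T)"
    unfolding zariski_open_def by blast
next
  fix K :: "'k mat set set"
  assume "\<forall>U\<in>K. zariski_open n U"
  then obtain P
    where P: "\<And>U. U \<in> K \<Longrightarrow> \<forall>p\<in>P U. mvars p \<subseteq> {..<n} \<times> {..<n}"
      and U: "\<And>U. U \<in> K \<Longrightarrow> U = carrier_mat n n - matrix_zero_locus n (P U)"
    unfolding zariski_open_def by metis
  have mem: "A \<in> U \<longleftrightarrow> A \<in> carrier_mat n n - matrix_zero_locus n (P U)" if "U \<in> K" for A U
    by (rule arg_cong[OF U[OF that], of "\<lambda>V. A \<in> V"])
  have "\<Union>K = (\<Union>U\<in>K. carrier_mat n n - matrix_zero_locus n (P U))"
    unfolding set_eq_iff UN_iff unfolding Union_iff by (intro allI bex_cong[OF refl mem])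
  also have "\<dots> = carrier_mat n n - matrix_zero_locus n (\<Union>U\<in>K. P U)"
    unfolding matrix_zero_locus_def by blast
  finally have eq: "\<Union>K = carrier_mat n n - matrix_zero_locus n (\<Union>U\<in>K. P U)" .
  have "\<forall>p\<in>(\<Union>U\<in>K. P U). mvars p \<subseteq> {..<n} \<times> {..<n}"
    unfolding ball_UN by (rule ballI[OF P])
  with eq show "zariski_open n (\<Union>K)"
    unfolding zariski_open_def by (intro exI conjI)
qed

lemma openin_zariski_topology [simp]: "openin (zariski_topology n) U \<longleftrightarrow> zariski_open n U"
  by (simp add: zariski_topology_def istopology_zariski_open)


section \<open>The quadratic form and its groups\<close>

text \<open>
  With \<open>\<nu> = n div 2\<close>, the coordinates of \<open>v\<close> are listed as \<open>x\<^sub>1, \<dots>, x\<^sub>\<nu>, y\<^sub>1, \<dots>, y\<^sub>\<nu>\<close>, followed by \<open>z\<close>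
  for odd \<open>n\<close>. The base ring is arbitrary so that the form can also be applied to vectors of
  indeterminates.
\<close>

definition qform :: "nat \<Rightarrow> 'a::comm_ring_1 vec \<Rightarrow> 'a"
  where "qform n v = (\<Sum>t<n div 2. v $ t * v $ (n div 2 + t)) +
           (if odd n then (v $ (n - 1))\<^sup>2 else 0)"

definition polar :: "nat \<Rightarrow> 'a::comm_ring_1 vec \<Rightarrow> 'a vec \<Rightarrow> 'a"
  where "polar n v w = qform n (v + w) - qform n v - qform n w"

definition orthogonal_group :: "nat \<Rightarrow> 'k::field mat set"
  where "orthogonal_group n = {A \<in> carrier_mat n n. invertible_mat A \<and>
           (\<forall>v\<in>carrier_vec n. qform n (A *\<^sub>v v) = qform n v)}"

definition special_orthogonal_group :: "nat \<Rightarrow> 'k::field mat set"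
  where "special_orthogonal_group n =
           connected_component_of_set
             (subtopology (zariski_topology n) (orthogonal_group n)) (1\<^sub>m n)"


section \<open>Invariants of several vectors\<close>

text \<open>
  The indeterminate \<open>(i, a)\<close> is coordinate \<open>a\<close> of the \<open>i\<close>-th indeterminate vector; both indices are
  counted from \<open>0\<close>.
\<close>

definition generic_vec :: "nat \<Rightarrow> nat \<Rightarrow> (nat \<times> nat, 'k::comm_ring_1) mpoly vec"
  where "generic_vec n i = vec n (\<lambda>a. Var (i, a))"

definition poly_algebra :: "nat \<Rightarrow> nat \<Rightarrow> (nat \<times> nat, 'k::comm_ring_1) mpoly set"
  where "poly_algebra n m = {f. mvars f \<subseteq> {..<m} \<times> {..<n}}"

text \<open>The polynomial \<open>f (A v\<^sub>1, \<dots>, A v\<^sub>m)\<close>:\<close>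

definition subst_linear ::
    "nat \<Rightarrow> 'k::comm_ring_1 mat \<Rightarrow> (nat \<times> nat, 'k) mpoly \<Rightarrow> (nat \<times> nat, 'k) mpoly"
  where "subst_linear n A f =
           meval Const (\<lambda>(i, a). (map_mat Const A *\<^sub>v generic_vec n i) $ a) f"

definition invariants :: "nat \<Rightarrow> nat \<Rightarrow> 'k::comm_ring_1 mat set \<Rightarrow> (nat \<times> nat, 'k) mpoly set"
  where "invariants n m G = {f \<in> poly_algebra n m. \<forall>A\<in>G. subst_linear n A f = f}"

definition Q_inv :: "nat \<Rightarrow> nat \<Rightarrow> (nat \<times> nat, 'k::comm_ring_1) mpoly"
  where "Q_inv n i = qform n (generic_vec n i)"

definition B_inv :: "nat \<Rightarrow> nat \<Rightarrow> nat \<Rightarrow> (nat \<times> nat, 'k::comm_ring_1) mpoly"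
  where "B_inv n i j = polar n (generic_vec n i) (generic_vec n j)"

definition QB_index :: "nat \<Rightarrow> (nat + nat \<times> nat) set"
  where "QB_index m = Inl ` {..<m} \<union> Inr ` {(i, j). i < j \<and> j < m}"

definition QB_inv :: "nat \<Rightarrow> nat + nat \<times> nat \<Rightarrow> (nat \<times> nat, 'k::comm_ring_1) mpoly"
  where "QB_inv n = case_sum (Q_inv n) (\<lambda>(i, j). B_inv n i j)"

end

theory Submission
  imports Defs "HOL-Combinatorics.Transposition" "Jordan_Normal_Form.Determinant"
begin

text \<open>
  Put the last two of \<open>2r\<close> vectors into the hyperbolic plane spanned by a pair of coordinates (two
  reflections achieve this generically) and write the others as \<open>a\<^sub>i w\<^sub>1 + b\<^sub>i w\<^sub>2 + u\<^sub>i\<close> with \<open>u\<^sub>i\<close>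
  orthogonal to that plane. On such tuples an invariant is, by induction applied to the \<open>u\<^sub>i\<close> and by
  the case of two vectors in a plane applied to \<open>w\<^sub>1, w\<^sub>2\<close>, a polynomial in \<open>Q(w\<^sub>1), Q(w\<^sub>2), B(w\<^sub>1, w\<^sub>2)\<close>,
  the \<open>a\<^sub>i, b\<^sub>i\<close> and the \<open>Q(u\<^sub>i), B(u\<^sub>i, u\<^sub>j)\<close>; all of these become polynomials in the \<open>Q\<close> and \<open>B\<close> of the whole
  tuple after inverting the single invariant \<open>B(w\<^sub>1, w\<^sub>2)\<close>. Exchanging two vectors gives the same
  statement with another invariant \<open>B\<close> inverted, and since the \<open>Q\<close> and \<open>B\<close> are algebraically independent, the
  denominators cancel. Fewer than \<open>2\<nu>\<close> vectors are handled by adding zero vectors.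

  Only invariance under reflections enters. Products of two reflections lie in the identity component,
  and fewer than \<open>n = 2\<nu>\<close> vectors are generically fixed by some reflection; so invariants of the
  special orthogonal group are reflection invariant as well.
\<close>

section \<open>Algebras of functions\<close>

text \<open>In characteristic 2 every vector is orthogonal to itself, so the usual splitting into a
  vector and its orthogonal complement fails. The smallest piece that splits off with a
  nondegenerate polar form is a plane, and w_1, w_2 span one exactly when B(w_1, w_2) is nonzero.
  This is why each induction step removes two vectors together with one pair of coordinates, and why
  a single B is the denominator. The reflections come from one identity: if q(v) = q(v'), then q(v +
  v') = B(v, v') = B(v, v + v'), so the reflection in v + v' takes v to v' as soon as this value is
  nonzero. The exchange of two vectors needs a third one, so the step with only two vectors is
  separate. In the bare plane no denominator arises. With the coordinate z, whose axis is the
  radical of the polar form, pairs with B = 0 and arbitrary norms can be written down directly, and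
  a numerator over a positive power of B must vanish there.\<close>

lemma alg_closed_infinite: "infinite (UNIV :: 'k::alg_closed_field set)"
proof
  assume fin: "finite (UNIV :: 'k set)"
  \<comment> \<open>\<open>p\<close> vanishes at every field element, so \<open>p + 1\<close> would
    be a polynomial of positive degree without a root.\<close>
  define p :: "'k poly" where "p = (\<Prod>a\<in>UNIV. [:-a, 1:])"
  have deg: "degree p = card (UNIV :: 'k set)"
    unfolding p_def by (subst degree_prod_eq_sum_degree) auto
  have "degree (p + 1) = degree p"
    using deg fin by (intro degree_add_eq_left) (auto simp: card_gt_0_iff)
  then have "degree (p + 1) > 0" using deg fin by (simp add: card_gt_0_iff)
  then obtain x where "poly (p + 1) x = 0" using alg_closed_imp_poly_has_root by blast
  moreover have "poly p x = 0" unfolding p_def poly_prod using fin by (auto intro!: prod_zero)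
  ultimately show False by simp
qed

lemma poly_eq_0_if_cofinite:
  fixes p :: "'k::alg_closed_field poly"
  assumes "finite B" "\<And>x. x \<notin> B \<Longrightarrow> poly p x = 0"
  shows "p = 0"
proof (rule ccontr)
  assume "p \<noteq> 0"
  then have "finite ({x. poly p x = 0} \<union> B)" using assms(1) poly_roots_finite by blast
  moreover have "{x. poly p x = 0} \<union> B = UNIV" using assms(2) by blast
  ultimately show False using alg_closed_infinite by metis
qed

text \<open>Both sides are polynomials in \<open>s\<close> that agree for nonzero \<open>s\<close>,
  so they have the same coefficient at \<open>s ^ M\<close>. The factor \<open>s ^ M\<close> on the
  right allows weights that may be negative to be shifted by \<open>M\<close> to natural
  exponents.\<close>

lemma power_sum_coeff:
  fixes a :: "'t \<Rightarrow> 'k::alg_closed_field"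
  assumes "finite T" "\<And>s. s \<noteq> 0 \<Longrightarrow> (\<Sum>t\<in>T. a t * s ^ e t) = b * s ^ M"
  shows "(\<Sum>t\<in>{t\<in>T. e t = M}. a t) = b"
proof -
  define p where "p = (\<Sum>t\<in>T. monom (a t) (e t)) - monom b M"
  have "p = 0"
    by (rule poly_eq_0_if_cofinite[of "{0}"]) (use assms in \<open>auto simp: p_def poly_sum poly_monom\<close>)
  then have "coeff p M = 0" by simp
  then show ?thesis
    using assms(1) by (simp add: p_def coeff_sum sum.If_cases Int_def flip: sum.inter_filter)
qed

text \<open>Invariants are handled as functions: over an infinite field a polynomial is determined
  by its values, and substitution becomes plain composition.\<close>

inductive_set alg :: "('a \<Rightarrow> 'k::comm_ring_1) set \<Rightarrow> ('a \<Rightarrow> 'k) set" for S where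
  gen: "f \<in> S \<Longrightarrow> f \<in> alg S"
| const: "(\<lambda>_. c) \<in> alg S"
| add: "f \<in> alg S \<Longrightarrow> g \<in> alg S \<Longrightarrow> (\<lambda>x. f x + g x) \<in> alg S"
| mult: "f \<in> alg S \<Longrightarrow> g \<in> alg S \<Longrightarrow> (\<lambda>x. f x * g x) \<in> alg S"

definition pf :: "'v set \<Rightarrow> (('v \<Rightarrow> 'k) \<Rightarrow> 'k::comm_ring_1) set"
  where "pf X = alg ((\<lambda>x \<sigma>. \<sigma> x) ` X)"

lemma alg_uminus: "f \<in> alg S \<Longrightarrow> (\<lambda>x. - f x) \<in> alg S"
  using alg.mult[OF alg.const[where c = "-1" and S = S], of f] by simp

lemma alg_diff: "f \<in> alg S \<Longrightarrow> g \<in> alg S \<Longrightarrow> (\<lambda>x. f x - g x) \<in> alg S"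
  using alg.add[OF _ alg_uminus, of f S g] by simp

lemma alg_power: "f \<in> alg S \<Longrightarrow> (\<lambda>x. f x ^ k) \<in> alg S"
  by (induction k) (auto intro: alg.intros)

lemma alg_sum: "(\<And>i. i \<in> I \<Longrightarrow> f i \<in> alg S) \<Longrightarrow> (\<lambda>x. \<Sum>i\<in>I. f i x) \<in> alg S"
  by (induction I rule: infinite_finite_induct) (auto intro: alg.intros)

lemma alg_prod: "(\<And>i. i \<in> I \<Longrightarrow> f i \<in> alg S) \<Longrightarrow> (\<lambda>x. \<Prod>i\<in>I. f i x) \<in> alg S"
  by (induction I rule: infinite_finite_induct) (auto intro: alg.intros)

lemma alg_comp:
  assumes "h \<in> alg S" "\<And>s. s \<in> S \<Longrightarrow> (\<lambda>x. s (g x)) \<in> alg T"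
  shows "(\<lambda>x. h (g x)) \<in> alg T"
  using assms(1) by induction (auto intro: assms(2) alg.intros)

lemma alg_subset: "h \<in> alg S \<Longrightarrow> S \<subseteq> alg T \<Longrightarrow> h \<in> alg T"
  using alg_comp[of h S "\<lambda>x. x" T] by auto

lemma alg_cong_points:
  assumes "h \<in> alg S" "\<And>s. s \<in> S \<Longrightarrow> s x = s y"
  shows "h x = h y"
  using assms(1) by induction (auto simp: assms(2))

text \<open>For lines and curves \<open>g\<close>, along which identities between functions turn
  into identities between polynomials in one parameter.\<close>

lemma alg_uniform:
  assumes "h \<in> alg S" "\<And>s. s \<in> S \<Longrightarrow> \<exists>p. \<forall>t. s (g t) = poly p t"
  shows "\<exists>p. \<forall>t. h (g t) = poly p t"
  using assms(1)
proof induction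
  case (const c)
  show ?case by (rule exI[of _ "[:c:]"]) simp
next
  case (add f1 f2)
  then show ?case by (metis poly_add)
next
  case (mult f1 f2)
  then show ?case by (metis poly_mult)
qed (use assms(2) in auto)

lemma pf_var: "x \<in> X \<Longrightarrow> (\<lambda>\<sigma>. \<sigma> x) \<in> pf X"
  by (auto simp: pf_def intro: alg.gen)

lemmas pf_const = alg.const[where S = "(\<lambda>x \<sigma>. \<sigma> x) ` X" for X, folded pf_def]
lemmas pf_add = alg.add[where S = "(\<lambda>x \<sigma>. \<sigma> x) ` X" for X, folded pf_def]
lemmas pf_mult = alg.mult[where S = "(\<lambda>x \<sigma>. \<sigma> x) ` X" for X, folded pf_def]
lemmas pf_diff = alg_diff[where S = "(\<lambda>x \<sigma>. \<sigma> x) ` X" for X, folded pf_def]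
lemmas pf_power = alg_power[where S = "(\<lambda>x \<sigma>. \<sigma> x) ` X" for X, folded pf_def]
lemmas pf_sum = alg_sum[where S = "(\<lambda>x \<sigma>. \<sigma> x) ` X" for X, folded pf_def]
lemmas pf_intros = pf_var pf_const pf_add pf_mult pf_diff pf_power pf_sum

lemma pf_comp_alg:
  assumes "h \<in> pf X" "\<And>x. x \<in> X \<Longrightarrow> (\<lambda>y. g y x) \<in> alg T"
  shows "(\<lambda>y. h (g y)) \<in> alg T"
  by (rule alg_comp[OF assms(1)[unfolded pf_def]]) (use assms(2) in auto)

lemma pf_comp:
  assumes "h \<in> pf X" "\<And>x. x \<in> X \<Longrightarrow> (\<lambda>y. g y x) \<in> pf Y"
  shows "(\<lambda>y. h (g y)) \<in> pf Y"
  using pf_comp_alg[OF assms[unfolded pf_def[of Y]]] by (simp add: pf_def)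

lemma pf_mono: "h \<in> pf X \<Longrightarrow> X \<subseteq> Y \<Longrightarrow> h \<in> pf Y"
  using pf_comp[of h X "\<lambda>y. y" Y] by (auto intro: pf_var)

lemma pf_cong: "h \<in> pf X \<Longrightarrow> (\<And>x. x \<in> X \<Longrightarrow> \<sigma> x = \<tau> x) \<Longrightarrow> h \<sigma> = h \<tau>"
  unfolding pf_def by (erule alg_cong_points) auto

text \<open>Density of a nonempty principal open set. On the line through
  \<open>\<sigma>\<^sub>0\<close> and \<open>\<sigma>\<close> the function \<open>D\<close> is a
  nonzero polynomial in the parameter, so \<open>h\<close> vanishes at all but finitely many points
  of the line and hence on all of it.\<close>

lemma pf_density:
  fixes h :: "('v \<Rightarrow> 'k::alg_closed_field) \<Rightarrow> 'k"
  assumes "D \<in> pf X" "h \<in> pf Y" "D \<sigma>\<^sub>0 \<noteq> 0" "\<And>\<sigma>. D \<sigma> \<noteq> 0 \<Longrightarrow> h \<sigma> = 0"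
  shows "h \<sigma> = 0"
proof -
  define l where "l t x = \<sigma>\<^sub>0 x + t * (\<sigma> x - \<sigma>\<^sub>0 x)" for t x
  have lin: "\<exists>p. \<forall>t. l t x = poly p t" for x
    by (rule exI[of _ "[:\<sigma>\<^sub>0 x, \<sigma> x - \<sigma>\<^sub>0 x:]"]) (simp add: l_def)
  have "\<exists>p. \<forall>t. D (l t) = poly p t"
    by (rule alg_uniform[OF assms(1)[unfolded pf_def]]) (use lin in auto)
  then obtain p where p: "\<And>t. D (l t) = poly p t" by blast
  have "\<exists>p. \<forall>t. h (l t) = poly p t"
    by (rule alg_uniform[OF assms(2)[unfolded pf_def]]) (use lin in auto)
  then obtain r where r: "\<And>t. h (l t) = poly r t" by blast
  have "l 0 = \<sigma>\<^sub>0" "l 1 = \<sigma>" by (auto simp: l_def)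
  then have "p \<noteq> 0" using p[of 0] assms(3) by auto
  moreover have "poly r t = 0" if "t \<notin> {t. poly p t = 0}" for t
    using assms(4)[of "l t"] that by (simp add: p r)
  ultimately have "r = 0"
    using poly_eq_0_if_cofinite poly_roots_finite by metis
  then show ?thesis using r[of 1] \<open>l 1 = \<sigma>\<close> by simp
qed

text \<open>Division by a variable with remainder: a function that vanishes on the hyperplane
  \<open>x = 0\<close> is divisible by \<open>x\<close>, which is how a denominator gets cancelled
  later.\<close>

lemma pf_split_var:
  fixes F :: "('v \<Rightarrow> 'k::comm_ring_1) \<Rightarrow> 'k"
  assumes "F \<in> pf X"
  obtains G where "G \<in> pf X" "\<And>\<tau>. F \<tau> = F (\<tau>(x := 0)) + \<tau> x * G \<tau>"
proof -
  have "\<exists>G\<in>pf X. \<forall>\<tau>. F \<tau> = F (\<tau>(x := 0)) + \<tau> x * G \<tau>"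
    using assms unfolding pf_def
  proof induction
    case (gen f)
    then obtain y where y: "f = (\<lambda>\<sigma>. \<sigma> y)" by auto
    show ?case
      by (rule bexI[of _ "\<lambda>_. if y = x then 1 else 0"]) (auto simp: y intro: alg.const)
  next
    case (const c)
    show ?case by (rule bexI[of _ "\<lambda>_. 0"]) (auto intro: alg.const)
  next
    case (add f g)
    obtain F where F: "F \<in> alg ((\<lambda>x \<sigma>. \<sigma> x) ` X)" and f: "\<forall>\<tau>. f \<tau> = f (\<tau>(x := 0)) + \<tau> x * F \<tau>"
      using add.IH(1) by blast
    obtain G where G: "G \<in> alg ((\<lambda>x \<sigma>. \<sigma> x) ` X)" and g: "\<forall>\<tau>. g \<tau> = g (\<tau>(x := 0)) + \<tau> x * G \<tau>"
      using add.IH(2) by blast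
    show ?case
    proof (rule bexI[of _ "\<lambda>\<tau>. F \<tau> + G \<tau>"], intro allI)
      fix \<tau>
      have "f \<tau> + g \<tau> = (f (\<tau>(x := 0)) + \<tau> x * F \<tau>) + (g (\<tau>(x := 0)) + \<tau> x * G \<tau>)"
        by (rule arg_cong2[OF f[rule_format] g[rule_format]])
      then show "f \<tau> + g \<tau> = f (\<tau>(x := 0)) + g (\<tau>(x := 0)) + \<tau> x * (F \<tau> + G \<tau>)"
        by (simp only: algebra_simps)
    qed (intro alg.intros F G)
  next
    case (mult f g)
    obtain F where F: "F \<in> alg ((\<lambda>x \<sigma>. \<sigma> x) ` X)" and f: "\<forall>\<tau>. f \<tau> = f (\<tau>(x := 0)) + \<tau> x * F \<tau>"
      using mult.IH(1) by blast
    obtain G where G: "G \<in> alg ((\<lambda>x \<sigma>. \<sigma> x) ` X)" and g: "\<forall>\<tau>. g \<tau> = g (\<tau>(x := 0)) + \<tau> x * G \<tau>"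
      using mult.IH(2) by blast
    show ?case
    proof (rule bexI[of _ "\<lambda>\<tau>. F \<tau> * g \<tau> + f (\<tau>(x := 0)) * G \<tau>"], intro allI)
      fix \<tau>
      have "f \<tau> * g \<tau> = (f (\<tau>(x := 0)) + \<tau> x * F \<tau>) * g \<tau>"
        by (rule arg_cong[OF f[rule_format]])
      also have "\<dots> = f (\<tau>(x := 0)) * g \<tau> + \<tau> x * F \<tau> * g \<tau>"
        by (rule distrib_right)
      also have "f (\<tau>(x := 0)) * g \<tau> = f (\<tau>(x := 0)) * (g (\<tau>(x := 0)) + \<tau> x * G \<tau>)"
        by (rule arg_cong[OF g[rule_format]])
      finally show "f \<tau> * g \<tau> = f (\<tau>(x := 0)) * g (\<tau>(x := 0)) + \<tau> x * (F \<tau> * g \<tau> + f (\<tau>(x := 0)) * G \<tau>)"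
        by (simp only: algebra_simps)
    next
      have upd: "(\<lambda>\<tau>. f (\<tau>(x := 0))) \<in> alg ((\<lambda>x \<sigma>. \<sigma> x) ` X)"
      proof (rule alg_comp[OF mult(1)])
        fix s :: "('v \<Rightarrow> 'k) \<Rightarrow> 'k"
        assume "s \<in> (\<lambda>x \<sigma>. \<sigma> x) ` X"
        then obtain y where y: "y \<in> X" "s = (\<lambda>\<sigma>. \<sigma> y)" by blast
        show "(\<lambda>\<tau>. s (\<tau>(x := 0))) \<in> alg ((\<lambda>x \<sigma>. \<sigma> x) ` X)"
          using y by (cases "y = x") (auto intro: alg.intros)
      qed
      show "(\<lambda>\<tau>. F \<tau> * g \<tau> + f (\<tau>(x := 0)) * G \<tau>) \<in> alg ((\<lambda>x \<sigma>. \<sigma> x) ` X)"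
        by (intro alg.intros(3,4) F G mult(1,2) upd)
    qed
  qed
  then show ?thesis using that by blast
qed

section \<open>Polynomials as functions\<close>

definition peval :: "('v, 'k::field) mpoly \<Rightarrow> ('v \<Rightarrow> 'k) \<Rightarrow> 'k"
  where "peval p \<sigma> = meval id \<sigma> p"

lemma peval_Const [simp]: "peval (Const c) \<sigma> = c"
  unfolding peval_def Const_def meval_id_single by (simp add: mono_eval_def)

lemma peval_Var [simp]: "peval (Var x) \<sigma> = \<sigma> x"
  unfolding peval_def Var_def meval_id_single by (simp add: mono_eval_def)

lemma peval_add [simp]: "peval (p + q) \<sigma> = peval p \<sigma> + peval q \<sigma>"
  unfolding peval_def by (rule meval_id_add)

lemma peval_mult [simp]: "peval (p * q) \<sigma> = peval p \<sigma> * peval q \<sigma>"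
  unfolding peval_def by (rule meval_id_mult)

lemma peval_superset:
  assumes "finite T" "Poly_Mapping.keys p \<subseteq> T"
  shows "peval p \<sigma> = (\<Sum>t\<in>T. Poly_Mapping.lookup p t * mono_eval \<sigma> t)"
  unfolding peval_def by (rule meval_id_superset[OF assms])

lemma mvars_Const [simp]: "mvars (Const c) = {}"
  by (auto simp: mvars_def Const_def)

lemma mvars_Var [simp]: "mvars (Var x :: ('v, 'k::field) mpoly) = {x}"
  by (auto simp: mvars_def Var_def)

lemma mvars_add_subset: "mvars (p + q) \<subseteq> mvars p \<union> mvars q"
  using Poly_Mapping.keys_add[of p q] by (auto simp: mvars_def)

lemma pf_imp_mpoly:
  fixes h :: "('v \<Rightarrow> 'k::field) \<Rightarrow> 'k"
  assumes "h \<in> pf X"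
  shows "\<exists>p. mvars p \<subseteq> X \<and> (\<forall>\<sigma>. h \<sigma> = peval p \<sigma>)"
  using assms unfolding pf_def
proof induction
  case (gen f)
  then obtain x where "x \<in> X" "f = (\<lambda>\<sigma>. \<sigma> x)" by blast
  then show ?case by (intro exI[of _ "Var x"]) auto
next
  case (const c)
  show ?case by (rule exI[of _ "Const c"]) simp
next
  case (add f g)
  then obtain p q where "mvars p \<subseteq> X" "\<forall>\<sigma>. f \<sigma> = peval p \<sigma>" "mvars q \<subseteq> X" "\<forall>\<sigma>. g \<sigma> = peval q \<sigma>"
    by blast
  then show ?case
    using mvars_add_subset[of p q] by (intro exI[of _ "p + q"]) auto
next
  case (mult f g)
  then obtain p q where "mvars p \<subseteq> X" "\<forall>\<sigma>. f \<sigma> = peval p \<sigma>" "mvars q \<subseteq> X" "\<forall>\<sigma>. g \<sigma> = peval q \<sigma>"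
    by blast
  then show ?case
    using mvars_mult_subset[of p q] by (intro exI[of _ "p * q"]) auto
qed

text \<open>Rescaling a variable in which two of the monomials have different exponents splits the
  relation by the exponent of that variable; the part containing \<open>t\<close> is a shorter
  relation.\<close>

lemma monomials_independent:
  fixes a :: "('v \<Rightarrow>\<^sub>0 nat) \<Rightarrow> 'k::alg_closed_field"
  assumes "finite T" "\<And>\<sigma>. (\<Sum>t\<in>T. a t * mono_eval \<sigma> t) = 0" "t \<in> T"
  shows "a t = 0"
  using assms
proof (induction "card T" arbitrary: T t rule: less_induct)
  case less
  show ?case
  proof (cases "T = {t}")
    case True
    then show ?thesis using less.prems(2)[of "\<lambda>_. 1"] by (simp add: mono_eval_def)
  next
    case False
    then obtain t' where t': "t' \<in> T" "t' \<noteq> t" using less.prems(3) by blast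
    then obtain x where x: "Poly_Mapping.lookup t' x \<noteq> Poly_Mapping.lookup t x"
      by (metis poly_mapping_eqI)
    let ?T = "{s \<in> T. Poly_Mapping.lookup s x = Poly_Mapping.lookup t x}"
    have scale: "mono_eval (\<sigma>(x := s * \<sigma> x)) u = mono_eval \<sigma> u * s ^ Poly_Mapping.lookup u x"
      for \<sigma> :: "'v \<Rightarrow> 'k" and s u
    proof -
      let ?X = "insert x (Poly_Mapping.keys u)"
      have "mono_eval (\<sigma>(x := s * \<sigma> x)) u =
          (\<Prod>y\<in>?X. \<sigma> y ^ Poly_Mapping.lookup u y * (if y = x then s ^ Poly_Mapping.lookup u x else 1))"
        by (subst mono_eval_superset[of ?X]) (auto simp: power_mult_distrib mult.commute intro!: prod.cong)
      also have "\<dots> = mono_eval \<sigma> u * s ^ Poly_Mapping.lookup u x"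
        by (subst mono_eval_superset[of ?X]) (auto simp: prod.distrib)
      finally show ?thesis .
    qed
    have "(\<Sum>s\<in>?T. a s * mono_eval \<sigma> s) = 0" for \<sigma>
    proof (rule power_sum_coeff[OF less.prems(1)])
      fix s :: 'k
      show "(\<Sum>t\<in>T. a t * mono_eval \<sigma> t * s ^ Poly_Mapping.lookup t x) = 0 * s ^ Poly_Mapping.lookup t x"
        using less.prems(2)[of "\<sigma>(x := s * \<sigma> x)"] by (simp add: scale mult.assoc)
    qed
    moreover have "card ?T < card T"
      using t' x by (intro psubset_card_mono less.prems) auto
    ultimately show ?thesis using less.prems(1,3) by (intro less.hyps[of ?T]) auto
  qed
qed

lemma mpoly_eqI:
  fixes p r :: "('v, 'k::alg_closed_field) mpoly"
  assumes "\<And>\<sigma>. peval p \<sigma> = peval r \<sigma>"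
  shows "p = r"
proof -
  have "peval (p - r) \<sigma> = 0" for \<sigma>
    using peval_add[of "p - r" r \<sigma>] assms[of \<sigma>] by simp
  then have sum0: "(\<Sum>t\<in>Poly_Mapping.keys (p - r). Poly_Mapping.lookup (p - r) t * mono_eval \<sigma> t) = 0" for \<sigma>
    by (subst peval_superset[symmetric]) auto
  have "Poly_Mapping.lookup (p - r) t = 0" if "t \<in> Poly_Mapping.keys (p - r)" for t
    by (rule monomials_independent[OF _ sum0 that]) simp
  then have "p - r = 0" by (metis in_keys_iff poly_mapping_eqI lookup_zero)
  then show ?thesis by simp
qed

lemma peval_0 [simp]: "peval 0 \<sigma> = 0"
  using peval_Const[of 0 \<sigma>] by (simp add: Const_def)

lemma peval_1 [simp]: "peval 1 \<sigma> = 1"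
  using peval_Const[of 1 \<sigma>] by (simp add: Const_def)

lemma peval_diff [simp]: "peval (p - r) \<sigma> = peval p \<sigma> - peval r \<sigma>"
  using peval_add[of "p - r" r \<sigma>] by simp

lemma peval_sum [simp]: "peval (\<Sum>i\<in>A. f i) \<sigma> = (\<Sum>i\<in>A. peval (f i) \<sigma>)"
  by (induction A rule: infinite_finite_induct) auto

lemma peval_prod [simp]: "peval (\<Prod>i\<in>A. f i) \<sigma> = (\<Prod>i\<in>A. peval (f i) \<sigma>)"
  by (induction A rule: infinite_finite_induct) auto

lemma peval_power [simp]: "peval (p ^ k) \<sigma> = peval p \<sigma> ^ k"
  by (induction k) auto

lemma peval_pf:
  assumes "mvars p \<subseteq> X"
  shows "peval p \<in> pf X"
proof -
  have "(\<lambda>\<sigma>. \<Sum>t\<in>Poly_Mapping.keys p. Poly_Mapping.lookup p t *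
      (\<Prod>x\<in>Poly_Mapping.keys t. \<sigma> x ^ Poly_Mapping.lookup t x)) \<in> pf X"
    using assms unfolding pf_def mvars_def
    by (intro alg_sum alg.mult alg.const alg_prod alg_power alg.gen) blast
  moreover have "peval p = (\<lambda>\<sigma>. \<Sum>t\<in>Poly_Mapping.keys p. Poly_Mapping.lookup p t *
      (\<Prod>x\<in>Poly_Mapping.keys t. \<sigma> x ^ Poly_Mapping.lookup t x))"
    unfolding peval_superset[OF finite_keys order_refl] mono_eval_def ..
  ultimately show ?thesis by simp
qed

text \<open>A function built from the coordinates in \<open>X\<close> is the value function of some
  polynomial in these variables, and by \<open>mpoly_eqI\<close> that polynomial is \<open>p\<close>
  itself.\<close>

lemma mvars_subset_iff_pf:
  fixes p :: "('v, 'k::alg_closed_field) mpoly"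
  shows "mvars p \<subseteq> X \<longleftrightarrow> peval p \<in> pf X"
proof
  assume "peval p \<in> pf X"
  then obtain r where "mvars r \<subseteq> X" "\<forall>\<sigma>. peval p \<sigma> = peval r \<sigma>" using pf_imp_mpoly by blast
  then show "mvars p \<subseteq> X" using mpoly_eqI[of p r] by blast
qed (rule peval_pf)

lemma peval_meval_Const:
  "peval (meval Const g P) \<sigma> = peval P (\<lambda>x. peval (g x) \<sigma>)"
  by (simp add: meval_def peval_superset[of _ P, OF _ order_refl] mono_eval_def)

section \<open>Invariants of a tensor product\<close>

text \<open>The algebra generated by a union is the image of a tensor product; the list of pairs
  represents a tensor.\<close>

lemma alg_Un_sum_products:
  assumes "f \<in> alg (S1 \<union> S2)"
  shows "\<exists>xs. set xs \<subseteq> alg S1 \<times> alg S2 \<and> (\<forall>z. f z = (\<Sum>(c, e)\<leftarrow>xs. c z * e z))"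
  using assms
proof induction
  case (gen f)
  show ?case
  proof (cases "f \<in> S1")
    case True
    show ?thesis by (rule exI[of _ "[(f, \<lambda>_. 1)]"]) (use True in \<open>auto intro: alg.intros\<close>)
  next
    case False
    show ?thesis by (rule exI[of _ "[(\<lambda>_. 1, f)]"]) (use False gen in \<open>auto intro: alg.intros\<close>)
  qed
next
  case (const c)
  show ?case by (rule exI[of _ "[(\<lambda>_. c, \<lambda>_. 1)]"]) (auto intro: alg.intros)
next
  case (add f g)
  then obtain xs ys where *: "set xs \<subseteq> alg S1 \<times> alg S2" "\<forall>z. f z = (\<Sum>(c, e)\<leftarrow>xs. c z * e z)"
    "set ys \<subseteq> alg S1 \<times> alg S2" "\<forall>z. g z = (\<Sum>(c, e)\<leftarrow>ys. c z * e z)" by auto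
  show ?case by (rule exI[of _ "xs @ ys"]) (use * in auto)
next
  case (mult f g)
  then obtain xs ys where *: "set xs \<subseteq> alg S1 \<times> alg S2" "\<forall>z. f z = (\<Sum>(c, e)\<leftarrow>xs. c z * e z)"
    "set ys \<subseteq> alg S1 \<times> alg S2" "\<forall>z. g z = (\<Sum>(c, e)\<leftarrow>ys. c z * e z)" by auto
  let ?m = "\<lambda>(c, e) (c', e'). (\<lambda>z. c z * c' z, \<lambda>z. e z * e' z)"
  have 1: "(\<Sum>(c, e)\<leftarrow>map (?m (a, b)) ys. c z * e z) = a z * b z * (\<Sum>(c, e)\<leftarrow>ys. c z * e z)" for a b z
    by (induction ys) (auto simp: algebra_simps)
  have 2: "(\<Sum>(c, e)\<leftarrow>concat (map (\<lambda>x. map (?m x) ys) xs). c z * e z) =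
      (\<Sum>(c, e)\<leftarrow>xs. c z * e z) * (\<Sum>(c, e)\<leftarrow>ys. c z * e z)" for z
  proof (induction xs)
    case (Cons x xs)
    obtain a b where x: "x = (a, b)" by force
    have "(\<Sum>(c, e)\<leftarrow>concat (map (\<lambda>x. map (?m x) ys) (x # xs)). c z * e z) =
      (\<Sum>(c, e)\<leftarrow>map (?m (a, b)) ys. c z * e z) + (\<Sum>(c, e)\<leftarrow>concat (map (\<lambda>x. map (?m x) ys) xs). c z * e z)"
      by (simp add: x)
    then show ?case unfolding 1 Cons.IH by (simp add: x algebra_simps)
  qed simp
  show ?case
  proof (rule exI[of _ "concat (map (\<lambda>x. map (?m x) ys) xs)"], intro conjI allI)
    show "set (concat (map (\<lambda>x. map (?m x) ys) xs)) \<subseteq> alg S1 \<times> alg S2"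
      using *(1,3) by (force intro: alg.mult)
  qed (use 2 * in simp)
qed

text \<open>A shortest representation as a sum of products has linearly independent left factors.\<close>

lemma linear_independent_sum_products:
  fixes c :: "'i \<Rightarrow> 'a \<Rightarrow> 'k::field"
  assumes "finite S" "\<And>z. f z = (\<Sum>k\<in>S. c k z * e k z)" "\<And>k. k \<in> S \<Longrightarrow> e k \<in> alg E"
  shows "\<exists>S' e'. S' \<subseteq> S \<and> (\<forall>z. f z = (\<Sum>k\<in>S'. c k z * e' k z)) \<and> (\<forall>k\<in>S'. e' k \<in> alg E) \<and>
    (\<forall>a. (\<forall>z. (\<Sum>k\<in>S'. a k * c k z) = 0) \<longrightarrow> (\<forall>k\<in>S'. a k = 0))"
  using assms
proof (induction "card S" arbitrary: S e rule: less_induct)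
  case less
  show ?case
  proof (cases "\<forall>a. (\<forall>z. (\<Sum>k\<in>S. a k * c k z) = 0) \<longrightarrow> (\<forall>k\<in>S. a k = 0)")
    case True
    then show ?thesis using less.prems by blast
  next
    case False
    then obtain a j where a: "\<And>z. (\<Sum>k\<in>S. a k * c k z) = 0" and j: "j \<in> S" "a j \<noteq> 0" by blast
    \<comment> \<open>The relation expresses \<open>c j\<close> through the other
      \<open>c k\<close>. Substituting it removes \<open>c j\<close> at the price of subtracting a
      multiple of \<open>e j\<close> from each \<open>e k\<close>, so the right factors stay in
      \<open>alg E\<close>.\<close>
    let ?e = "\<lambda>k z. e k z - (a k / a j) * e j z"
    have "f z = (\<Sum>k\<in>S-{j}. c k z * ?e k z)" for z
    proof -
      have "(\<Sum>k\<in>S. c k z * ?e k z) = (\<Sum>k\<in>S. c k z * e k z - (a k * c k z) * (e j z / a j))"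
        by (intro sum.cong refl) (simp add: algebra_simps)
      also have "\<dots> = f z - (\<Sum>k\<in>S. a k * c k z) * (e j z / a j)"
        unfolding sum_subtractf sum_distrib_right less.prems(2) ..
      also have "\<dots> = f z" using a by simp
      finally show ?thesis using less.prems(1) j by (simp add: sum.remove[of S j])
    qed
    moreover have "?e k \<in> alg E" if "k \<in> S - {j}" for k
      using that j less.prems(3) by (intro alg_diff alg.intros(2,4)) auto
    moreover have "card (S - {j}) < card S" using less.prems(1) j(1) by (rule card_Diff1_less)
    ultimately have "\<exists>S' e'. S' \<subseteq> S - {j} \<and> (\<forall>z. f z = (\<Sum>k\<in>S'. c k z * e' k z)) \<and> (\<forall>k\<in>S'. e' k \<in> alg E) \<and>
      (\<forall>a. (\<forall>z. (\<Sum>k\<in>S'. a k * c k z) = 0) \<longrightarrow> (\<forall>k\<in>S'. a k = 0))"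
      using less.prems(1) by (intro less.hyps) auto
    then obtain S' e' where S': "S' \<subseteq> S - {j}" "\<forall>z. f z = (\<Sum>k\<in>S'. c k z * e' k z)" "\<forall>k\<in>S'. e' k \<in> alg E"
      "\<forall>a. (\<forall>z. (\<Sum>k\<in>S'. a k * c k z) = 0) \<longrightarrow> (\<forall>k\<in>S'. a k = 0)"
      by (elim exE conjE)
    from S'(1) have "S' \<subseteq> S" by blast
    with S'(2-4) show ?thesis by (intro exI conjI)
  qed
qed

text \<open>The maps in \<open>\<Gamma>\<close> act on the second factor only. With linearly
  independent \<open>c k\<close>, invariance says that the combination of the \<open>c k y\<close>
  with coefficients \<open>e k (\<gamma> u) - e k u\<close> vanishes for all \<open>y\<close>, so
  each \<open>e k\<close> is invariant. \<open>merge\<close> lets \<open>y\<close> and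
  \<open>u\<close> be chosen independently; \<open>act2\<close> says that the effect of
  \<open>\<gamma>\<close> on the second kind of data depends on that data alone.\<close>

lemma alg_Un_invariant:
  fixes f :: "'a \<Rightarrow> 'k::field"
  assumes f: "f \<in> alg (S1 \<union> S2)"
    and merge: "\<And>y u. \<exists>z. (\<forall>s\<in>S1. s z = s y) \<and> (\<forall>s\<in>S2. s z = s u)"
    and act1: "\<And>\<gamma> s z. \<gamma> \<in> \<Gamma> \<Longrightarrow> s \<in> S1 \<Longrightarrow> s (\<gamma> z) = s z"
    and act2: "\<And>\<gamma> s z u. \<gamma> \<in> \<Gamma> \<Longrightarrow> (\<forall>s\<in>S2. s z = s u) \<Longrightarrow> s \<in> S2 \<Longrightarrow> s (\<gamma> z) = s (\<gamma> u)"
    and inv: "\<And>\<gamma> z. \<gamma> \<in> \<Gamma> \<Longrightarrow> f (\<gamma> z) = f z"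
  shows "f \<in> alg (S1 \<union> {e \<in> alg S2. \<forall>\<gamma>\<in>\<Gamma>. \<forall>z. e (\<gamma> z) = e z})"
proof -
  obtain xs where xs: "set xs \<subseteq> alg S1 \<times> alg S2" "\<And>z. f z = (\<Sum>(c, e)\<leftarrow>xs. c z * e z)"
    using alg_Un_sum_products[OF f] by blast
  define c where "c k = fst (xs ! k)" for k
  have c: "c k \<in> alg S1" and "snd (xs ! k) \<in> alg S2" if "k < length xs" for k
    using xs(1) nth_mem[OF that] by (auto simp: c_def mem_Times_iff)
  then obtain S e where S: "S \<subseteq> {..<length xs}" "\<And>z. f z = (\<Sum>k\<in>S. c k z * e k z)"
    "\<And>k. k \<in> S \<Longrightarrow> e k \<in> alg S2"
    "\<And>a k. (\<And>z. (\<Sum>k\<in>S. a k * c k z) = 0) \<Longrightarrow> k \<in> S \<Longrightarrow> a k = 0"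
    using linear_independent_sum_products[of "{..<length xs}" f c "\<lambda>k. snd (xs ! k)" S2]
    by (auto simp: xs(2) sum_list_sum_nth atLeast0LessThan c_def case_prod_unfold)
  have "e k (\<gamma> u) = e k u" if k: "k \<in> S" and \<gamma>: "\<gamma> \<in> \<Gamma>" for k \<gamma> u
  proof -
    have "(\<Sum>k\<in>S. (e k (\<gamma> u) - e k u) * c k y) = 0" for y
    proof -
      obtain z where z: "\<forall>s\<in>S1. s z = s y" "\<forall>s\<in>S2. s z = s u" using merge by blast
      have "e k (\<gamma> z) = e k (\<gamma> u)" "e k z = e k u" if "k \<in> S" for k
        using alg_cong_points[OF S(3)[OF that], of "\<gamma> z" "\<gamma> u"] act2[OF \<gamma> z(2)]
          alg_cong_points[OF S(3)[OF that], of z u] z(2) by auto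
      moreover have "c k (\<gamma> z) = c k y" "c k z = c k y" if "k \<in> S" for k
        using alg_cong_points[OF c[of k], of "\<gamma> z" z] alg_cong_points[OF c[of k], of z y] act1[OF \<gamma>] z(1) that S(1)
        by auto
      moreover have "(\<Sum>k\<in>S. c k (\<gamma> z) * e k (\<gamma> z)) = (\<Sum>k\<in>S. c k z * e k z)"
        using inv[OF \<gamma>, of z] by (simp add: S(2))
      ultimately have "(\<Sum>k\<in>S. c k y * e k (\<gamma> u)) = (\<Sum>k\<in>S. c k y * e k u)"
        by (auto cong: sum.cong)
      then show ?thesis by (simp add: algebra_simps sum_subtractf)
    qed
    from S(4)[of "\<lambda>k. e k (\<gamma> u) - e k u", OF this k] show ?thesis by simp
  qed
  then have "e k \<in> alg (S1 \<union> {e \<in> alg S2. \<forall>\<gamma>\<in>\<Gamma>. \<forall>z. e (\<gamma> z) = e z})" if "k \<in> S" for k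
    using that S(3) by (auto intro: alg.gen)
  moreover have "c k \<in> alg (S1 \<union> {e \<in> alg S2. \<forall>\<gamma>\<in>\<Gamma>. \<forall>z. e (\<gamma> z) = e z})" if "k \<in> S" for k
    using that S(1) by (intro alg_subset[OF c]) (auto intro: alg.gen)
  ultimately have "(\<lambda>z. \<Sum>k\<in>S. c k z * e k z) \<in> alg (S1 \<union> {e \<in> alg S2. \<forall>\<gamma>\<in>\<Gamma>. \<forall>z. e (\<gamma> z) = e z})"
    by (intro alg_sum alg.mult) auto
  then show ?thesis using S(2) by presburger
qed

section \<open>Invariants of two vectors in the hyperbolic plane\<close>

text \<open>The hypothesis is invariance under the reflections of the plane in the vectors with
  coordinates (s, 1). Two of them compose to a torus action, whose invariants are generated by the
  four products of an x with a y; the swap of x and y, which is the case \<open>s = 1\<close>, then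
  leaves only the symmetric ones.\<close>

lemma hyperbolic_plane_invariants:
  fixes h :: "('v \<Rightarrow> 'k::alg_closed_field) \<Rightarrow> 'k"
  assumes h: "h \<in> pf {x\<^sub>1, y\<^sub>1, x\<^sub>2, y\<^sub>2}" and dist: "distinct [x\<^sub>1, y\<^sub>1, x\<^sub>2, y\<^sub>2]"
    and inv: "\<And>s \<sigma>. s \<noteq> 0 \<Longrightarrow>
      h (\<sigma>(x\<^sub>1 := s * \<sigma> y\<^sub>1, y\<^sub>1 := \<sigma> x\<^sub>1 / s, x\<^sub>2 := s * \<sigma> y\<^sub>2, y\<^sub>2 := \<sigma> x\<^sub>2 / s)) = h \<sigma>"
  shows "h \<in> alg {\<lambda>\<sigma>. \<sigma> x\<^sub>1 * \<sigma> y\<^sub>1, \<lambda>\<sigma>. \<sigma> x\<^sub>2 * \<sigma> y\<^sub>2, \<lambda>\<sigma>. \<sigma> x\<^sub>1 * \<sigma> y\<^sub>2 + \<sigma> x\<^sub>2 * \<sigma> y\<^sub>1}"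
    (is "h \<in> alg ?A3")
proof -
  have dist': "x\<^sub>1 \<noteq> y\<^sub>1" "x\<^sub>1 \<noteq> x\<^sub>2" "x\<^sub>1 \<noteq> y\<^sub>2" "y\<^sub>1 \<noteq> x\<^sub>2" "y\<^sub>1 \<noteq> y\<^sub>2" "x\<^sub>2 \<noteq> y\<^sub>2"
    "y\<^sub>1 \<noteq> x\<^sub>1" "x\<^sub>2 \<noteq> x\<^sub>1" "y\<^sub>2 \<noteq> x\<^sub>1" "x\<^sub>2 \<noteq> y\<^sub>1" "y\<^sub>2 \<noteq> y\<^sub>1" "y\<^sub>2 \<noteq> x\<^sub>2"
    using dist by auto
  let ?A4 = "{\<lambda>\<sigma>. \<sigma> x\<^sub>1 * \<sigma> y\<^sub>1, \<lambda>\<sigma>. \<sigma> x\<^sub>2 * \<sigma> y\<^sub>2, \<lambda>\<sigma>. \<sigma> x\<^sub>1 * \<sigma> y\<^sub>2, \<lambda>\<sigma>. \<sigma> x\<^sub>2 * \<sigma> y\<^sub>1} :: (('v \<Rightarrow> 'k) \<Rightarrow> 'k) set"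
  have torus: "h (\<sigma>(x\<^sub>1 := s * \<sigma> x\<^sub>1, y\<^sub>1 := \<sigma> y\<^sub>1 / s, x\<^sub>2 := s * \<sigma> x\<^sub>2, y\<^sub>2 := \<sigma> y\<^sub>2 / s)) = h \<sigma>"
    if "s \<noteq> 0" for s \<sigma>
  proof -
    define \<tau> where "\<tau> = \<sigma>(x\<^sub>1 := \<sigma> y\<^sub>1, y\<^sub>1 := \<sigma> x\<^sub>1, x\<^sub>2 := \<sigma> y\<^sub>2, y\<^sub>2 := \<sigma> x\<^sub>2)"
    have "h (\<sigma>(x\<^sub>1 := s * \<sigma> x\<^sub>1, y\<^sub>1 := \<sigma> y\<^sub>1 / s, x\<^sub>2 := s * \<sigma> x\<^sub>2, y\<^sub>2 := \<sigma> y\<^sub>2 / s)) =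
      h (\<tau>(x\<^sub>1 := s * \<tau> y\<^sub>1, y\<^sub>1 := \<tau> x\<^sub>1 / s, x\<^sub>2 := s * \<tau> y\<^sub>2, y\<^sub>2 := \<tau> x\<^sub>2 / s))"
      by (rule arg_cong[of _ _ h]) (use dist' in \<open>auto simp: \<tau>_def fun_eq_iff\<close>)
    also have "\<dots> = h \<tau>" using that by (rule inv)
    also have "\<dots> = h \<sigma>" using inv[of 1 \<sigma>] by (simp add: \<tau>_def)
    finally show ?thesis .
  qed
  obtain p where p: "mvars p \<subseteq> {x\<^sub>1, y\<^sub>1, x\<^sub>2, y\<^sub>2}" "\<And>\<sigma>. h \<sigma> = peval p \<sigma>"
    using pf_imp_mpoly[OF h] by blast
  let ?l = "Poly_Mapping.lookup"
  let ?K = "Poly_Mapping.keys p"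
  have mono: "mono_eval \<sigma> t = \<sigma> x\<^sub>1 ^ ?l t x\<^sub>1 * (\<sigma> y\<^sub>1 ^ ?l t y\<^sub>1 * (\<sigma> x\<^sub>2 ^ ?l t x\<^sub>2 * \<sigma> y\<^sub>2 ^ ?l t y\<^sub>2))"
    if "t \<in> ?K" for t and \<sigma> :: "'v \<Rightarrow> 'k"
    by (subst mono_eval_superset[of "{x\<^sub>1, y\<^sub>1, x\<^sub>2, y\<^sub>2}"]) (use p(1) that dist' in \<open>auto simp: mvars_def\<close>)
  have hsum: "h \<sigma> = (\<Sum>t\<in>?K. ?l p t * mono_eval \<sigma> t)" for \<sigma>
    unfolding p(2) by (rule peval_superset) auto
  \<comment> \<open>The torus weight of a monomial may be negative. Adding \<open>M\<close>, which
    bounds the total degree in the two y variables, makes \<open>e t\<close> a natural number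
    without truncated subtraction.\<close>
  define M where "M = (\<Sum>t\<in>?K. ?l t y\<^sub>1 + ?l t y\<^sub>2)"
  have M: "?l t y\<^sub>1 + ?l t y\<^sub>2 \<le> M" if "t \<in> ?K" for t
    unfolding M_def using that by (intro member_le_sum) auto
  define e where "e t = M + ?l t x\<^sub>1 + ?l t x\<^sub>2 - ?l t y\<^sub>1 - ?l t y\<^sub>2" for t
  have hbal: "h \<sigma> = (\<Sum>t\<in>{t\<in>?K. e t = M}. ?l p t * mono_eval \<sigma> t)" for \<sigma>
  proof (rule power_sum_coeff[symmetric])
    fix s :: 'k assume s: "s \<noteq> 0"
    let ?\<sigma> = "\<sigma>(x\<^sub>1 := s * \<sigma> x\<^sub>1, y\<^sub>1 := \<sigma> y\<^sub>1 / s, x\<^sub>2 := s * \<sigma> x\<^sub>2, y\<^sub>2 := \<sigma> y\<^sub>2 / s)"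
    have "mono_eval ?\<sigma> t * s ^ M = mono_eval \<sigma> t * s ^ e t" if t: "t \<in> ?K" for t
    proof -
      have "e t + ?l t y\<^sub>1 + ?l t y\<^sub>2 = M + ?l t x\<^sub>1 + ?l t x\<^sub>2" using M[OF t] by (simp add: e_def)
      then have "s ^ e t * (s ^ ?l t y\<^sub>1 * s ^ ?l t y\<^sub>2) = s ^ M * (s ^ ?l t x\<^sub>1 * s ^ ?l t x\<^sub>2)"
        by (metis power_add mult.assoc)
      then show ?thesis
        unfolding mono[OF t] using dist' s by (simp add: power_mult_distrib power_divide field_simps)
    qed
    then have "(\<Sum>t\<in>?K. ?l p t * mono_eval \<sigma> t * s ^ e t) = (\<Sum>t\<in>?K. ?l p t * mono_eval ?\<sigma> t * s ^ M)"
      by (intro sum.cong refl) (simp add: mult.assoc)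
    also have "\<dots> = h ?\<sigma> * s ^ M" by (simp add: hsum sum_distrib_right)
    finally show "(\<Sum>t\<in>?K. ?l p t * mono_eval \<sigma> t * s ^ e t) = h \<sigma> * s ^ M"
      using torus[OF s] by simp
  qed simp
  have "(\<lambda>\<sigma>. ?l p t * mono_eval \<sigma> t) \<in> alg ?A4" if t: "t \<in> ?K" "e t = M" for t
  proof -
    have bal: "?l t x\<^sub>1 + ?l t x\<^sub>2 = ?l t y\<^sub>1 + ?l t y\<^sub>2" using t(2) M[OF t(1)] by (simp add: e_def)
    have gens: "(\<lambda>\<sigma>. \<sigma> x\<^sub>1 * \<sigma> y\<^sub>1) \<in> alg ?A4" "(\<lambda>\<sigma>. \<sigma> x\<^sub>2 * \<sigma> y\<^sub>2) \<in> alg ?A4"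
      "(\<lambda>\<sigma>. \<sigma> x\<^sub>1 * \<sigma> y\<^sub>2) \<in> alg ?A4" "(\<lambda>\<sigma>. \<sigma> x\<^sub>2 * \<sigma> y\<^sub>1) \<in> alg ?A4"
      by (auto intro: alg.gen)
    have "(\<lambda>\<sigma>. mono_eval \<sigma> t) \<in> alg ?A4"
    proof (cases "?l t y\<^sub>1 \<le> ?l t x\<^sub>1")
      case True
      then obtain d where d: "?l t x\<^sub>1 = ?l t y\<^sub>1 + d" using le_Suc_ex by blast
      then have d2: "?l t y\<^sub>2 = ?l t x\<^sub>2 + d" using bal by simp
      have "(\<lambda>\<sigma> :: 'v \<Rightarrow> 'k. mono_eval \<sigma> t) =
          (\<lambda>\<sigma>. (\<sigma> x\<^sub>1 * \<sigma> y\<^sub>1) ^ ?l t y\<^sub>1 * ((\<sigma> x\<^sub>2 * \<sigma> y\<^sub>2) ^ ?l t x\<^sub>2 * (\<sigma> x\<^sub>1 * \<sigma> y\<^sub>2) ^ d))"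
        unfolding mono[OF t(1)] d d2 by (simp add: power_add power_mult_distrib ac_simps)
      then show ?thesis by (simp only:) (intro alg.mult alg_power gens)
    next
      case False
      then obtain d where d: "?l t y\<^sub>1 = ?l t x\<^sub>1 + d" using le_Suc_ex nat_le_linear by blast
      then have d2: "?l t x\<^sub>2 = ?l t y\<^sub>2 + d" using bal by simp
      have "(\<lambda>\<sigma> :: 'v \<Rightarrow> 'k. mono_eval \<sigma> t) =
          (\<lambda>\<sigma>. (\<sigma> x\<^sub>1 * \<sigma> y\<^sub>1) ^ ?l t x\<^sub>1 * ((\<sigma> x\<^sub>2 * \<sigma> y\<^sub>2) ^ ?l t y\<^sub>2 * (\<sigma> x\<^sub>2 * \<sigma> y\<^sub>1) ^ d))"
        unfolding mono[OF t(1)] d d2 by (simp add: power_add power_mult_distrib ac_simps)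
      then show ?thesis by (simp only:) (intro alg.mult alg_power gens)
    qed
    then show ?thesis by (intro alg.mult alg.const)
  qed
  then have "(\<lambda>\<sigma>. \<Sum>t\<in>{t\<in>?K. e t = M}. ?l p t * mono_eval \<sigma> t) \<in> alg ?A4"
    by (intro alg_sum) auto
  then have h4: "h \<in> alg ?A4" using hbal by presburger
  \<comment> \<open>The product \<open>\<sigma> x\<^sub>1 * \<sigma> y\<^sub>2\<close> satisfies X^2
    = B X - Q1 Q2, with Q1, Q2 the norms and B the mixed generator, so over \<open>alg ?A3\<close>
    its powers reduce to 1 and itself.\<close>
  have "\<exists>F\<in>alg ?A3. \<exists>G\<in>alg ?A3. \<forall>\<sigma>. h \<sigma> = F \<sigma> + \<sigma> x\<^sub>1 * \<sigma> y\<^sub>2 * G \<sigma>"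
    using h4
  proof induction
    case (gen f)
    then consider "f \<in> ?A3" | "f = (\<lambda>\<sigma>. \<sigma> x\<^sub>1 * \<sigma> y\<^sub>2)" | "f = (\<lambda>\<sigma>. \<sigma> x\<^sub>2 * \<sigma> y\<^sub>1)" by auto
    then show ?case
    proof cases
      case 1
      then show ?thesis by (intro bexI[of _ f] bexI[of _ "\<lambda>_. 0"]) (auto intro: alg.const alg.gen)
    next
      case 2
      then show ?thesis by (intro bexI[of _ "\<lambda>_. 0"] bexI[of _ "\<lambda>_. 1"]) (auto intro: alg.const)
    next
      case 3
      then show ?thesis
        by (intro bexI[of _ "\<lambda>\<sigma>. \<sigma> x\<^sub>1 * \<sigma> y\<^sub>2 + \<sigma> x\<^sub>2 * \<sigma> y\<^sub>1"] bexI[of _ "\<lambda>_. -1"]) (auto intro: alg.const alg.gen)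
    qed
  next
    case (const c)
    show ?case by (rule bexI[of _ "\<lambda>_. c"], rule bexI[of _ "\<lambda>_. 0"]) (auto intro: alg.const)
  next
    case (add f g)
    obtain F G where F: "F \<in> alg ?A3" "G \<in> alg ?A3" "\<And>\<sigma>. f \<sigma> = F \<sigma> + \<sigma> x\<^sub>1 * \<sigma> y\<^sub>2 * G \<sigma>" using add.IH(1) by blast
    obtain F' G' where F': "F' \<in> alg ?A3" "G' \<in> alg ?A3" "\<And>\<sigma>. g \<sigma> = F' \<sigma> + \<sigma> x\<^sub>1 * \<sigma> y\<^sub>2 * G' \<sigma>" using add.IH(2) by blast
    show ?case
      by (rule bexI[of _ "\<lambda>\<sigma>. F \<sigma> + F' \<sigma>"], rule bexI[of _ "\<lambda>\<sigma>. G \<sigma> + G' \<sigma>"])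
        (auto simp: F(3) F'(3) algebra_simps intro!: alg.add F(1,2) F'(1,2))
  next
    case (mult f g)
    obtain F G where F: "F \<in> alg ?A3" "G \<in> alg ?A3" "\<And>\<sigma>. f \<sigma> = F \<sigma> + \<sigma> x\<^sub>1 * \<sigma> y\<^sub>2 * G \<sigma>" using mult.IH(1) by blast
    obtain F' G' where F': "F' \<in> alg ?A3" "G' \<in> alg ?A3" "\<And>\<sigma>. g \<sigma> = F' \<sigma> + \<sigma> x\<^sub>1 * \<sigma> y\<^sub>2 * G' \<sigma>" using mult.IH(2) by blast
    have gens: "(\<lambda>\<sigma>. \<sigma> x\<^sub>1 * \<sigma> y\<^sub>1) \<in> alg ?A3" "(\<lambda>\<sigma>. \<sigma> x\<^sub>2 * \<sigma> y\<^sub>2) \<in> alg ?A3"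
      "(\<lambda>\<sigma>. \<sigma> x\<^sub>1 * \<sigma> y\<^sub>2 + \<sigma> x\<^sub>2 * \<sigma> y\<^sub>1) \<in> alg ?A3"
      by (auto intro: alg.gen)
    show ?case
    proof (rule bexI[of _ "\<lambda>\<sigma>. F \<sigma> * F' \<sigma> - (\<sigma> x\<^sub>1 * \<sigma> y\<^sub>1) * (\<sigma> x\<^sub>2 * \<sigma> y\<^sub>2) * (G \<sigma> * G' \<sigma>)"],
        rule bexI[of _ "\<lambda>\<sigma>. F \<sigma> * G' \<sigma> + G \<sigma> * F' \<sigma> + (\<sigma> x\<^sub>1 * \<sigma> y\<^sub>2 + \<sigma> x\<^sub>2 * \<sigma> y\<^sub>1) * (G \<sigma> * G' \<sigma>)"], intro allI)
      fix \<sigma>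
      show "f \<sigma> * g \<sigma> = F \<sigma> * F' \<sigma> - \<sigma> x\<^sub>1 * \<sigma> y\<^sub>1 * (\<sigma> x\<^sub>2 * \<sigma> y\<^sub>2) * (G \<sigma> * G' \<sigma>) +
        \<sigma> x\<^sub>1 * \<sigma> y\<^sub>2 * (F \<sigma> * G' \<sigma> + G \<sigma> * F' \<sigma> + (\<sigma> x\<^sub>1 * \<sigma> y\<^sub>2 + \<sigma> x\<^sub>2 * \<sigma> y\<^sub>1) * (G \<sigma> * G' \<sigma>))"
        unfolding F(3) F'(3) by (simp only: algebra_simps)
    qed (intro alg.add alg.mult alg_diff gens F(1,2) F'(1,2))+
  qed
  then obtain F G where F: "F \<in> alg ?A3" and G: "G \<in> alg ?A3" and
    h': "\<And>\<sigma>. h \<sigma> = F \<sigma> + \<sigma> x\<^sub>1 * \<sigma> y\<^sub>2 * G \<sigma>" by blast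
  have vars: "s \<in> ?A3 \<Longrightarrow> s \<in> pf UNIV" for s by (auto intro!: pf_intros)
  \<comment> \<open>The swap fixes \<open>F\<close>, \<open>G\<close> and \<open>h\<close> but
    exchanges the two mixed products, so \<open>G\<close> vanishes wherever these differ.\<close>
  have "\<sigma> x\<^sub>1 * \<sigma> y\<^sub>2 * G \<sigma> = 0" for \<sigma>
  proof (rule pf_density[where D = "\<lambda>\<sigma>. \<sigma> x\<^sub>1 * \<sigma> y\<^sub>2 - \<sigma> x\<^sub>2 * \<sigma> y\<^sub>1" and X = UNIV and Y = UNIV
        and h = "\<lambda>\<sigma>. \<sigma> x\<^sub>1 * \<sigma> y\<^sub>2 * G \<sigma>" and \<sigma>\<^sub>0 = "\<lambda>x. if x = x\<^sub>1 \<or> x = y\<^sub>2 then 1 else 0"])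
    have "G \<in> pf UNIV" unfolding pf_def by (rule alg_subset[OF G]) (use vars in \<open>auto simp: pf_def\<close>)
    then show "(\<lambda>\<sigma>. \<sigma> x\<^sub>1 * \<sigma> y\<^sub>2 * G \<sigma>) \<in> pf UNIV" by (intro pf_intros) auto
    fix \<sigma> :: "'v \<Rightarrow> 'k"
    assume D: "\<sigma> x\<^sub>1 * \<sigma> y\<^sub>2 - \<sigma> x\<^sub>2 * \<sigma> y\<^sub>1 \<noteq> 0"
    define \<tau> where "\<tau> = \<sigma>(x\<^sub>1 := \<sigma> y\<^sub>1, y\<^sub>1 := \<sigma> x\<^sub>1, x\<^sub>2 := \<sigma> y\<^sub>2, y\<^sub>2 := \<sigma> x\<^sub>2)"
    have "s \<tau> = s \<sigma>" if "s \<in> ?A3" for s using that dist' by (auto simp: \<tau>_def)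
    then have "F \<tau> = F \<sigma>" "G \<tau> = G \<sigma>"
      using alg_cong_points[OF F] alg_cong_points[OF G] by blast+
    moreover have "h \<tau> = h \<sigma>" using inv[of 1 \<sigma>] by (simp add: \<tau>_def)
    moreover have "\<tau> x\<^sub>1 * \<tau> y\<^sub>2 = \<sigma> x\<^sub>2 * \<sigma> y\<^sub>1" using dist' by (simp add: \<tau>_def)
    ultimately have "\<sigma> x\<^sub>2 * \<sigma> y\<^sub>1 * G \<sigma> = \<sigma> x\<^sub>1 * \<sigma> y\<^sub>2 * G \<sigma>"
      unfolding h' by (metis add_left_cancel)
    then have "(\<sigma> x\<^sub>1 * \<sigma> y\<^sub>2 - \<sigma> x\<^sub>2 * \<sigma> y\<^sub>1) * G \<sigma> = 0"
      by (simp only: left_diff_distrib diff_self)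
    with D show "\<sigma> x\<^sub>1 * \<sigma> y\<^sub>2 * G \<sigma> = 0" by simp
  qed (use dist' in \<open>auto intro!: pf_intros\<close>)
  then have "h = F" by (simp add: h' fun_eq_iff)
  then show ?thesis using F by simp
qed

section \<open>Quadratic forms and reflections in characteristic two\<close>

locale char2_forms =
  fixes N :: nat and \<epsilon> :: bool and ty :: "'k::alg_closed_field itself"
  assumes two_eq_0 [simp]: "(2::'k) = 0"
begin

lemma add_self [simp]: "x + x = 0" for x :: 'k
  using two_eq_0 by (metis mult_2 mult_zero_left)

lemma add_self_left [simp]: "x + (x + y) = y" for x :: 'k
  by (simp flip: add.assoc)

lemma uminus_eq [simp]: "- x = x" for x :: 'k
  using add_self[of x] by (simp add: neg_eq_iff_add_eq_0)

lemma diff_eq_add: "x - y = x + y" for x :: 'k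
  by (simp add: diff_conv_add_uminus del: add_uminus_conv_diff)

lemma eq_iff_add_eq_0: "x = y \<longleftrightarrow> x + y = 0" for x :: 'k
  by (metis add_self add_self_left add.right_neutral)

lemma square_add: "(x + y)\<^sup>2 = x\<^sup>2 + y\<^sup>2" for x :: 'k
  by (simp add: power2_sum two_eq_0)

text \<open>
  At level \<open>r \<le> N\<close> only the coordinates \<open>x\<^sub>t, y\<^sub>t\<close> with \<open>t < r\<close>, stored at \<open>t\<close> and \<open>N + t\<close>, are used, together
  with \<open>z\<close>, stored at \<open>2N\<close>, if \<open>\<epsilon>\<close> holds. The induction of the main argument is on \<open>r\<close> for fixed \<open>N\<close>, so
  that no coordinate has to be renumbered.
\<close>

definition q :: "nat \<Rightarrow> (nat \<Rightarrow> 'k) \<Rightarrow> 'k"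
  where "q r v = (\<Sum>t<r. v t * v (N + t)) + (if \<epsilon> then (v (2 * N))\<^sup>2 else 0)"

definition bil :: "nat \<Rightarrow> (nat \<Rightarrow> 'k) \<Rightarrow> (nat \<Rightarrow> 'k) \<Rightarrow> 'k"
  where "bil r u v = (\<Sum>t<r. u t * v (N + t) + u (N + t) * v t)"

definition C :: "nat \<Rightarrow> nat set"
  where "C r = {..<r} \<union> {N..<N+r} \<union> (if \<epsilon> then {2 * N} else {})"

definition row :: "(nat \<times> nat \<Rightarrow> 'k) \<Rightarrow> nat \<Rightarrow> nat \<Rightarrow> 'k"
  where "row \<sigma> i = (\<lambda>c. \<sigma> (i, c))"

text \<open>The orthogonal reflection in \<open>u\<close>, applied to all rows at once; in
  characteristic 2 it is a transvection and its usual minus sign disappears.\<close>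

definition refl :: "nat \<Rightarrow> (nat \<Rightarrow> 'k) \<Rightarrow> (nat \<times> nat \<Rightarrow> 'k) \<Rightarrow> nat \<times> nat \<Rightarrow> 'k"
  where "refl r u \<sigma> = (\<lambda>(i, c). \<sigma> (i, c) + bil r u (row \<sigma> i) / q r u * u c)"

text \<open>Since \<open>bil\<close> vanishes on the diagonal, the diagonal entries are free to hold
  the values of \<open>q\<close>, which \<open>bil\<close> does not determine. \<open>I m\<close>
  then lists each generator once.\<close>

definition qb :: "nat \<Rightarrow> (nat \<times> nat \<Rightarrow> 'k) \<Rightarrow> nat \<times> nat \<Rightarrow> 'k"
  where "qb r \<sigma> = (\<lambda>(i, j). if i = j then q r (row \<sigma> i) else bil r (row \<sigma> i) (row \<sigma> j))"

definition I :: "nat \<Rightarrow> (nat \<times> nat) set"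
  where "I m = {(i, j). i \<le> j \<and> j < m}"

text \<open>The support condition keeps reflections of level \<open>r\<close> from moving
  coordinates outside \<open>C r\<close>; by \<open>refl_Suc\<close> they are then also reflections
  of the next level.\<close>

definition reflection_invariant :: "nat \<Rightarrow> ((nat \<times> nat \<Rightarrow> 'k) \<Rightarrow> 'k) \<Rightarrow> bool"
  where "reflection_invariant r f \<longleftrightarrow>
    (\<forall>u. (\<forall>c. c \<notin> C r \<longrightarrow> u c = 0) \<longrightarrow> q r u \<noteq> 0 \<longrightarrow> (\<forall>\<sigma>. f (refl r u \<sigma>) = f \<sigma>))"

lemma row_apply [simp]: "row \<sigma> i c = \<sigma> (i, c)"
  by (simp add: row_def)

lemma refl_apply: "refl r u \<sigma> (i, c) = \<sigma> (i, c) + bil r u (row \<sigma> i) / q r u * u c"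
  by (simp add: refl_def)

lemma row_refl: "row (refl r u \<sigma>) i = (\<lambda>c. row \<sigma> i c + bil r u (row \<sigma> i) / q r u * u c)"
  by (simp add: fun_eq_iff refl_apply)

lemma bil_self [simp]: "bil r u u = 0"
  by (simp add: bil_def mult.commute)

lemma bil_sym: "bil r u v = bil r v u"
  by (simp add: bil_def algebra_simps)

lemma bil_add_scaled_right: "bil r u (\<lambda>c. v c + a * w c) = bil r u v + a * bil r u w"
  by (simp add: bil_def sum.distrib sum_distrib_left algebra_simps)

lemma bil_add_scaled_left: "bil r (\<lambda>c. v c + a * w c) u = bil r v u + a * bil r w u"
  using bil_add_scaled_right[of r u v a w] by (simp add: bil_sym)

lemma q_add_scaled: "q r (\<lambda>c. v c + a * u c) = q r v + a * bil r u v + a\<^sup>2 * q r u"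
proof -
  have "(\<Sum>t<r. (v t + a * u t) * (v (N + t) + a * u (N + t))) =
    (\<Sum>t<r. v t * v (N + t) + a * (u t * v (N + t) + u (N + t) * v t) + a\<^sup>2 * (u t * u (N + t)))"
    by (intro sum.cong refl) (simp add: algebra_simps power2_eq_square)
  then show ?thesis
    by (simp add: q_def bil_def sum.distrib sum_distrib_left square_add power_mult_distrib algebra_simps)
qed

lemma q_cong: "(\<And>c. c \<in> C r \<Longrightarrow> v c = w c) \<Longrightarrow> q r v = q r w"
  by (auto simp: q_def C_def intro!: sum.cong)

lemma bil_cong: "(\<And>c. c \<in> C r \<Longrightarrow> v c = w c) \<Longrightarrow> (\<And>c. c \<in> C r \<Longrightarrow> v' c = w' c) \<Longrightarrow> bil r v v' = bil r w w'"
  by (auto simp: bil_def C_def intro!: sum.cong)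

lemma q_zero: "(\<And>c. c \<in> C r \<Longrightarrow> v c = 0) \<Longrightarrow> q r v = 0"
  using q_cong[of r v "\<lambda>_. 0"] by (simp add: q_def)

lemma bil_zero_right: "(\<And>c. c \<in> C r \<Longrightarrow> v c = 0) \<Longrightarrow> bil r u v = 0"
  using bil_cong[of r u u v "\<lambda>_. 0"] by (simp add: bil_def)

lemma q_refl: "q r u \<noteq> 0 \<Longrightarrow> q r (row (refl r u \<sigma>) i) = q r (row \<sigma> i)"
  unfolding row_refl q_add_scaled by (simp add: power2_eq_square del: row_apply)

lemma bil_refl: "q r u \<noteq> 0 \<Longrightarrow> bil r (row (refl r u \<sigma>) i) (row (refl r u \<sigma>) j) = bil r (row \<sigma> i) (row \<sigma> j)"
  unfolding row_refl bil_add_scaled_left bil_add_scaled_right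
  by (simp add: bil_sym[of r "row \<sigma> i" u] mult.commute del: row_apply)

lemma qb_refl: "q r u \<noteq> 0 \<Longrightarrow> qb r (refl r u \<sigma>) = qb r \<sigma>"
  by (auto simp: qb_def fun_eq_iff q_refl bil_refl)

lemma q_Suc: "q (Suc r) v = q r v + v r * v (N + r)"
  by (simp add: q_def)

lemma bil_Suc: "bil (Suc r) u v = bil r u v + (u r * v (N + r) + u (N + r) * v r)"
  by (simp add: bil_def)

lemma C_Suc: "C (Suc r) = insert r (insert (N + r) (C r))"
  by (auto simp: C_def)

lemma not_in_C: "r < N \<Longrightarrow> r \<notin> C r" "r < N \<Longrightarrow> N + r \<notin> C r"
  by (auto simp: C_def)

lemma refl_Suc:
  assumes "r < N" "\<And>c. c \<notin> C r \<Longrightarrow> u c = 0"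
  shows "q (Suc r) u = q r u" "refl (Suc r) u = refl r u"
  using assms not_in_C[OF assms(1)] by (auto simp: q_Suc bil_Suc refl_def fun_eq_iff)

lemma q_row_pf: "{i} \<times> C r \<subseteq> X \<Longrightarrow> (\<lambda>\<sigma>. q r (row \<sigma> i)) \<in> pf X"
  unfolding q_def C_def by (cases \<epsilon>) (auto intro!: pf_intros)

lemma bil_row_pf: "{i, j} \<times> C r \<subseteq> X \<Longrightarrow> (\<lambda>\<sigma>. bil r (row \<sigma> i) (row \<sigma> j)) \<in> pf X"
  by (auto simp: bil_def C_def intro!: pf_intros)

lemma qb_pf: "ij \<in> I m \<Longrightarrow> {..<m} \<times> C r \<subseteq> X \<Longrightarrow> (\<lambda>\<sigma>. qb r \<sigma> ij) \<in> pf X"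
  by (cases "fst ij = snd ij") (auto simp: qb_def I_def intro!: q_row_pf bil_row_pf subsetD[of "{..<m} \<times> C r" X])

lemma qb_cong:
  "ij \<in> I m \<Longrightarrow> (\<And>i c. i < m \<Longrightarrow> c \<in> C r \<Longrightarrow> \<sigma> (i, c) = \<tau> (i, c)) \<Longrightarrow> qb r \<sigma> ij = qb r \<tau> ij"
  by (auto simp: qb_def I_def intro!: q_cong bil_cong)

lemma reflection_invariantD:
  "reflection_invariant r f \<Longrightarrow> (\<And>c. c \<notin> C r \<Longrightarrow> u c = 0) \<Longrightarrow> q r u \<noteq> 0 \<Longrightarrow> f (refl r u \<sigma>) = f \<sigma>"
  by (auto simp: reflection_invariant_def)

section \<open>Tuples with two vectors in a plane\<close>

text \<open>
  The argument of \<open>\<Phi> r\<close> stores \<open>w\<^sub>1, w\<^sub>2\<close> in the plane coordinates of the rows \<open>2r, 2r + 1\<close> and \<open>a\<^sub>i, b\<^sub>i\<close> in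
  the plane coordinates of the rows \<open>i < 2r\<close>, whose other coordinates are those of \<open>u\<^sub>i\<close>.
\<close>

definition \<Phi> :: "nat \<Rightarrow> (nat \<times> nat \<Rightarrow> 'k) \<Rightarrow> nat \<times> nat \<Rightarrow> 'k"
  where "\<Phi> r \<sigma> = (\<lambda>(i, c).
    if i < 2 * r then
      (if c = r then \<sigma> (i, r) * \<sigma> (2 * r, r) + \<sigma> (i, N + r) * \<sigma> (2 * r + 1, r)
       else if c = N + r then \<sigma> (i, r) * \<sigma> (2 * r, N + r) + \<sigma> (i, N + r) * \<sigma> (2 * r + 1, N + r)
       else \<sigma> (i, c))
    else if c = r \<or> c = N + r then \<sigma> (i, c) else 0)"

text \<open>In characteristic 2 the polar form of two plane vectors is also the determinant of their
  coordinates, so the denominator is nonzero exactly when the two vectors span the plane.\<close>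

definition plane_det :: "nat \<Rightarrow> (nat \<times> nat \<Rightarrow> 'k) \<Rightarrow> 'k"
  where "plane_det r \<sigma> = \<sigma> (2 * r, r) * \<sigma> (2 * r + 1, N + r) + \<sigma> (2 * r + 1, r) * \<sigma> (2 * r, N + r)"

lemma q_row_\<Phi>:
  assumes "r < N" "i < 2 * r"
  shows "q r (row (\<Phi> r \<sigma>) i) = q r (row \<sigma> i)"
  by (rule q_cong) (use not_in_C[OF assms(1)] assms(2) in \<open>auto simp: \<Phi>_def\<close>)

lemma q_row_\<Phi>_plane:
  assumes "r < N" "\<not> i < 2 * r"
  shows "q r (row (\<Phi> r \<sigma>) i) = 0"
  by (rule q_zero) (use not_in_C[OF assms(1)] assms(2) in \<open>auto simp: \<Phi>_def\<close>)

lemma bil_row_\<Phi>: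
  assumes "r < N" "i < 2 * r" "j < 2 * r"
  shows "bil r (row (\<Phi> r \<sigma>) i) (row (\<Phi> r \<sigma>) j) = bil r (row \<sigma> i) (row \<sigma> j)"
  by (rule bil_cong) (use not_in_C[OF assms(1)] assms(2,3) in \<open>auto simp: \<Phi>_def\<close>)

lemma bil_row_\<Phi>_plane:
  assumes "r < N" "\<not> i < 2 * r"
  shows "bil r u (row (\<Phi> r \<sigma>) i) = 0"
  by (rule bil_zero_right) (use not_in_C[OF assms(1)] assms(2) in \<open>auto simp: \<Phi>_def\<close>)

lemma qb_\<Phi>_plane:
  assumes r: "r < N"
  shows
    "qb (Suc r) (\<Phi> r \<sigma>) (2 * r, 2 * r) = \<sigma> (2 * r, r) * \<sigma> (2 * r, N + r)"
    "qb (Suc r) (\<Phi> r \<sigma>) (Suc (2 * r), Suc (2 * r)) = \<sigma> (Suc (2 * r), r) * \<sigma> (Suc (2 * r), N + r)"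
    "qb (Suc r) (\<Phi> r \<sigma>) (2 * r, Suc (2 * r)) = plane_det r \<sigma>"
proof -
  note [simp] = q_row_\<Phi>[OF r] q_row_\<Phi>_plane[OF r] bil_row_\<Phi>[OF r] bil_row_\<Phi>_plane[OF r]
  have [simp]: "N \<noteq> 0" "N + r \<noteq> r" using r by auto
  show "qb (Suc r) (\<Phi> r \<sigma>) (2 * r, 2 * r) = \<sigma> (2 * r, r) * \<sigma> (2 * r, N + r)"
    "qb (Suc r) (\<Phi> r \<sigma>) (Suc (2 * r), Suc (2 * r)) = \<sigma> (Suc (2 * r), r) * \<sigma> (Suc (2 * r), N + r)"
    by (simp_all add: qb_def q_Suc) (simp_all add: \<Phi>_def)
  show "qb (Suc r) (\<Phi> r \<sigma>) (2 * r, Suc (2 * r)) = plane_det r \<sigma>"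
    by (simp add: qb_def bil_Suc plane_det_def) (simp add: \<Phi>_def algebra_simps)
qed

text \<open>Pairing row \<open>i\<close> with w_1 kills its component along w_1 and leaves b_i times
  the determinant, and likewise a_i for w_2; hence the crossed positions.\<close>

lemma qb_\<Phi>:
  assumes r: "r < N" and i: "i < 2 * r" and j: "j < 2 * r"
  shows
    "qb (Suc r) (\<Phi> r \<sigma>) (i, 2 * r) = plane_det r \<sigma> * \<sigma> (i, N + r)"
    "qb (Suc r) (\<Phi> r \<sigma>) (i, Suc (2 * r)) = plane_det r \<sigma> * \<sigma> (i, r)"
    "qb (Suc r) (\<Phi> r \<sigma>) (i, i) = qb r \<sigma> (i, i)
      + ((\<sigma> (i, r))\<^sup>2 * (\<sigma> (2 * r, r) * \<sigma> (2 * r, N + r))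
      + (\<sigma> (i, N + r))\<^sup>2 * (\<sigma> (Suc (2 * r), r) * \<sigma> (Suc (2 * r), N + r))
      + \<sigma> (i, r) * \<sigma> (i, N + r) * plane_det r \<sigma>)"
    "i \<noteq> j \<Longrightarrow> qb (Suc r) (\<Phi> r \<sigma>) (i, j) = qb r \<sigma> (i, j)
      + (\<sigma> (i, r) * \<sigma> (j, N + r) + \<sigma> (j, r) * \<sigma> (i, N + r)) * plane_det r \<sigma>"
proof -
  note [simp] = q_row_\<Phi>[OF r] q_row_\<Phi>_plane[OF r] bil_row_\<Phi>[OF r] bil_row_\<Phi>_plane[OF r]
  have [simp]: "N \<noteq> 0" "N + r \<noteq> r" using r by auto
  show "qb (Suc r) (\<Phi> r \<sigma>) (i, 2 * r) = plane_det r \<sigma> * \<sigma> (i, N + r)"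
    "qb (Suc r) (\<Phi> r \<sigma>) (i, Suc (2 * r)) = plane_det r \<sigma> * \<sigma> (i, r)"
    using i by (simp_all add: qb_def bil_Suc plane_det_def) (simp_all add: \<Phi>_def algebra_simps)
  show "qb (Suc r) (\<Phi> r \<sigma>) (i, i) = qb r \<sigma> (i, i)
      + ((\<sigma> (i, r))\<^sup>2 * (\<sigma> (2 * r, r) * \<sigma> (2 * r, N + r))
      + (\<sigma> (i, N + r))\<^sup>2 * (\<sigma> (Suc (2 * r), r) * \<sigma> (Suc (2 * r), N + r))
      + \<sigma> (i, r) * \<sigma> (i, N + r) * plane_det r \<sigma>)"
    using i by (simp add: qb_def q_Suc plane_det_def) (simp add: \<Phi>_def algebra_simps power2_eq_square)
  show "qb (Suc r) (\<Phi> r \<sigma>) (i, j) = qb r \<sigma> (i, j)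
      + (\<sigma> (i, r) * \<sigma> (j, N + r) + \<sigma> (j, r) * \<sigma> (i, N + r)) * plane_det r \<sigma>" if "i \<noteq> j"
    using i j that by (simp add: qb_def bil_Suc plane_det_def) (simp add: \<Phi>_def algebra_simps)
qed

definition plane_gens :: "nat \<Rightarrow> ((nat \<times> nat \<Rightarrow> 'k) \<Rightarrow> 'k) set"
  where "plane_gens r = {\<lambda>\<sigma>. \<sigma> (2 * r, r) * \<sigma> (2 * r, N + r),
    \<lambda>\<sigma>. \<sigma> (Suc (2 * r), r) * \<sigma> (Suc (2 * r), N + r),
    \<lambda>\<sigma>. \<sigma> (2 * r, r) * \<sigma> (Suc (2 * r), N + r) + \<sigma> (Suc (2 * r), r) * \<sigma> (2 * r, N + r)}"

text \<open>The composition depends on three groups of parameters: the a_i and b_i, the u_i, and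
  w_1, w_2. A reflection of level \<open>r\<close> moves only the u_i. A reflection of the plane
  moves only w_1 and w_2, since a linear map carries a_i w_1 + b_i w_2 to the same combination of
  the images. So \<open>alg_Un_invariant\<close> applies twice.\<close>

lemma pf_\<Phi>_alg:
  assumes r: "r < N"
    and IH: "\<And>f. f \<in> pf ({..<2 * r} \<times> C r) \<Longrightarrow> reflection_invariant r f \<Longrightarrow> f \<in> alg ((\<lambda>ij \<sigma>. qb r \<sigma> ij) ` I (2 * r))"
    and f: "f \<in> pf ({..<2 * Suc r} \<times> C (Suc r))" and inv: "reflection_invariant (Suc r) f"
  shows "(\<lambda>\<sigma>. f (\<Phi> r \<sigma>)) \<in> alg
    ((\<lambda>x \<sigma>. \<sigma> x) ` ({..<2 * r} \<times> {r, N + r}) \<union> (\<lambda>ij \<sigma>. qb r \<sigma> ij) ` I (2 * r) \<union> plane_gens r)"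
proof -
  let ?co = "\<lambda>X. (\<lambda>x \<sigma>. \<sigma> x) ` X :: ((nat \<times> nat \<Rightarrow> 'k) \<Rightarrow> 'k) set"
  let ?U = "{..<2 * r} \<times> C r" and ?AB = "{..<2 * r} \<times> {r, N + r}"
  let ?W = "{(2 * r, r), (2 * r, N + r), (Suc (2 * r), r), (Suc (2 * r), N + r)}"
  let ?Q = "(\<lambda>ij \<sigma>. qb r \<sigma> ij) ` I (2 * r)"
  note C = not_in_C[OF r]
  have N0: "N \<noteq> 0" using r by simp
  have "(\<lambda>\<sigma>. f (\<Phi> r \<sigma>)) \<in> pf (?AB \<union> ?W \<union> ?U)"
  proof (rule pf_comp[OF f])
    fix x assume "x \<in> {..<2 * Suc r} \<times> C (Suc r)"
    moreover obtain i c where x: "x = (i, c)" by force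
    ultimately have "i < 2 * r \<or> i = 2 * r \<or> i = Suc (2 * r)"
      and "c = r \<or> c = N + r \<or> c \<noteq> r \<and> c \<noteq> N + r \<and> c \<in> C r"
      using C by (auto simp: C_Suc less_Suc_eq)
    then show "(\<lambda>\<sigma>. \<Phi> r \<sigma> x) \<in> pf (?AB \<union> ?W \<union> ?U)"
      unfolding \<Phi>_def x using N0 by (elim disjE conjE) (auto intro!: pf_intros)
  qed
  then have "(\<lambda>\<sigma>. f (\<Phi> r \<sigma>)) \<in> alg (?co (?AB \<union> ?W) \<union> ?co ?U)"
    by (simp add: pf_def image_Un)
  let ?\<Gamma> = "{refl r u | u. (\<forall>c. c \<notin> C r \<longrightarrow> u c = 0) \<and> q r u \<noteq> 0}"
  have "(\<lambda>\<sigma>. f (\<Phi> r \<sigma>)) \<in> alg (?co (?AB \<union> ?W) \<union> {e \<in> alg (?co ?U). \<forall>\<gamma>\<in>?\<Gamma>. \<forall>z. e (\<gamma> z) = e z})"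
  proof (rule alg_Un_invariant)
    show "\<exists>z. (\<forall>s\<in>?co (?AB \<union> ?W). s z = s y) \<and> (\<forall>s\<in>?co ?U. s z = s u)" for y u
      by (rule exI[of _ "\<lambda>x. if x \<in> ?U then u x else y x"]) (use C in auto)
  next
    fix \<gamma> s z assume "\<gamma> \<in> ?\<Gamma>" "s \<in> ?co (?AB \<union> ?W)"
    then show "s (\<gamma> z) = s z" using C by (auto simp: refl_apply)
  next
    fix \<gamma> s z u assume "\<gamma> \<in> ?\<Gamma>" and zu: "\<forall>s\<in>?co ?U. s z = s u" and "s \<in> ?co ?U"
    then obtain v i c where v: "\<gamma> = refl r v" "s = (\<lambda>\<sigma>. \<sigma> (i, c))" "i < 2 * r" "c \<in> C r" by auto
    have "bil r v (row z i) = bil r v (row u i)" by (rule bil_cong) (use zu v in auto)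
    then show "s (\<gamma> z) = s (\<gamma> u)" using zu v by (auto simp: refl_apply)
  next
    fix \<gamma> z assume "\<gamma> \<in> ?\<Gamma>"
    then obtain u where u: "\<gamma> = refl r u" "\<And>c. c \<notin> C r \<Longrightarrow> u c = 0" "q r u \<noteq> 0" by blast
    have "bil r u (row (\<Phi> r z) i) = (if i < 2 * r then bil r u (row z i) else 0)" for i
      using bil_row_\<Phi>_plane[OF r, of i u z] C by (auto simp: \<Phi>_def intro!: bil_cong)
    then have "\<Phi> r (refl r u z) = refl r u (\<Phi> r z)"
      using u(2)[OF C(1)] u(2)[OF C(2)] by (auto simp: fun_eq_iff \<Phi>_def refl_apply)
    also have "\<dots> = refl (Suc r) u (\<Phi> r z)" using refl_Suc[OF r u(2)] by simp
    finally show "f (\<Phi> r (\<gamma> z)) = f (\<Phi> r z)"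
      using reflection_invariantD[OF inv, of u] u refl_Suc(1)[OF r u(2)] by (auto simp: C_Suc)
  qed fact
  also have "\<dots> \<subseteq> alg (?co (?AB \<union> ?W) \<union> ?Q)"
  proof
    fix h assume "h \<in> alg (?co (?AB \<union> ?W) \<union> {e \<in> alg (?co ?U). \<forall>\<gamma>\<in>?\<Gamma>. \<forall>z. e (\<gamma> z) = e z})"
    then show "h \<in> alg (?co (?AB \<union> ?W) \<union> ?Q)"
    proof (rule alg_subset, intro subsetI)
      fix e assume e: "e \<in> ?co (?AB \<union> ?W) \<union> {e \<in> alg (?co ?U). \<forall>\<gamma>\<in>?\<Gamma>. \<forall>z. e (\<gamma> z) = e z}"
      show "e \<in> alg (?co (?AB \<union> ?W) \<union> ?Q)"
      proof (cases "e \<in> ?co (?AB \<union> ?W)")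
        case True
        then show ?thesis by (intro alg.gen) blast
      next
        case False
        with e have "e \<in> pf ?U" "reflection_invariant r e"
          by (auto simp: pf_def reflection_invariant_def)
        then have "e \<in> alg ?Q" by (rule IH)
        then show ?thesis by (rule alg_subset) (auto intro: alg.gen)
      qed
    qed
  qed
  also have "?co (?AB \<union> ?W) \<union> ?Q = (?co ?AB \<union> ?Q) \<union> ?co ?W" by blast
  finally have f2: "(\<lambda>\<sigma>. f (\<Phi> r \<sigma>)) \<in> alg ((?co ?AB \<union> ?Q) \<union> ?co ?W)" .
  \<comment> \<open>The effect on the parameters of the reflection in the plane vector with
    coordinates (s, 1), whose norm is s.\<close>
  define \<delta> where "\<delta> s \<sigma> = \<sigma>((2 * r, r) := s * \<sigma> (2 * r, N + r), (2 * r, N + r) := \<sigma> (2 * r, r) / s,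
    (Suc (2 * r), r) := s * \<sigma> (Suc (2 * r), N + r), (Suc (2 * r), N + r) := \<sigma> (Suc (2 * r), r) / s)"
    for s :: 'k and \<sigma> :: "nat \<times> nat \<Rightarrow> 'k"
  have "(\<lambda>\<sigma>. f (\<Phi> r \<sigma>)) \<in> alg ((?co ?AB \<union> ?Q) \<union> {e \<in> alg (?co ?W). \<forall>\<gamma>\<in>\<delta> ` (- {0}). \<forall>z. e (\<gamma> z) = e z})"
  proof (rule alg_Un_invariant)
    fix y u :: "nat \<times> nat \<Rightarrow> 'k"
    let ?z = "\<lambda>x. if x \<in> ?W then u x else y x"
    have "qb r ?z ij = qb r y ij" if "ij \<in> I (2 * r)" for ij
      using that by (rule qb_cong) auto
    then show "\<exists>z. (\<forall>s\<in>?co ?AB \<union> ?Q. s z = s y) \<and> (\<forall>s\<in>?co ?W. s z = s u)"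
      by (intro exI[of _ ?z]) auto
  next
    fix \<gamma> s z assume "\<gamma> \<in> \<delta> ` (- {0})" "s \<in> ?co ?AB \<union> ?Q"
    moreover have "qb r (\<delta> t z) ij = qb r z ij" if "ij \<in> I (2 * r)" for ij t
      using that by (rule qb_cong) (auto simp: \<delta>_def)
    ultimately show "s (\<gamma> z) = s z" by (auto simp: \<delta>_def)
  next
    fix \<gamma> s z u assume "\<gamma> \<in> \<delta> ` (- {0})" "\<forall>s\<in>?co ?W. s z = s u" "s \<in> ?co ?W"
    then show "s (\<gamma> z) = s (\<gamma> u)" using N0 by (auto simp: \<delta>_def)
  next
    fix \<gamma> z assume "\<gamma> \<in> \<delta> ` (- {0})"
    then obtain s where s: "\<gamma> = \<delta> s" "s \<noteq> 0" by blast
    define w where "w c = (if c = r then s else if c = N + r then 1 else 0)" for c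
    have w: "w c = 0" if "c \<notin> C (Suc r)" for c using that by (auto simp: w_def C_Suc)
    have "q r w = 0" "bil r v w = 0" for v using C by (auto simp: w_def intro!: q_zero bil_zero_right)
    then have qw: "q (Suc r) w = s" and bw: "bil (Suc r) w v = s * v (N + r) + v r" for v
      using N0 by (auto simp: q_Suc bil_Suc bil_sym[of r w]) (auto simp: w_def)
    have "f (\<Phi> r (\<gamma> z)) = f (refl (Suc r) w (\<Phi> r z))"
    proof (rule pf_cong[OF f])
      fix x assume "x \<in> {..<2 * Suc r} \<times> C (Suc r)"
      then obtain i c where x: "x = (i, c)" "i < 2 * r \<or> i = 2 * r \<or> i = Suc (2 * r)" by force
      show "\<Phi> r (\<gamma> z) x = refl (Suc r) w (\<Phi> r z) x"
        using x(2) s(2) N0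
        by (auto simp: x(1) refl_apply bw qw s(1) \<Phi>_def \<delta>_def w_def field_simps)
    qed
    then show "f (\<Phi> r (\<gamma> z)) = f (\<Phi> r z)"
      using reflection_invariantD[OF inv w] qw s(2) by simp
  qed (fact f2)
  then show ?thesis
  proof (rule alg_subset, intro subsetI)
    fix e assume e: "e \<in> (?co ?AB \<union> ?Q) \<union> {e \<in> alg (?co ?W). \<forall>\<gamma>\<in>\<delta> ` (- {0}). \<forall>z. e (\<gamma> z) = e z}"
    show "e \<in> alg (?co ?AB \<union> ?Q \<union> plane_gens r)"
    proof (cases "e \<in> ?co ?AB \<union> ?Q")
      case True
      then show ?thesis by (intro alg.gen) blast
    next
      case False
      with e have "e \<in> pf ?W" and "\<And>s \<sigma>. s \<noteq> 0 \<Longrightarrow> e (\<delta> s \<sigma>) = e \<sigma>"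
        by (auto simp: pf_def)
      then have "e \<in> alg (plane_gens r)"
        unfolding plane_gens_def \<delta>_def by (intro hyperbolic_plane_invariants) (use N0 in auto)
      then show ?thesis by (rule alg_subset) (auto intro: alg.gen)
    qed
  qed
qed

text \<open>On the image of \<open>\<Phi>\<close> the a_i and b_i are entries of \<open>qb\<close>
  divided by the determinant, and the Q and B of the u_i differ from those of the full rows only by
  plane parts.\<close>

lemma clear_denominators:
  assumes r: "r < N" and h: "h \<in> alg
    ((\<lambda>x \<sigma>. \<sigma> x) ` ({..<2 * r} \<times> {r, N + r}) \<union> (\<lambda>ij \<sigma>. qb r \<sigma> ij) ` I (2 * r) \<union> plane_gens r)"
  shows "\<exists>k F. F \<in> pf (I (2 * Suc r)) \<and>
    (\<forall>\<sigma>. qb (Suc r) (\<Phi> r \<sigma>) (2 * r, Suc (2 * r)) ^ k * h \<sigma> = F (qb (Suc r) (\<Phi> r \<sigma>)))"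
  using h
proof induction
  case (gen f)
  let ?D = "\<lambda>\<tau> :: nat \<times> nat \<Rightarrow> 'k. \<tau> (2 * r, Suc (2 * r))"
  have var: "(\<lambda>\<tau> :: nat \<times> nat \<Rightarrow> 'k. \<tau> ij) \<in> pf (I (2 * Suc r))" if "fst ij \<le> snd ij" "snd ij < 2 * Suc r" for ij
    using that by (intro pf_var) (auto simp: I_def)
  note \<Phi> = qb_\<Phi>_plane[OF r]
  from gen consider
      i c where "i < 2 * r" "c = r \<or> c = N + r" "f = (\<lambda>\<sigma>. \<sigma> (i, c))"
    | i where "i < 2 * r" "f = (\<lambda>\<sigma>. qb r \<sigma> (i, i))"
    | i j where "i < j" "j < 2 * r" "f = (\<lambda>\<sigma>. qb r \<sigma> (i, j))"
    | "f = (\<lambda>\<sigma>. \<sigma> (2 * r, r) * \<sigma> (2 * r, N + r))"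
    | "f = (\<lambda>\<sigma>. \<sigma> (Suc (2 * r), r) * \<sigma> (Suc (2 * r), N + r))"
    | "f = plane_det r"
    unfolding plane_gens_def plane_det_def I_def
    by (auto simp: fun_eq_iff le_less)
  then show ?case
  proof cases
    case (1 i c)
    show ?thesis
    proof (cases "c = r")
      case True
      show ?thesis
        by (intro exI[of _ 1] exI[of _ "\<lambda>\<tau>. \<tau> (i, Suc (2 * r))"] conjI allI var)
          (use 1 True in \<open>auto simp: \<Phi>(3) qb_\<Phi>(2)[OF r, of i i]\<close>)
    next
      case False
      show ?thesis
        by (intro exI[of _ 1] exI[of _ "\<lambda>\<tau>. \<tau> (i, 2 * r)"] conjI allI var)
          (use 1 False in \<open>auto simp: \<Phi>(3) qb_\<Phi>(1)[OF r, of i i]\<close>)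
    qed
  next
    case (2 i)
    \<comment> \<open>The plane part adds a^2 Q1 + b^2 Q2 + a b B to the norm of row
      \<open>i\<close>; as a and b have denominator B, its square suffices.\<close>
    let ?F = "\<lambda>\<tau>. ?D \<tau> ^ 2 * \<tau> (i, i) + (\<tau> (i, Suc (2 * r)) ^ 2 * \<tau> (2 * r, 2 * r)
      + \<tau> (i, 2 * r) ^ 2 * \<tau> (Suc (2 * r), Suc (2 * r)) + \<tau> (i, Suc (2 * r)) * \<tau> (i, 2 * r) * ?D \<tau>)"
    have "qb (Suc r) (\<Phi> r \<sigma>) (2 * r, Suc (2 * r)) ^ 2 * qb r \<sigma> (i, i) = ?F (qb (Suc r) (\<Phi> r \<sigma>))" for \<sigma>
      unfolding \<Phi>(1-3) qb_\<Phi>(1-3)[OF r 2(1) 2(1)] by (simp add: algebra_simps power2_eq_square)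
    moreover have "?F \<in> pf (I (2 * Suc r))" using 2(1) by (intro pf_intros var) (auto simp: I_def)
    ultimately show ?thesis unfolding 2(2) by blast
  next
    case (3 i j)
    let ?F = "\<lambda>\<tau>. ?D \<tau> * \<tau> (i, j) + (\<tau> (i, Suc (2 * r)) * \<tau> (j, 2 * r)
      + \<tau> (j, Suc (2 * r)) * \<tau> (i, 2 * r))"
    have i: "i < 2 * r" "i \<noteq> j" using 3 by auto
    have "qb (Suc r) (\<Phi> r \<sigma>) (2 * r, Suc (2 * r)) ^ 1 * qb r \<sigma> (i, j) = ?F (qb (Suc r) (\<Phi> r \<sigma>))" for \<sigma>
      unfolding \<Phi>(3) qb_\<Phi>(1,2)[OF r i(1) 3(2)] qb_\<Phi>(1,2)[OF r 3(2) 3(2)] qb_\<Phi>(4)[OF r i(1) 3(2) i(2)]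
      by (simp add: algebra_simps)
    moreover have "?F \<in> pf (I (2 * Suc r))" using 3(1,2) by (intro pf_intros var) (auto simp: I_def)
    ultimately show ?thesis unfolding 3(3) by blast
  next
    case 4
    show ?thesis
      by (intro exI[of _ 0] exI[of _ "\<lambda>\<tau>. \<tau> (2 * r, 2 * r)"] conjI allI var) (auto simp: 4 \<Phi>(1))
  next
    case 5
    show ?thesis
      by (intro exI[of _ 0] exI[of _ "\<lambda>\<tau>. \<tau> (Suc (2 * r), Suc (2 * r))"] conjI allI var) (auto simp: 5 \<Phi>(2))
  next
    case 6
    show ?thesis
      by (intro exI[of _ 0] exI[of _ ?D] conjI allI var) (auto simp: 6 \<Phi>(3))
  qed
next
  case (const c)
  show ?case by (intro exI[of _ 0] exI[of _ "\<lambda>_. c"] conjI allI pf_const) simp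
next
  case (add f g)
  let ?D = "\<lambda>\<tau> :: nat \<times> nat \<Rightarrow> 'k. \<tau> (2 * r, Suc (2 * r))"
  obtain k F where F: "F \<in> pf (I (2 * Suc r))"
    "\<And>\<sigma>. ?D (qb (Suc r) (\<Phi> r \<sigma>)) ^ k * f \<sigma> = F (qb (Suc r) (\<Phi> r \<sigma>))" using add.IH(1) by blast
  obtain l G where G: "G \<in> pf (I (2 * Suc r))"
    "\<And>\<sigma>. ?D (qb (Suc r) (\<Phi> r \<sigma>)) ^ l * g \<sigma> = G (qb (Suc r) (\<Phi> r \<sigma>))" using add.IH(2) by blast
  show ?case
  proof (rule exI[of _ "k + l"], rule exI[of _ "\<lambda>\<tau>. ?D \<tau> ^ l * F \<tau> + ?D \<tau> ^ k * G \<tau>"], intro conjI allI)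
    show "(\<lambda>\<tau>. ?D \<tau> ^ l * F \<tau> + ?D \<tau> ^ k * G \<tau>) \<in> pf (I (2 * Suc r))"
      by (intro pf_intros F G) (auto simp: I_def)
  qed (simp add: power_add algebra_simps flip: F(2) G(2))
next
  case (mult f g)
  let ?D = "\<lambda>\<tau> :: nat \<times> nat \<Rightarrow> 'k. \<tau> (2 * r, Suc (2 * r))"
  obtain k F where F: "F \<in> pf (I (2 * Suc r))"
    "\<And>\<sigma>. ?D (qb (Suc r) (\<Phi> r \<sigma>)) ^ k * f \<sigma> = F (qb (Suc r) (\<Phi> r \<sigma>))" using mult.IH(1) by blast
  obtain l G where G: "G \<in> pf (I (2 * Suc r))"
    "\<And>\<sigma>. ?D (qb (Suc r) (\<Phi> r \<sigma>)) ^ l * g \<sigma> = G (qb (Suc r) (\<Phi> r \<sigma>))" using mult.IH(2) by blast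
  show ?case
    by (intro exI[of _ "k + l"] exI[of _ "\<lambda>\<tau>. F \<tau> * G \<tau>"] conjI allI pf_mult F(1) G(1))
      (simp add: power_add algebra_simps flip: F(2) G(2))
qed

section \<open>Moving two vectors into a plane\<close>

abbreviation tuple_coords :: "nat \<Rightarrow> (nat \<times> nat) set"
  where "tuple_coords r \<equiv> {..<2 * r} \<times> C r"

lemma tuple_coords_SucE:
  assumes "x \<in> tuple_coords (Suc r)"
  obtains i c where "x = (i, c)" "i < 2 * r \<or> i = 2 * r \<or> i = Suc (2 * r)" "c = r \<or> c = N + r \<or> c \<in> C r"
  using assms by (cases x) (auto simp: C_Suc less_Suc_eq)

text \<open>Cramer's rule finds the a_i and b_i from the plane coordinates of the first rows, so
  such a tuple agrees with a value of \<open>\<Phi>\<close> on the coordinates that \<open>g\<close>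
  sees.\<close>

lemma vanishes_if_plane:
  assumes r: "r < N" and g: "g \<in> pf (tuple_coords (Suc r))"
    and \<Phi>: "\<And>\<sigma>. plane_det r \<sigma> \<noteq> 0 \<Longrightarrow> g (\<Phi> r \<sigma>) = 0"
    and \<sigma>: "\<And>c. c \<in> C r \<Longrightarrow> \<sigma> (2 * r, c) = 0" "\<And>c. c \<in> C r \<Longrightarrow> \<sigma> (Suc (2 * r), c) = 0" "plane_det r \<sigma> \<noteq> 0"
  shows "g \<sigma> = 0"
proof -
  have N0: "N \<noteq> 0" using r by simp
  note C = not_in_C[OF r]
  let ?x1 = "\<sigma> (2 * r, r)" and ?y1 = "\<sigma> (2 * r, N + r)" and ?x2 = "\<sigma> (Suc (2 * r), r)" and ?y2 = "\<sigma> (Suc (2 * r), N + r)"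
  define d where "d = plane_det r \<sigma>"
  have d: "d \<noteq> 0" "?x1 * ?y2 + ?x2 * ?y1 = d" using \<sigma>(3) by (simp_all add: d_def plane_det_def)
  define \<tau> where "\<tau> = (\<lambda>(i, c). if i < 2 * r then
    (if c = r then (\<sigma> (i, r) * ?y2 + ?x2 * \<sigma> (i, N + r)) / d
     else if c = N + r then (?x1 * \<sigma> (i, N + r) + ?y1 * \<sigma> (i, r)) / d else \<sigma> (i, c)) else \<sigma> (i, c))"
  have cramer: "(X * ?y2 + ?x2 * Y) / d * ?x1 + (?x1 * Y + ?y1 * X) / d * ?x2 = X"
    "(X * ?y2 + ?x2 * Y) / d * ?y1 + (?x1 * Y + ?y1 * X) / d * ?y2 = Y" for X Y
  proof -
    have "(X * ?y2 + ?x2 * Y) * ?x1 + (?x1 * Y + ?y1 * X) * ?x2 = X * (?x1 * ?y2 + ?x2 * ?y1)"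
      "(X * ?y2 + ?x2 * Y) * ?y1 + (?x1 * Y + ?y1 * X) * ?y2 = Y * (?x1 * ?y2 + ?x2 * ?y1)"
      by (simp_all add: algebra_simps)
    then show "(X * ?y2 + ?x2 * Y) / d * ?x1 + (?x1 * Y + ?y1 * X) / d * ?x2 = X"
      "(X * ?y2 + ?x2 * Y) / d * ?y1 + (?x1 * Y + ?y1 * X) / d * ?y2 = Y"
      unfolding d(2) using d(1) by (simp_all add: divide_simps)
  qed
  have "plane_det r \<tau> = d" using d(2) by (simp add: plane_det_def \<tau>_def)
  then have "g (\<Phi> r \<tau>) = 0" using d(1) by (intro \<Phi>) simp
  moreover have "g (\<Phi> r \<tau>) = g \<sigma>"
  proof (rule pf_cong[OF g])
    fix x assume "x \<in> tuple_coords (Suc r)"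
    then show "\<Phi> r \<tau> x = \<sigma> x"
      by (rule tuple_coords_SucE) (use N0 C cramer \<sigma>(1,2) in \<open>auto simp: \<Phi>_def \<tau>_def\<close>)
  qed
  ultimately show ?thesis by simp
qed

text \<open>\<open>b \<noteq> 0\<close> keeps the polynomial nonconstant even when
  \<open>a = 0\<close>.\<close>

lemma quadratic_root:
  assumes "b \<noteq> 0"
  obtains x where "a * x\<^sup>2 + b * x + c = (0 :: 'k)"
proof -
  have "degree [:c, b, a:] > 0" using assms by simp
  then obtain x where "poly [:c, b, a:] x = 0" using alg_closed_imp_poly_has_root by blast
  then show ?thesis using that[of x] by (simp add: algebra_simps power2_eq_square)
qed

text \<open>A reflection has to fix row \<open>2 * r\<close>, which is w_1 = (1, Q), and move the
  last row v into the plane. The image (x, y) must have the norm of v and the same polar form B with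
  w_1, which forces y = B + Q x and a quadratic equation for x. The reflection is the one in v + (x,
  y), which is orthogonal to w_1.\<close>

lemma vanishes_if_first_standard:
  assumes r: "r < N" and g: "g \<in> pf (tuple_coords (Suc r))" and inv: "reflection_invariant (Suc r) g"
    and \<Phi>: "\<And>\<sigma>. plane_det r \<sigma> \<noteq> 0 \<Longrightarrow> g (\<Phi> r \<sigma>) = 0"
    and \<sigma>: "\<And>c. c \<in> C r \<Longrightarrow> \<sigma> (2 * r, c) = 0" "\<sigma> (2 * r, r) = 1" "plane_det r \<sigma> \<noteq> 0"
      "q r (row \<sigma> (Suc (2 * r))) \<noteq> 0"
  shows "g \<sigma> = 0"
proof -
  have N0: "N \<noteq> 0" using r by simp
  note C = not_in_C[OF r]
  let ?Q = "\<sigma> (2 * r, N + r)" and ?x0 = "\<sigma> (Suc (2 * r), r)" and ?y0 = "\<sigma> (Suc (2 * r), N + r)"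
  define \<rho> where "\<rho> = q r (row \<sigma> (Suc (2 * r)))"
  define B where "B = plane_det r \<sigma>"
  have B: "B = ?y0 + ?Q * ?x0" using \<sigma>(2) by (simp add: B_def plane_det_def mult.commute)
  have B0: "B \<noteq> 0" using \<sigma>(3) by (simp add: B_def)
  obtain x where x: "?Q * x\<^sup>2 + B * x + (?x0 * ?y0 + \<rho>) = 0" using quadratic_root[OF B0] by blast
  define y where "y = B + ?Q * x"
  define u where "u c = (if c = r then ?x0 + x else if c = N + r then ?y0 + y
    else if c \<in> C r then \<sigma> (Suc (2 * r), c) else 0)" for c
  have u0: "u c = 0" if "c \<notin> C (Suc r)" for c using that by (simp add: u_def C_Suc)
  have uC: "u c = \<sigma> (Suc (2 * r), c)" if "c \<in> C r" for c using that C by (auto simp: u_def)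
  have ur: "u r = ?x0 + x" "u (N + r) = ?y0 + y" using N0 by (auto simp: u_def)
  have y': "?y0 + y = ?Q * (?x0 + x)" by (simp add: y_def B algebra_simps)
  \<comment> \<open>The norm of \<open>u\<close> will be \<open>(?x0 + x) * B\<close>. At
    \<open>x = ?x0\<close> the quadratic equation collapses to \<open>\<rho> = 0\<close>, so the
    assumption on the part of the last row outside the plane makes the reflection exist.\<close>
  have "x \<noteq> ?x0"
  proof
    assume "x = ?x0"
    then have "\<rho> = 0" using x unfolding B by (simp add: algebra_simps power2_eq_square)
    then show False using \<sigma>(4) by (simp add: \<rho>_def)
  qed
  then have neq: "?x0 + x \<noteq> 0" using eq_iff_add_eq_0[of x ?x0] by (simp add: add.commute)
  have qr: "q r u = \<rho>" unfolding \<rho>_def by (rule q_cong) (simp add: uC)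
  have "\<rho> = ?Q * x\<^sup>2 + B * x + ?x0 * ?y0"
    using x by (subst eq_iff_add_eq_0) (simp add: algebra_simps)
  then have qu: "q (Suc r) u = (?x0 + x) * B"
    unfolding q_Suc ur qr y' by (simp add: B algebra_simps power2_eq_square)
  have qu0: "q (Suc r) u \<noteq> 0" using qu neq B0 by simp
  have "bil r u (row \<sigma> (2 * r)) = 0" by (rule bil_zero_right) (simp add: \<sigma>(1))
  then have b1: "bil (Suc r) u (row \<sigma> (2 * r)) = 0"
    unfolding bil_Suc ur y' by (simp add: \<sigma>(2) mult.commute[of "?x0 + x" ?Q])
  have "bil r u (row \<sigma> (Suc (2 * r))) = bil r (row \<sigma> (Suc (2 * r))) (row \<sigma> (Suc (2 * r)))"
    by (rule bil_cong) (simp_all add: uC)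
  then have b2: "bil (Suc r) u (row \<sigma> (Suc (2 * r))) = q (Suc r) u"
    unfolding bil_Suc ur y' qu by (simp add: B algebra_simps)
  let ?\<tau> = "refl (Suc r) u \<sigma>"
  have \<tau>: "?\<tau> (2 * r, c) = \<sigma> (2 * r, c)" "?\<tau> (Suc (2 * r), c) = \<sigma> (Suc (2 * r), c) + u c" for c
    using b1 b2 qu0 by (simp_all add: refl_apply)
  have "plane_det r ?\<tau> = y + x * ?Q"
    using \<sigma>(2) by (simp add: plane_det_def \<tau> ur)
  also have "\<dots> = B" by (simp add: y_def algebra_simps)
  finally have "plane_det r ?\<tau> = B" .
  then have "g ?\<tau> = 0"
    using B0 by (intro vanishes_if_plane[OF r g \<Phi>]) (simp_all add: \<tau> \<sigma>(1) uC)
  then show ?thesis using reflection_invariantD[OF inv u0 qu0] by simp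
qed

lemma q_nonzero_exists:
  assumes "r < N" "C r \<noteq> {}"
  obtains v where "q r v \<noteq> 0"
proof (cases \<epsilon>)
  case True
  have "q r (\<lambda>c. if c = 2 * N then 1 else 0) = 1"
    unfolding q_def using True assms(1) by (auto intro!: sum.neutral)
  then show ?thesis using that by (metis one_neq_zero)
next
  case False
  have "r > 0" using assms(2) unfolding C_def using False by (cases "r = 0") auto
  let ?v = "\<lambda>c. if c = 0 \<or> c = N then 1 else 0 :: 'k"
  have "q r ?v = (\<Sum>t<r. ?v t * ?v (N + t))"
    unfolding q_def using False by simp
  also have "\<dots> = (\<Sum>t<r. if t = 0 then 1 else 0)"
    by (rule sum.cong) (use assms(1) in auto)
  also have "\<dots> = 1" using \<open>r > 0\<close> by simp
  finally show ?thesis using that by (metis one_neq_zero)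
qed

text \<open>Row \<open>2 * r\<close> is sent to (1, Q), of the same norm, by the reflection in its
  sum with that vector; the norm of this sum is the \<open>D\<close> of the last density argument.
  The density argument before it treats tuples whose row already has this form. \<open>ne\<close>
  provides a last row whose part outside the plane has nonzero norm.\<close>

lemma vanishes_if_vanishes_on_\<Phi>:
  assumes r: "r < N" and ne: "C r \<noteq> {}"
    and g: "g \<in> pf (tuple_coords (Suc r))" and inv: "reflection_invariant (Suc r) g"
    and \<Phi>: "\<And>\<sigma>. plane_det r \<sigma> \<noteq> 0 \<Longrightarrow> g (\<Phi> r \<sigma>) = 0"
  shows "g \<sigma> = 0"
proof -
  have N0: "N \<noteq> 0" using r by simp
  note C = not_in_C[OF r]
  \<comment> \<open>\<open>\<Psi>\<close> overwrites row \<open>2 * r\<close> by (1, y), keeping its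
    y. Composition with it turns the tuples in normal form into a full affine space, where
    \<open>pf_density\<close> can be used.\<close>
  define \<Psi> where "\<Psi> \<sigma> = (\<lambda>(i, c). if i = 2 * r then (if c = r then 1 else if c = N + r then \<sigma> (i, c) else 0) else \<sigma> (i, c))"
    for \<sigma> :: "nat \<times> nat \<Rightarrow> 'k"
  have \<Psi>_row: "row (\<Psi> \<sigma>) (Suc (2 * r)) = row \<sigma> (Suc (2 * r))" for \<sigma>
    by (simp add: \<Psi>_def fun_eq_iff)
  obtain v where v: "q r v \<noteq> 0" using q_nonzero_exists[OF r ne] .
  have \<Psi>0: "g (\<Psi> \<sigma>) = 0" for \<sigma>
  proof (rule pf_density[where D = "\<lambda>\<sigma>. plane_det r (\<Psi> \<sigma>) * q r (row \<sigma> (Suc (2 * r)))" and X = UNIV and Y = UNIV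
        and h = "\<lambda>\<sigma>. g (\<Psi> \<sigma>)"
        and \<sigma>\<^sub>0 = "\<lambda>(i, c). if i = 2 * r then 0 else if c = r then 0 else if c = N + r then 1 else v c"])
    let ?\<sigma> = "\<lambda>(i, c). if i = 2 * r then 0 else if c = r then 0 else if c = N + r then 1 else v c"
    have "q r (row ?\<sigma> (Suc (2 * r))) = q r v" by (rule q_cong) (use C in auto)
    then show "plane_det r (\<Psi> ?\<sigma>) * q r (row ?\<sigma> (Suc (2 * r))) \<noteq> 0"
      using v N0 by (simp add: plane_det_def \<Psi>_def)
    show "(\<lambda>\<sigma>. plane_det r (\<Psi> \<sigma>) * q r (row \<sigma> (Suc (2 * r)))) \<in> pf UNIV"
      using N0 by (intro pf_mult q_row_pf) (auto simp: plane_det_def \<Psi>_def intro!: pf_intros)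
    have "(\<lambda>\<sigma>. \<Psi> \<sigma> x) \<in> pf UNIV" for x
      by (cases "fst x = 2 * r"; cases "snd x = r"; cases "snd x = N + r")
        (auto simp: \<Psi>_def case_prod_unfold intro!: pf_intros)
    then show "(\<lambda>\<sigma>. g (\<Psi> \<sigma>)) \<in> pf UNIV" by (intro pf_comp[OF g])
    fix \<sigma> assume "plane_det r (\<Psi> \<sigma>) * q r (row \<sigma> (Suc (2 * r))) \<noteq> 0"
    then show "g (\<Psi> \<sigma>) = 0"
      using C by (intro vanishes_if_first_standard[OF r g inv \<Phi>]) (auto simp: \<Psi>_row, auto simp: \<Psi>_def)
  qed
  show ?thesis
  proof (rule pf_density[where D = "\<lambda>\<sigma>. \<sigma> (2 * r, N + r) + q (Suc r) (row \<sigma> (2 * r)) * \<sigma> (2 * r, r)" and X = UNIV,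
        OF _ g, where \<sigma>\<^sub>0 = "\<lambda>(i, c). if c = N + r then 1 else 0"])
    show "(\<lambda>\<sigma>. \<sigma> (2 * r, N + r) + q (Suc r) (row \<sigma> (2 * r)) * \<sigma> (2 * r, r)) \<in> pf UNIV"
      by (intro pf_add pf_mult q_row_pf pf_var) auto
    fix \<sigma> assume D: "\<sigma> (2 * r, N + r) + q (Suc r) (row \<sigma> (2 * r)) * \<sigma> (2 * r, r) \<noteq> 0"
    let ?x = "\<sigma> (2 * r, r)" and ?y = "\<sigma> (2 * r, N + r)"
    define Q where "Q = q (Suc r) (row \<sigma> (2 * r))"
    define u where "u c = (if c = r then ?x + 1 else if c = N + r then ?y + Q
      else if c \<in> C r then \<sigma> (2 * r, c) else 0)" for c
    have u0: "u c = 0" if "c \<notin> C (Suc r)" for c using that by (simp add: u_def C_Suc)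
    have uC: "u c = \<sigma> (2 * r, c)" if "c \<in> C r" for c using that C by (auto simp: u_def)
    have ur: "u r = ?x + 1" "u (N + r) = ?y + Q" using N0 by (auto simp: u_def)
    have "q r u = q r (row \<sigma> (2 * r))" by (rule q_cong) (simp add: uC)
    also have "\<dots> = Q + ?x * ?y" by (simp add: Q_def q_Suc add.assoc)
    finally have qu: "q (Suc r) u = ?y + Q * ?x" unfolding q_Suc ur by (simp add: algebra_simps)
    have qu0: "q (Suc r) u \<noteq> 0" using qu D by (simp add: Q_def)
    have "bil r u (row \<sigma> (2 * r)) = bil r (row \<sigma> (2 * r)) (row \<sigma> (2 * r))"
      by (rule bil_cong) (simp_all add: uC)
    then have bu: "bil (Suc r) u (row \<sigma> (2 * r)) = q (Suc r) u"
      unfolding bil_Suc ur qu by (simp add: algebra_simps)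
    let ?\<tau> = "refl (Suc r) u \<sigma>"
    have "g (\<Psi> ?\<tau>) = g ?\<tau>"
    proof (rule pf_cong[OF g])
      fix x assume "x \<in> tuple_coords (Suc r)"
      then obtain i c where x: "x = (i, c)" "c = r \<or> c = N + r \<or> c \<in> C r" by (rule tuple_coords_SucE)
      have "?\<tau> (2 * r, c) = \<sigma> (2 * r, c) + u c" using bu qu0 by (simp add: refl_apply)
      then show "\<Psi> ?\<tau> x = ?\<tau> x"
        using x C ur uC by (auto simp: \<Psi>_def)
    qed
    then show "g \<sigma> = 0" using \<Psi>0[of ?\<tau>] reflection_invariantD[OF inv u0 qu0] by simp
  qed (use N0 in simp)
qed

section \<open>Algebraic independence and cancellation of denominators\<close>

text \<open>If the prescribed B of the last two rows is nonzero, their values are realised by w_1 =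
  (1, Q1) and some w_2 in the plane, and the pairings with them by suitable a_i and b_i. Only the Q
  and B of the u_i remain to be prescribed, and these are left to the induction hypothesis.\<close>

lemma qb_dominant:
  assumes "r \<le> N" "F \<in> pf (I (2 * r))" "\<And>\<sigma>. F (qb r \<sigma>) = 0"
  shows "F \<tau> = 0"
  using assms
proof (induction r arbitrary: F \<tau>)
  case 0
  have "F \<tau> = F (qb 0 (\<lambda>_. 0))" by (rule pf_cong[OF 0(2)]) (auto simp: I_def)
  then show ?case using 0(3) by simp
next
  case (Suc r)
  then have r: "r < N" by simp
  then have N0: "N \<noteq> 0" by simp
  note C = not_in_C[OF r]
  let ?p = "2 * r" and ?p' = "Suc (2 * r)"
  show ?case
  proof (rule pf_density[where D = "\<lambda>\<tau>. \<tau> (?p, ?p')" and X = UNIV, OF _ Suc.prems(2), where \<sigma>\<^sub>0 = "\<lambda>_. 1"])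
    fix \<tau> :: "nat \<times> nat \<Rightarrow> 'k" assume B0: "\<tau> (?p, ?p') \<noteq> 0"
    let ?B = "\<tau> (?p, ?p')" and ?Q1 = "\<tau> (?p, ?p)" and ?Q2 = "\<tau> (?p', ?p')"
    obtain x where x: "?Q1 * x\<^sup>2 + ?B * x + ?Q2 = 0" using quadratic_root[OF B0] .
    define y where "y = ?B + ?Q1 * x"
    have "x * y = ?Q1 * x\<^sup>2 + ?B * x" by (simp add: y_def algebra_simps power2_eq_square)
    then have xy: "x * y = ?Q2" using x by (subst eq_iff_add_eq_0) simp
    define a b where "a i = \<tau> (i, ?p') / ?B" and "b i = \<tau> (i, ?p) / ?B" for i
    define s where "s = (\<lambda>(i, j). if i = j then (a i)\<^sup>2 * ?Q1 + (b i)\<^sup>2 * ?Q2 + a i * b i * ?B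
      else (a i * b j + a j * b i) * ?B)"
    \<comment> \<open>The values on the whole tuple when the u_i have the values
      \<open>\<tau>'\<close>: columns of the last two vectors are as in \<open>\<tau>\<close>, all
      others receive the plane contribution \<open>s\<close>.\<close>
    define \<Lambda> where "\<Lambda> \<tau>' = (\<lambda>(i, j). if ?p \<le> j then \<tau> (i, j) else \<tau>' (i, j) + s (i, j))"
      for \<tau>' :: "nat \<times> nat \<Rightarrow> 'k"
    have "F (\<Lambda> (qb r u)) = 0" for u
    proof -
      define \<sigma> where "\<sigma> = (\<lambda>(i, c). if i = ?p then if c = r then 1 else if c = N + r then ?Q1 else 0
        else if i = ?p' then if c = r then x else if c = N + r then y else 0
        else if c = r then a i else if c = N + r then b i else u (i, c))"
      have pd: "plane_det r \<sigma> = ?B" using N0 by (simp add: plane_det_def \<sigma>_def y_def algebra_simps)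
      have "F (\<Lambda> (qb r u)) = F (qb (Suc r) (\<Phi> r \<sigma>))"
      proof (rule pf_cong[OF Suc.prems(2)])
        fix ij assume "ij \<in> I (2 * Suc r)"
        then obtain i j where ij: "ij = (i, j)" "i \<le> j" "j < Suc (Suc (2 * r))" by (auto simp: I_def)
        have \<sigma>u: "qb r \<sigma> (i, j) = qb r u (i, j)" if "j < 2 * r"
        proof (rule qb_cong)
          show "(i, j) \<in> I (2 * r)" using ij(2) that by (simp add: I_def)
        qed (use C in \<open>auto simp: \<sigma>_def\<close>)
        have \<sigma>i: "\<sigma> (i, r) = a i" "\<sigma> (i, N + r) = b i" if "i < ?p" for i using that N0 by (auto simp: \<sigma>_def)
        have \<sigma>p: "\<sigma> (?p, r) = 1" "\<sigma> (?p, N + r) = ?Q1" "\<sigma> (?p', r) = x" "\<sigma> (?p', N + r) = y"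
          using N0 by (auto simp: \<sigma>_def)
        consider "j < ?p" "i = j" | "j < ?p" "i < j" | "j = ?p" "i < ?p" | "j = ?p'" "i < ?p"
          | "j = ?p" "i = ?p" | "j = ?p'" "i = ?p" | "j = ?p'" "i = ?p'"
          using ij(2,3) by linarith
        then show "\<Lambda> (qb r u) ij = qb (Suc r) (\<Phi> r \<sigma>) ij"
        proof cases
          case 1
          then show ?thesis
            using qb_\<Phi>(3)[OF r, of j j \<sigma>] \<sigma>u by (simp add: ij(1) \<Lambda>_def s_def \<sigma>i \<sigma>p pd xy)
        next
          case 2
          then show ?thesis
            using qb_\<Phi>(4)[OF r, of i j \<sigma>] \<sigma>u by (simp add: ij(1) \<Lambda>_def s_def \<sigma>i pd)
        next
          case 3
          then show ?thesis using qb_\<Phi>(1)[OF r, of i i \<sigma>] B0 by (simp add: ij(1) \<Lambda>_def \<sigma>i pd b_def)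
        next
          case 4
          then show ?thesis using qb_\<Phi>(2)[OF r, of i i \<sigma>] B0 by (simp add: ij(1) \<Lambda>_def \<sigma>i pd a_def)
        qed (use qb_\<Phi>_plane[OF r, of \<sigma>] in \<open>simp_all add: ij(1) \<Lambda>_def \<sigma>p pd xy\<close>)
      qed
      then show ?thesis using Suc.prems(3) by simp
    qed
    moreover have "(\<lambda>\<tau>'. F (\<Lambda> \<tau>')) \<in> pf (I (2 * r))"
    proof (rule pf_comp[OF Suc.prems(2)])
      fix ij assume "ij \<in> I (2 * Suc r)"
      then show "(\<lambda>\<tau>'. \<Lambda> \<tau>' ij) \<in> pf (I (2 * r))"
        by (cases "?p \<le> snd ij") (auto simp: \<Lambda>_def case_prod_unfold I_def intro!: pf_intros)
    qed
    \<comment> \<open>In characteristic 2 the shift by \<open>s\<close> is its own inverse, so this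
      argument is the preimage of \<open>\<tau>\<close> under \<open>\<Lambda>\<close>.\<close>
    ultimately have "F (\<Lambda> (\<lambda>ij. \<tau> ij + s ij)) = 0"
      using Suc.IH[of "\<lambda>\<tau>'. F (\<Lambda> \<tau>')" "\<lambda>ij. \<tau> ij + s ij"] r by simp
    moreover have "\<Lambda> (\<lambda>ij. \<tau> ij + s ij) = \<tau>" by (auto simp: \<Lambda>_def fun_eq_iff add.assoc)
    ultimately show "F \<tau> = 0" by simp
  qed (auto intro: pf_var)
qed

lemma qb_alg:
  assumes "F \<in> pf X" "\<And>\<sigma>. f \<sigma> = F (qb r \<sigma>)"
  shows "f \<in> alg ((\<lambda>ij \<sigma>. qb r \<sigma> ij) ` X)"
proof -
  have "(\<lambda>\<sigma>. F (qb r \<sigma>)) \<in> alg ((\<lambda>ij \<sigma>. qb r \<sigma> ij) ` X)"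
    by (rule pf_comp_alg[OF assms(1)]) (auto intro: alg.gen)
  then show ?thesis using assms(2) by presburger
qed

text \<open>The difference of the two sides is again a reflection invariant and vanishes on the
  image of \<open>\<Phi>\<close>, so the move into the plane is applied to that difference.\<close>

lemma reflection_invariant_fraction:
  assumes r: "r < N" and ne: "C r \<noteq> {}"
    and IH: "\<And>f. f \<in> pf (tuple_coords r) \<Longrightarrow> reflection_invariant r f \<Longrightarrow> f \<in> alg ((\<lambda>ij \<sigma>. qb r \<sigma> ij) ` I (2 * r))"
    and f: "f \<in> pf (tuple_coords (Suc r))" and inv: "reflection_invariant (Suc r) f"
  shows "\<exists>k F. F \<in> pf (I (2 * Suc r)) \<and> (\<forall>\<sigma>. qb (Suc r) \<sigma> (2 * r, Suc (2 * r)) ^ k * f \<sigma> = F (qb (Suc r) \<sigma>))"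
proof -
  obtain k F where F: "F \<in> pf (I (2 * Suc r))"
    "\<And>\<sigma>. qb (Suc r) (\<Phi> r \<sigma>) (2 * r, Suc (2 * r)) ^ k * f (\<Phi> r \<sigma>) = F (qb (Suc r) (\<Phi> r \<sigma>))"
    using clear_denominators[OF r pf_\<Phi>_alg[OF r IH f inv]] by blast
  define g where "g \<sigma> = qb (Suc r) \<sigma> (2 * r, Suc (2 * r)) ^ k * f \<sigma> - F (qb (Suc r) \<sigma>)" for \<sigma>
  have "g \<in> pf (tuple_coords (Suc r))"
    unfolding g_def by (intro pf_diff pf_mult pf_power f pf_comp[OF F(1)] qb_pf[of _ "2 * Suc r"]) (auto simp: I_def)
  moreover have "reflection_invariant (Suc r) g"
    using inv by (auto simp: reflection_invariant_def g_def qb_refl)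
  moreover have "g (\<Phi> r \<sigma>) = 0" for \<sigma> using F(2) by (simp add: g_def)
  ultimately have "g \<sigma> = 0" for \<sigma> by (rule vanishes_if_vanishes_on_\<Phi>[OF r ne])
  then show ?thesis using F(1) by (auto simp: g_def)
qed

text \<open>If a numerator vanishes wherever the variable in the denominator does, that variable
  divides it and the exponent drops by one. \<open>zero\<close> ranges over all \<open>k\<close> and
  \<open>F\<close> because the numerator changes at every step.\<close>

lemma cancel_denominator:
  assumes r: "r < N" and f: "f \<in> pf (tuple_coords (Suc r))"
    and zero: "\<And>k F \<tau>. F \<in> pf (I (2 * Suc r)) \<Longrightarrow>
      (\<And>\<sigma>. qb (Suc r) \<sigma> (2 * r, Suc (2 * r)) ^ Suc k * f \<sigma> = F (qb (Suc r) \<sigma>)) \<Longrightarrow>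
      \<tau> (2 * r, Suc (2 * r)) = 0 \<Longrightarrow> F \<tau> = 0"
    and F: "F \<in> pf (I (2 * Suc r))" "\<And>\<sigma>. qb (Suc r) \<sigma> (2 * r, Suc (2 * r)) ^ k * f \<sigma> = F (qb (Suc r) \<sigma>)"
  shows "f \<in> alg ((\<lambda>ij \<sigma>. qb (Suc r) \<sigma> ij) ` I (2 * Suc r))"
  using F
proof (induction k arbitrary: F)
  case 0
  then show ?case by (intro qb_alg[of F]) auto
next
  case (Suc k)
  let ?x = "(2 * r, Suc (2 * r))"
  have N0: "N \<noteq> 0" using r by simp
  obtain G where G: "G \<in> pf (I (2 * Suc r))" "\<And>\<tau>. F \<tau> = F (\<tau>(?x := 0)) + \<tau> ?x * G \<tau>"
    using pf_split_var[OF Suc.prems(1)] by blast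
  have FG: "F \<tau> = \<tau> ?x * G \<tau>" for \<tau>
    using G(2)[of \<tau>] zero[OF Suc.prems, of "\<tau>(?x := 0)"] by simp
  have D: "(\<lambda>\<sigma>. qb (Suc r) \<sigma> ?x) \<in> pf UNIV" by (rule qb_pf[of _ "2 * Suc r"]) (auto simp: I_def)
  have "qb (Suc r) \<sigma> ?x ^ k * f \<sigma> - G (qb (Suc r) \<sigma>) = 0" for \<sigma>
  proof (rule pf_density[where h = "\<lambda>\<sigma>. qb (Suc r) \<sigma> ?x ^ k * f \<sigma> - G (qb (Suc r) \<sigma>)" and Y = UNIV, OF D])
    show "(\<lambda>\<sigma>. qb (Suc r) \<sigma> ?x ^ k * f \<sigma> - G (qb (Suc r) \<sigma>)) \<in> pf UNIV"
      by (intro pf_diff pf_mult pf_power pf_mono[OF f] pf_comp[OF G(1)] D qb_pf[of _ "2 * Suc r"]) auto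
    show "qb (Suc r) (\<lambda>(i, c). if i = 2 * r \<and> c = r \<or> i = Suc (2 * r) \<and> c = N + r then 1 else 0) ?x \<noteq> 0"
      using N0 r by (auto simp: qb_def bil_Suc) (auto simp: bil_def intro!: sum.neutral)
    fix \<sigma> assume *: "qb (Suc r) \<sigma> ?x \<noteq> 0"
    have "qb (Suc r) \<sigma> ?x * (qb (Suc r) \<sigma> ?x ^ k * f \<sigma>) = qb (Suc r) \<sigma> ?x * G (qb (Suc r) \<sigma>)"
      using Suc.prems(2)[of \<sigma>] unfolding FG by (simp add: mult.assoc)
    with * show "qb (Suc r) \<sigma> ?x ^ k * f \<sigma> - G (qb (Suc r) \<sigma>) = 0" by simp
  qed
  then show ?case using Suc.IH[OF G(1)] by simp
qed

text \<open>Permuting rows commutes with reflections, so the previous fraction exists for the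
  permuted \<open>f\<close> as well; back in the old order its denominator is another variable.
  \<open>0 < r\<close> provides the third row.\<close>

lemma fraction_by_transposition:
  fixes r :: nat
  assumes r: "0 < r" "r < N"
    and IH: "\<And>f. f \<in> pf (tuple_coords r) \<Longrightarrow> reflection_invariant r f \<Longrightarrow> f \<in> alg ((\<lambda>ij \<sigma>. qb r \<sigma> ij) ` I (2 * r))"
    and f: "f \<in> pf (tuple_coords (Suc r))" and inv: "reflection_invariant (Suc r) f"
  shows "\<exists>l G. G \<in> pf (I (2 * Suc r)) \<and> (\<forall>\<sigma>. qb (Suc r) \<sigma> (2 * r - 1, Suc (2 * r)) ^ l * f \<sigma> = G (qb (Suc r) \<sigma>))"
proof -
  define p where "p = Transposition.transpose (2 * r - 1) (2 * r)"
  have p: "p i < 2 * Suc r \<longleftrightarrow> i < 2 * Suc r" "p i = p j \<longleftrightarrow> i = j" "p (p i) = i" for i j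
    by (auto simp: p_def Transposition.transpose_def)
  have p': "p (2 * r) = 2 * r - 1" "p (Suc (2 * r)) = Suc (2 * r)"
    using r(1) by (auto simp: p_def Transposition.transpose_def)
  define w where "w \<sigma> = (\<lambda>(i, c). \<sigma> (p i, c))" for \<sigma> :: "nat \<times> nat \<Rightarrow> 'k"
  have ww: "w (w \<sigma>) = \<sigma>" for \<sigma> by (simp add: w_def p fun_eq_iff)
  have row_w: "row (w \<sigma>) i = row \<sigma> (p i)" for \<sigma> i by (simp add: w_def row_def)
  have "(\<lambda>\<sigma>. f (w \<sigma>)) \<in> pf (tuple_coords (Suc r))"
    by (rule pf_comp[OF f]) (use p(1) in \<open>auto simp: w_def intro!: pf_var\<close>)
  moreover have "w (refl (Suc r) u \<sigma>) = refl (Suc r) u (w \<sigma>)" for u \<sigma>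
    by (simp add: fun_eq_iff refl_apply row_w) (simp add: w_def refl_apply)
  then have "reflection_invariant (Suc r) (\<lambda>\<sigma>. f (w \<sigma>))"
    using inv by (simp add: reflection_invariant_def)
  moreover have "C r \<noteq> {}" using r(1) by (auto simp: C_def)
  ultimately obtain l F where F: "F \<in> pf (I (2 * Suc r))"
    "\<And>\<sigma>. qb (Suc r) \<sigma> (2 * r, Suc (2 * r)) ^ l * f (w \<sigma>) = F (qb (Suc r) \<sigma>)"
    using reflection_invariant_fraction[OF r(2) _ IH] by blast
  \<comment> \<open>A permuted pair may be out of order; \<open>min\<close> and \<open>max\<close>
    bring it back into \<open>I\<close>, which is compatible with \<open>qb\<close> because
    \<open>bil\<close> is symmetric.\<close>
  define W where "W \<tau> = (\<lambda>(i, j). \<tau> (min (p i) (p j), max (p i) (p j)))" for \<tau> :: "nat \<times> nat \<Rightarrow> 'k"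
  have "(\<lambda>\<tau>. F (W \<tau>)) \<in> pf (I (2 * Suc r))"
  proof (rule pf_comp[OF F(1)])
    fix ij assume "ij \<in> I (2 * Suc r)"
    then obtain i j where ij: "ij = (i, j)" "i < 2 * Suc r" "j < 2 * Suc r" by (auto simp: I_def)
    have "p i < 2 * Suc r" "p j < 2 * Suc r" using ij p(1) by blast+
    then have "(min (p i) (p j), max (p i) (p j)) \<in> I (2 * Suc r)"
      unfolding I_def by (simp add: min_def max_def)
    then show "(\<lambda>\<tau>. W \<tau> ij) \<in> pf (I (2 * Suc r))"
      unfolding W_def ij(1) by (auto intro: pf_var)
  qed
  moreover have W: "qb (Suc r) (w \<sigma>) (i, j) = W (qb (Suc r) \<sigma>) (i, j)" for \<sigma> i j
    by (auto simp: qb_def W_def row_w p(2) min_def max_def bil_sym)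
  have "qb (Suc r) \<sigma> (2 * r - 1, Suc (2 * r)) ^ l * f \<sigma> = F (W (qb (Suc r) \<sigma>))" for \<sigma>
  proof -
    have "qb (Suc r) (w \<sigma>) (2 * r, Suc (2 * r)) = qb (Suc r) \<sigma> (2 * r - 1, Suc (2 * r))"
      using r(1) by (simp add: qb_def row_w p')
    moreover have "qb (Suc r) (w \<sigma>) = W (qb (Suc r) \<sigma>)" using W by (auto simp: fun_eq_iff)
    ultimately show ?thesis using F(2)[of "w \<sigma>"] ww by simp
  qed
  ultimately show ?thesis by blast
qed

theorem reflection_invariants_generated:
  assumes "r \<le> N" "f \<in> pf (tuple_coords r)" "reflection_invariant r f"
  shows "f \<in> alg ((\<lambda>ij \<sigma>. qb r \<sigma> ij) ` I (2 * r))"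
  using assms
proof (induction r arbitrary: f)
  case 0
  then show ?case by (simp add: pf_def) (rule alg_subset, auto)
next
  case (Suc r)
  then have r: "r < N" by simp
  have IH: "f \<in> alg ((\<lambda>ij \<sigma>. qb r \<sigma> ij) ` I (2 * r))"
    if "f \<in> pf (tuple_coords r)" "reflection_invariant r f" for f
    using Suc.IH that r by simp
  note f = Suc.prems(2) and inv = Suc.prems(3)
  have N0: "N \<noteq> 0" using r by simp
  let ?x = "(2 * r, Suc (2 * r))"
  show ?case
  proof (cases "C r = {}")
    case True
    then have r0: "r = 0" and \<epsilon>: "\<not> \<epsilon>" by (auto simp: C_def split: if_splits)
    \<comment> \<open>With two vectors in a bare plane \<open>\<Phi>\<close> changes no relevant
      coordinate, so \<open>pf_\<Phi>_alg\<close> already yields the generators without a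
      denominator.\<close>
    have "f (\<Phi> r \<sigma>) = f \<sigma>" for \<sigma>
      by (rule pf_cong[OF f]) (use True in \<open>auto simp: r0 \<Phi>_def C_Suc\<close>)
    then have "f \<in> alg ((\<lambda>x \<sigma>. \<sigma> x) ` ({..<2 * r} \<times> {r, N + r}) \<union> (\<lambda>ij \<sigma>. qb r \<sigma> ij) ` I (2 * r) \<union> plane_gens r)"
      using pf_\<Phi>_alg[OF r IH f inv] by simp
    then have "f \<in> alg (plane_gens 0)" by (simp add: r0 I_def)
    then show ?thesis
    proof (rule alg_subset, intro subsetI alg.gen)
      have q1: "q (Suc 0) v = v 0 * v N" for v unfolding q_def using \<epsilon> by simp
      have bil1: "bil (Suc 0) u v = u 0 * v N + v 0 * u N" for u v by (simp add: bil_def mult.commute)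
      fix s assume "s \<in> plane_gens 0"
      then have "s = (\<lambda>\<sigma>. qb (Suc r) \<sigma> (0, 0)) \<or> s = (\<lambda>\<sigma>. qb (Suc r) \<sigma> (1, 1)) \<or> s = (\<lambda>\<sigma>. qb (Suc r) \<sigma> (0, 1))"
        by (auto simp: plane_gens_def qb_def r0 q1 bil1)
      then show "s \<in> (\<lambda>ij \<sigma>. qb (Suc r) \<sigma> ij) ` I (2 * Suc r)"
        by (auto simp: I_def r0)
    qed
  next
    case False
    obtain k F where F: "F \<in> pf (I (2 * Suc r))"
      "\<And>\<sigma>. qb (Suc r) \<sigma> ?x ^ k * f \<sigma> = F (qb (Suc r) \<sigma>)"
      using reflection_invariant_fraction[OF r False IH f inv] by blast
    show ?thesis
    proof (rule cancel_denominator[OF r f _ F])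
      fix k F \<tau>
      assume F: "F \<in> pf (I (2 * Suc r))" "\<And>\<sigma>. qb (Suc r) \<sigma> ?x ^ Suc k * f \<sigma> = F (qb (Suc r) \<sigma>)"
        and \<tau>: "\<tau> ?x = (0 :: 'k)"
      show "F \<tau> = 0"
      proof (cases "r = 0")
        case True
        then have \<epsilon>: "\<epsilon>" using False by (auto simp: C_def split: if_splits)
        \<comment> \<open>There is only one B here and nothing to exchange. Instead a pair with B =
          0 and the prescribed norms is constructed; its second vector lies on the z axis, in the
          radical of the polar form.\<close>
        obtain z where z: "z\<^sup>2 = \<tau> (1, 1)" using nth_root_exists[of 2 "\<tau> (1, 1)"] by auto
        define \<sigma> where "\<sigma> = (\<lambda>(i :: nat, c). if i = 0 then if c = 0 then 1 else if c = N then \<tau> (0, 0) else 0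
          else if c = 2 * N then z else (0 :: 'k))"
        have "q (Suc 0) v = v 0 * v N + (v (2 * N))\<^sup>2" for v using \<epsilon> unfolding q_def by simp
        then have q1: "qb (Suc 0) \<sigma> (0, 0) = \<tau> (0, 0)" "qb (Suc 0) \<sigma> (1, 1) = \<tau> (1, 1)" "qb (Suc 0) \<sigma> (0, 1) = 0"
          using N0 by (simp_all add: qb_def bil_def \<sigma>_def z)
        have I1: "I (2 * Suc r) = {(0, 0), (0, 1), (1, 1)}" unfolding True by (auto simp: I_def)
        have "\<tau> ij = qb (Suc r) \<sigma> ij" if "ij \<in> I (2 * Suc r)" for ij
          using that q1 \<tau> unfolding I1 unfolding True by auto
        then have "F \<tau> = F (qb (Suc r) \<sigma>)" by (rule pf_cong[OF F(1)])
        moreover have "qb (Suc r) \<sigma> ?x = 0" using q1(3) by (simp add: True)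
        ultimately show ?thesis using F(2)[of \<sigma>] by simp
      next
        case False
        then obtain l G where G: "G \<in> pf (I (2 * Suc r))"
          "\<And>\<sigma>. qb (Suc r) \<sigma> (2 * r - 1, Suc (2 * r)) ^ l * f \<sigma> = G (qb (Suc r) \<sigma>)"
          using fraction_by_transposition[OF _ r IH f inv] by blast
        let ?y = "(2 * r - 1, Suc (2 * r))"
        have vars: "?x \<in> I (2 * Suc r)" "?y \<in> I (2 * Suc r)" by (auto simp: I_def)
        \<comment> \<open>Both fractions represent \<open>f\<close>, and \<open>qb_dominant\<close>
          turns their equality into an identity in free variables. Where the variable
          \<open>?x\<close> is 0, only the power of \<open>?y\<close> times \<open>F\<close>
          survives.\<close>
        have rel: "\<tau> ?y ^ l * F \<tau> - \<tau> ?x ^ Suc k * G \<tau> = 0" for \<tau>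
        proof (rule qb_dominant[where r = "Suc r" and F = "\<lambda>\<tau>. \<tau> ?y ^ l * F \<tau> - \<tau> ?x ^ Suc k * G \<tau>"])
          show "(\<lambda>\<tau>. \<tau> ?y ^ l * F \<tau> - \<tau> ?x ^ Suc k * G \<tau>) \<in> pf (I (2 * Suc r))"
            by (intro pf_diff pf_mult pf_power pf_var vars F(1) G(1))
          show "qb (Suc r) \<sigma> ?y ^ l * F (qb (Suc r) \<sigma>) - qb (Suc r) \<sigma> ?x ^ Suc k * G (qb (Suc r) \<sigma>) = 0" for \<sigma>
            unfolding F(2)[symmetric] G(2)[symmetric] by (simp only: mult_ac diff_self)
        qed (use r in simp)
        have "F (\<tau>(?x := 0)) = 0" for \<tau>
        proof (rule pf_density[where D = "\<lambda>\<tau>. \<tau> ?y" and h = "\<lambda>\<tau>. F (\<tau>(?x := 0))" and X = UNIV and Y = UNIV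
              and \<sigma>\<^sub>0 = "\<lambda>_. 1"])
          have "(\<lambda>\<tau>. (\<tau>(?x := 0)) ij) \<in> pf UNIV" for ij
            by (cases "ij = ?x") (auto intro: pf_intros)
          then show "(\<lambda>\<tau>. F (\<tau>(?x := 0))) \<in> pf UNIV" by (intro pf_comp[OF F(1)])
          fix \<tau> :: "nat \<times> nat \<Rightarrow> 'k" assume "\<tau> ?y \<noteq> 0"
          then show "F (\<tau>(?x := 0)) = 0" using rel[of "\<tau>(?x := 0)"] False by (simp split: if_splits)
        qed (auto intro: pf_var)
        from this[of \<tau>] show ?thesis using \<tau> by (simp add: fun_upd_idem)
      qed
    qed
  qed
qed

end

section \<open>Action of matrices on polynomials\<close>

lemma poly_algebra_iff: "(f :: (nat \<times> nat, 'k::alg_closed_field) mpoly) \<in> poly_algebra n m \<longleftrightarrow> peval f \<in> pf ({..<m} \<times> {..<n})"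
  by (simp add: poly_algebra_def mvars_subset_iff_pf)

definition mat_act :: "nat \<Rightarrow> 'k::field mat \<Rightarrow> (nat \<times> nat \<Rightarrow> 'k) \<Rightarrow> nat \<times> nat \<Rightarrow> 'k"
  where "mat_act n A \<sigma> = (\<lambda>(i, a). \<Sum>b<n. A $$ (a, b) * \<sigma> (i, b))"

lemma peval_subst_linear:
  fixes f :: "(nat \<times> nat, 'k::alg_closed_field) mpoly"
  assumes "f \<in> poly_algebra n m" "A \<in> carrier_mat n n"
  shows "peval (subst_linear n A f) \<sigma> = peval f (mat_act n A \<sigma>)"
  unfolding subst_linear_def peval_meval_Const
proof (rule pf_cong[OF assms(1)[unfolded poly_algebra_iff]])
  fix x assume "x \<in> {..<m} \<times> {..<n}"
  then show "peval (case x of (i, a) \<Rightarrow> (map_mat Const A *\<^sub>v generic_vec n i) $ a) \<sigma> = mat_act n A \<sigma> x"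
    using assms(2) by (auto simp: mat_act_def generic_vec_def scalar_prod_def atLeast0LessThan)
qed

lemma invariants_iff:
  fixes f :: "(nat \<times> nat, 'k::alg_closed_field) mpoly"
  assumes "G \<subseteq> carrier_mat n n"
  shows "f \<in> invariants n m G \<longleftrightarrow>
    f \<in> poly_algebra n m \<and> (\<forall>A\<in>G. \<forall>\<sigma>. peval f (mat_act n A \<sigma>) = peval f \<sigma>)"
proof -
  have "subst_linear n A f = f \<longleftrightarrow> (\<forall>\<sigma>. peval f (mat_act n A \<sigma>) = peval f \<sigma>)"
    if "f \<in> poly_algebra n m" "A \<in> G" for A
    using peval_subst_linear[OF that(1), of A] assms that(2) mpoly_eqI[of "subst_linear n A f" f]
    by (metis subsetD)
  then show ?thesis by (auto simp: invariants_def)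
qed

lemma mat_act_mult:
  assumes "A \<in> carrier_mat n n" "B \<in> carrier_mat n n" "a < n"
  shows "mat_act n (A * B) \<sigma> (i, a) = mat_act n A (mat_act n B \<sigma>) (i, a)"
proof -
  have "(\<Sum>b<n. (A * B) $$ (a, b) * \<sigma> (i, b)) = (\<Sum>b<n. \<Sum>c<n. A $$ (a, c) * B $$ (c, b) * \<sigma> (i, b))"
    using assms by (intro sum.cong refl) (simp add: scalar_prod_def sum_distrib_right atLeast0LessThan)
  also have "\<dots> = (\<Sum>c<n. \<Sum>b<n. A $$ (a, c) * B $$ (c, b) * \<sigma> (i, b))" by (rule sum.swap)
  finally show ?thesis by (simp add: mat_act_def sum_distrib_left mult.assoc)
qed

section \<open>The standard form and its invariants in terms of \<open>q\<close> and
  \<open>qb\<close>\<close>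

context char2_forms
begin

definition dim :: nat
  where "dim = 2 * N + (if \<epsilon> then 1 else 0)"

lemma dim_simps: "dim div 2 = N" "odd dim \<longleftrightarrow> \<epsilon>" "\<epsilon> \<Longrightarrow> dim - 1 = 2 * N"
  unfolding dim_def by auto

lemma C_N: "C N = {..<dim}"
  unfolding C_def dim_def by (cases \<epsilon>) auto

text \<open>\<open>h\<close> is evaluation at a point for vectors of indeterminates and the identity
  for vectors over the field, so one computation serves both base rings.\<close>

lemma qform_hom:
  fixes h :: "'b::comm_ring_1 \<Rightarrow> 'k"
  assumes h: "\<And>x y. h (x + y) = h x + h y" "\<And>x y. h (x * y) = h x * h y" "h 0 = 0"
    and v: "\<And>a. a < dim \<Longrightarrow> h (v $ a) = w a"
  shows "h (qform dim v) = q N w"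
proof -
  have sum: "h (\<Sum>t\<in>T. f t) = (\<Sum>t\<in>T. h (f t))" for f and T :: "nat set"
    by (induction T rule: infinite_finite_induct) (auto simp: h)
  have "(\<Sum>t<N. h (v $ t) * h (v $ (N + t))) = (\<Sum>t<N. w t * w (N + t))"
    by (intro sum.cong refl arg_cong2[of _ _ _ _ "(*)"] v) (auto simp: dim_def)
  moreover have "h (if \<epsilon> then (v $ (dim - 1))\<^sup>2 else 0) = (if \<epsilon> then (w (2 * N))\<^sup>2 else 0)"
  proof (cases \<epsilon>)
    case True
    have "h (v $ (2 * N)) = w (2 * N)" by (rule v) (use True in \<open>unfold dim_def, auto\<close>)
    then show ?thesis unfolding if_P[OF True] dim_simps(3)[OF True] by (simp add: power2_eq_square h)
  next
    case False
    show ?thesis unfolding if_not_P[OF False] by (rule h)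
  qed
  ultimately show ?thesis unfolding qform_def q_def dim_simps(1,2) h sum by (rule arg_cong2)
qed

lemma qform_vec: "qform dim (vec dim v) = q N v"
  by (rule qform_hom[where h = "\<lambda>x. x"]) auto

lemma peval_Q_inv: "peval (Q_inv dim i) \<sigma> = q N (row \<sigma> i)"
  unfolding Q_inv_def by (rule qform_hom) (auto simp: generic_vec_def)

lemma q_polar: "q N (\<lambda>c. v c + w c) - q N v - q N w = bil N v w"
  using q_add_scaled[of N v 1 w] by (simp add: diff_eq_add bil_sym[of N w] add_ac)

lemma peval_B_inv: "peval (B_inv dim i j) \<sigma> = bil N (row \<sigma> i) (row \<sigma> j)"
proof -
  have "peval (qform dim (generic_vec dim i + generic_vec dim j)) \<sigma> = q N (\<lambda>c. row \<sigma> i c + row \<sigma> j c)"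
    by (rule qform_hom) (auto simp: generic_vec_def)
  then show ?thesis
    using peval_Q_inv[of i \<sigma>] peval_Q_inv[of j \<sigma>] q_polar[of "row \<sigma> i" "row \<sigma> j"]
    by (simp add: B_inv_def polar_def Q_inv_def)
qed

definition index_pair :: "nat + nat \<times> nat \<Rightarrow> nat \<times> nat"
  where "index_pair = case_sum (\<lambda>i. (i, i)) id"

lemma peval_QB_inv: "x \<in> QB_index m \<Longrightarrow> peval (QB_inv dim x) \<sigma> = qb N \<sigma> (index_pair x)"
  by (auto simp: QB_index_def QB_inv_def qb_def index_pair_def peval_Q_inv peval_B_inv)

lemma index_pair_image: "index_pair ` QB_index m = I m"
proof -
  have "I m = (\<lambda>i. (i, i)) ` {..<m} \<union> {(i, j). i < j \<and> j < m}" by (auto simp: I_def)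
  then show ?thesis by (simp add: QB_index_def index_pair_def image_Un image_image)
qed

lemma I_mono: "m \<le> m' \<Longrightarrow> I m \<subseteq> I m'"
  by (auto simp: I_def)

lemma QB_algebraically_independent:
  assumes "m \<le> 2 * N"
  shows "algebraically_independent (QB_index m) (QB_inv dim :: _ \<Rightarrow> (nat \<times> nat, 'k) mpoly)"
  unfolding algebraically_independent_def
proof (intro allI impI)
  fix P :: "(nat + nat \<times> nat, 'k) mpoly"
  assume P: "mvars P \<subseteq> QB_index m" "meval Const (QB_inv dim :: _ \<Rightarrow> (nat \<times> nat, 'k) mpoly) P = 0"
  note PP = P(1)[unfolded mvars_subset_iff_pf]
  define F where "F \<tau> = peval P (\<lambda>x. \<tau> (index_pair x))" for \<tau>
  have "F \<in> pf (I m)"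
    unfolding F_def by (rule pf_comp[OF PP]) (use index_pair_image in \<open>auto intro!: pf_var\<close>)
  then have "F \<in> pf (I (2 * N))" by (rule pf_mono) (rule I_mono[OF assms])
  moreover have "F (qb N \<sigma>) = 0" for \<sigma>
  proof -
    have "F (qb N \<sigma>) = peval P (\<lambda>x. peval (QB_inv dim x) \<sigma>)"
      unfolding F_def by (rule pf_cong[OF PP]) (simp add: peval_QB_inv)
    then show ?thesis using P(2) peval_meval_Const[of "QB_inv dim" P \<sigma>] by simp
  qed
  ultimately have F: "F \<tau> = 0" for \<tau> by (rule qb_dominant[OF order_refl])
  have "peval P \<rho> = 0" for \<rho>
  proof -
    have "peval P \<rho> = F (\<lambda>(i, j). if i = j then \<rho> (Inl i) else \<rho> (Inr (i, j)))"
      unfolding F_def by (rule pf_cong[OF PP]) (auto simp: index_pair_def QB_index_def)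
    then show ?thesis using F by simp
  qed
  then show "P = 0" by (intro mpoly_eqI) simp
qed

lemma card_QB_index: "card (QB_index m) = (m + 1) choose 2"
proof (induction m)
  case 0
  show ?case by (simp add: QB_index_def)
next
  case (Suc m)
  have fin: "finite (QB_index m)"
    by (rule finite_subset[of _ "Inl ` {..<m} \<union> Inr ` ({..<m} \<times> {..<m})"]) (auto simp: QB_index_def)
  have "QB_index (Suc m) = insert (Inl m) (QB_index m \<union> (\<lambda>i. Inr (i, m)) ` {..<m})"
    by (auto simp: QB_index_def less_Suc_eq)
  moreover have "QB_index m \<inter> (\<lambda>i. Inr (i, m)) ` {..<m} = {}"
    "Inl m \<notin> QB_index m \<union> (\<lambda>i. Inr (i, m)) ` {..<m}" by (auto simp: QB_index_def)
  moreover have "card ((\<lambda>i. Inr (i, m) :: nat + nat \<times> nat) ` {..<m}) = m"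
    by (subst card_image) (auto simp: inj_on_def)
  ultimately have "card (QB_index (Suc m)) = Suc (card (QB_index m) + m)"
    using fin by (simp add: card_Un_disjoint)
  also have "\<dots> = (Suc m + 1) choose 2" using Suc by (simp add: numeral_2_eq_2)
  finally show ?case .
qed

text \<open>Two indices with the same image would make the difference of their variables a relation.
  This turns the count of indices into a count of invariants.\<close>

lemma algebraically_independent_imp_inj_on:
  fixes g :: "'i \<Rightarrow> ('v, 'k) mpoly"
  assumes "algebraically_independent J g"
  shows "inj_on g J"
proof (rule inj_onI, rule ccontr)
  fix x y assume xy: "x \<in> J" "y \<in> J" "g x = g y" "x \<noteq> y"
  define P :: "('i, 'k) mpoly" where "P = Var x - Var y"
  have "mvars P \<subseteq> J"
  proof -
    have "peval P = (\<lambda>\<sigma>. \<sigma> x - \<sigma> y)" by (simp add: P_def fun_eq_iff)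
    then show ?thesis unfolding mvars_subset_iff_pf using xy(1,2) by (simp add: pf_diff pf_var)
  qed
  moreover have "meval Const g P = 0"
    by (rule mpoly_eqI) (simp add: peval_meval_Const P_def xy(3))
  ultimately have "P = 0" using assms by (auto simp: algebraically_independent_def)
  then have "peval P (\<lambda>z. if z = x then 1 else 0) = 0" by simp
  then show False using xy(4) by (simp add: P_def)
qed

lemma reflection_invariant_few_vectors:
  assumes "m \<le> 2 * N" "f \<in> pf ({..<m} \<times> C N)" "reflection_invariant N f"
  shows "f \<in> alg ((\<lambda>ij \<sigma>. qb N \<sigma> ij) ` I m)"
proof -
  have "f \<in> pf (tuple_coords N)" by (rule pf_mono[OF assms(2)]) (use assms(1) in auto)
  then have f: "f \<in> alg ((\<lambda>ij \<sigma>. qb N \<sigma> ij) ` I (2 * N))"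
    by (intro reflection_invariants_generated assms) auto
  define Z where "Z \<sigma> = (\<lambda>(i, c). if i < m then \<sigma> (i, c) else 0)" for \<sigma> :: "nat \<times> nat \<Rightarrow> 'k"
  have "(\<lambda>\<sigma>. f (Z \<sigma>)) \<in> alg ((\<lambda>ij \<sigma>. qb N \<sigma> ij) ` I m)"
  proof (rule alg_comp[OF f])
    fix s assume "s \<in> (\<lambda>ij \<sigma>. qb N \<sigma> ij) ` I (2 * N)"
    then obtain i j where s: "s = (\<lambda>\<sigma>. qb N \<sigma> (i, j))" "i \<le> j" by (auto simp: I_def)
    show "(\<lambda>\<sigma>. s (Z \<sigma>)) \<in> alg ((\<lambda>ij \<sigma>. qb N \<sigma> ij) ` I m)"
    proof (cases "j < m")
      case True
      then have "(\<lambda>\<sigma>. s (Z \<sigma>)) = (\<lambda>\<sigma>. qb N \<sigma> (i, j))"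
        unfolding s(1) by (intro ext qb_cong[of _ m]) (use s(2) in \<open>auto simp: Z_def I_def\<close>)
      then show ?thesis using True s(2) by (auto simp: I_def intro: alg.gen)
    next
      case False
      \<comment> \<open>As \<open>i \<le> j\<close>, a pair outside \<open>I m\<close> has its
        larger row among the added zero vectors.\<close>
      then have "(\<lambda>\<sigma>. s (Z \<sigma>)) = (\<lambda>_. 0)"
        by (auto simp: s(1) qb_def Z_def fun_eq_iff intro!: q_zero bil_zero_right)
      then show ?thesis by (simp add: alg.const)
    qed
  qed
  moreover have "f (Z \<sigma>) = f \<sigma>" for \<sigma>
    by (rule pf_cong[OF assms(2)]) (auto simp: Z_def)
  ultimately show ?thesis by simp
qed

lemma reflection_invariant_imp_generated:
  assumes m: "m \<le> 2 * N" and f: "f \<in> poly_algebra dim m" and inv: "reflection_invariant N (peval f)"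
  shows "f \<in> subalgebra_generated (QB_inv dim ` QB_index m)"
proof -
  have "peval f \<in> alg ((\<lambda>ij \<sigma>. qb N \<sigma> ij) ` I m)"
    using f by (intro reflection_invariant_few_vectors m inv) (simp add: poly_algebra_iff C_N)
  then have "\<exists>g \<in> subalgebra_generated (QB_inv dim ` QB_index m). \<forall>\<sigma>. peval g \<sigma> = peval f \<sigma>"
  proof induction
    case (gen s)
    then obtain x where x: "x \<in> QB_index m" "s = (\<lambda>\<sigma>. qb N \<sigma> (index_pair x))"
      unfolding index_pair_image[symmetric] by auto
    show ?case
      by (rule bexI[of _ "QB_inv dim x"]) (use x in \<open>auto simp: peval_QB_inv[OF x(1)] intro: subalgebra_generated.gen\<close>)
  next
    case (const c)
    show ?case by (rule bexI[of _ "Const c"]) (auto intro: subalgebra_generated.const)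
  next
    case (add f1 f2)
    then show ?case by (metis peval_add subalgebra_generated.add)
  next
    case (mult f1 f2)
    then show ?case by (metis peval_mult subalgebra_generated.mult)
  qed
  then show ?thesis using mpoly_eqI by metis
qed

section \<open>Invariance of Q and B under the orthogonal group\<close>

lemma orthogonal_group_carrier: "orthogonal_group n \<subseteq> carrier_mat n n"
  by (auto simp: orthogonal_group_def)

lemma orthogonal_group_q:
  assumes "A \<in> orthogonal_group dim"
  shows "q N (row (mat_act dim A \<sigma>) i) = q N (row \<sigma> i)"
proof -
  have A: "A \<in> carrier_mat dim dim" and inv: "\<And>v. v \<in> carrier_vec dim \<Longrightarrow> qform dim (A *\<^sub>v v) = qform dim v"
    using assms by (auto simp: orthogonal_group_def)
  have "A *\<^sub>v vec dim (row \<sigma> i) = vec dim (row (mat_act dim A \<sigma>) i)"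
    using A by (intro eq_vecI) (auto simp: mat_act_def scalar_prod_def atLeast0LessThan)
  then show ?thesis using inv[of "vec dim (row \<sigma> i)"] by (simp add: qform_vec)
qed

lemma mat_act_add_row:
  "row (mat_act n A (\<lambda>(i, c). \<sigma> (j, c) + \<sigma> (l, c))) i = (\<lambda>c. row (mat_act n A \<sigma>) j c + row (mat_act n A \<sigma>) l c)"
  by (simp add: mat_act_def fun_eq_iff algebra_simps sum.distrib)

text \<open>Polarisation: the tuple whose rows all equal the sum of rows \<open>i\<close> and
  \<open>j\<close> brings this sum into the reach of \<open>orthogonal_group_q\<close>.\<close>

lemma orthogonal_group_bil:
  assumes "A \<in> orthogonal_group dim"
  shows "bil N (row (mat_act dim A \<sigma>) i) (row (mat_act dim A \<sigma>) j) = bil N (row \<sigma> i) (row \<sigma> j)"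
proof -
  have "q N (\<lambda>c. row (mat_act dim A \<sigma>) i c + row (mat_act dim A \<sigma>) j c) = q N (\<lambda>c. row \<sigma> i c + row \<sigma> j c)"
    using orthogonal_group_q[OF assms, of "\<lambda>(k, c). \<sigma> (i, c) + \<sigma> (j, c)" 0]
    unfolding mat_act_add_row by (simp add: row_def)
  then show ?thesis by (simp only: q_polar[symmetric] orthogonal_group_q[OF assms])
qed

lemma generated_imp_invariant:
  assumes "f \<in> subalgebra_generated (QB_inv dim ` QB_index m)"
  shows "f \<in> invariants dim m (orthogonal_group dim :: 'k mat set)"
proof -
  have "peval f \<in> pf ({..<m} \<times> {..<dim}) \<and>
    (\<forall>A\<in>orthogonal_group dim. \<forall>\<sigma>. peval f (mat_act dim A \<sigma>) = peval f \<sigma>)"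
    using assms
  proof induction
    case (gen f)
    then obtain x where x: "x \<in> QB_index m" "f = QB_inv dim x" by blast
    have "peval f = (\<lambda>\<sigma>. qb N \<sigma> (index_pair x))" by (simp add: x(2) peval_QB_inv[OF x(1)] fun_eq_iff)
    moreover have "index_pair x \<in> I m" using x(1) index_pair_image by blast
    ultimately show ?case
      by (auto simp: qb_pf C_N) (auto simp: qb_def case_prod_unfold orthogonal_group_q orthogonal_group_bil)
  next
    case (const c)
    have "peval (Const c :: (nat \<times> nat, 'k) mpoly) = (\<lambda>_. c)" by (simp add: fun_eq_iff)
    then show ?case by (simp add: pf_const)
  next
    case (add f g)
    have "peval (f + g) = (\<lambda>\<sigma>. peval f \<sigma> + peval g \<sigma>)" by (simp add: fun_eq_iff)
    then show ?case using add by (simp add: pf_add)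
  next
    case (mult f g)
    have "peval (f * g) = (\<lambda>\<sigma>. peval f \<sigma> * peval g \<sigma>)" by (simp add: fun_eq_iff)
    then show ?case using mult by (simp add: pf_mult)
  qed
  then show ?thesis by (simp add: invariants_iff[OF orthogonal_group_carrier] poly_algebra_iff)
qed

end

section \<open>Connected sets of matrices\<close>

text \<open>The generators have a common denominator \<open>D\<close>, but sums and products need
  different powers of it; hence the existential exponent.\<close>

lemma alg_uniform_fraction:
  fixes D :: "'k::field poly"
  assumes "h \<in> alg S" "\<And>s. s \<in> S \<Longrightarrow> \<exists>k p. \<forall>t. poly D t \<noteq> 0 \<longrightarrow> poly D t ^ k * s (g t) = poly p t"
  shows "\<exists>k p. \<forall>t. poly D t \<noteq> 0 \<longrightarrow> poly D t ^ k * h (g t) = poly p t"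
  using assms(1)
proof induction
  case (const c)
  show ?case by (rule exI[of _ 0], rule exI[of _ "[:c:]"]) simp
next
  case (add f1 f2)
  then obtain k1 p1 k2 p2 where *: "\<And>t. poly D t \<noteq> 0 \<Longrightarrow> poly D t ^ k1 * f1 (g t) = poly p1 t"
    "\<And>t. poly D t \<noteq> 0 \<Longrightarrow> poly D t ^ k2 * f2 (g t) = poly p2 t" by blast
  show ?case
    by (rule exI[of _ "k1 + k2"], rule exI[of _ "D ^ k2 * p1 + D ^ k1 * p2"])
      (auto simp: power_add algebra_simps poly_power simp flip: *)
next
  case (mult f1 f2)
  then obtain k1 p1 k2 p2 where *: "\<And>t. poly D t \<noteq> 0 \<Longrightarrow> poly D t ^ k1 * f1 (g t) = poly p1 t"
    "\<And>t. poly D t \<noteq> 0 \<Longrightarrow> poly D t ^ k2 * f2 (g t) = poly p2 t" by blast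
  show ?case
    by (rule exI[of _ "k1 + k2"], rule exI[of _ "p1 * p2"])
      (auto simp: power_add algebra_simps simp flip: *)
qed (use assms(2) in auto)

lemma topspace_zariski_topology: "carrier_mat n n \<subseteq> topspace (zariski_topology n :: 'k::field mat topology)"
proof (rule openin_subset)
  have "matrix_zero_locus n {Const (1 :: 'k)} = {}"
    by (simp add: matrix_zero_locus_def flip: peval_def)
  then show "openin (zariski_topology n) (carrier_mat n n :: 'k mat set)"
    by (auto simp: zariski_open_def intro!: exI[of _ "{Const 1}"])
qed

text \<open>A nonempty open subset of the curve contains all but finitely many of its points.\<close>

lemma connectedin_rational_curve:
  fixes A :: "'k::alg_closed_field \<Rightarrow> 'k mat" and D :: "'k poly"
  assumes D: "D \<noteq> 0" and A: "\<And>t. poly D t \<noteq> 0 \<Longrightarrow> A t \<in> carrier_mat n n"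
    and rat: "\<And>i j. i < n \<Longrightarrow> j < n \<Longrightarrow> \<exists>k p. \<forall>t. poly D t \<noteq> 0 \<longrightarrow> poly D t ^ k * A t $$ (i, j) = poly p t"
  shows "connectedin (zariski_topology n) (A ` {t. poly D t \<noteq> 0})"
proof -
  let ?T = "A ` {t. poly D t \<noteq> 0}"
  have open_poly: "\<exists>p. p \<noteq> 0 \<and> (\<forall>t. poly D t \<noteq> 0 \<longrightarrow> poly p t \<noteq> 0 \<longrightarrow> A t \<in> E)"
    if E: "zariski_open n E" "E \<inter> ?T \<noteq> {}" for E
  proof -
    obtain P where P: "\<And>p. p \<in> P \<Longrightarrow> mvars p \<subseteq> {..<n} \<times> {..<n}" "E = carrier_mat n n - matrix_zero_locus n P"
      using E(1) by (auto simp: zariski_open_def)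
    obtain t0 where t0: "poly D t0 \<noteq> 0" "A t0 \<in> E" using E(2) by blast
    then obtain p where p: "p \<in> P" "peval p (\<lambda>ij. A t0 $$ ij) \<noteq> 0"
      unfolding P(2) matrix_zero_locus_def peval_def by blast
    have "\<exists>k f. \<forall>t. poly D t \<noteq> 0 \<longrightarrow> poly D t ^ k * peval p (\<lambda>ij. A t $$ ij) = poly f t"
      by (rule alg_uniform_fraction[OF peval_pf[OF P(1)[OF p(1)], unfolded pf_def]]) (use rat in auto)
    then obtain k f where f: "\<And>t. poly D t \<noteq> 0 \<Longrightarrow> poly D t ^ k * peval p (\<lambda>ij. A t $$ ij) = poly f t" by blast
    have "f \<noteq> 0" using f[OF t0(1)] p(2) t0(1) by auto
    moreover have "A t \<in> E" if "poly D t \<noteq> 0" "poly f t \<noteq> 0" for t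
    proof -
      have "peval p (\<lambda>ij. A t $$ ij) \<noteq> 0" using f[OF that(1)] that(2) by auto
      then show ?thesis using A[OF that(1)] p(1) unfolding P(2) matrix_zero_locus_def peval_def by blast
    qed
    ultimately show ?thesis by blast
  qed
  have "E1 \<inter> E2 \<inter> ?T \<noteq> {}"
    if E: "zariski_open n E1" "zariski_open n E2" "E1 \<inter> ?T \<noteq> {}" "E2 \<inter> ?T \<noteq> {}" for E1 E2
  proof -
    obtain p1 where p1: "p1 \<noteq> 0" "\<And>t. poly D t \<noteq> 0 \<Longrightarrow> poly p1 t \<noteq> 0 \<Longrightarrow> A t \<in> E1" using open_poly[OF E(1,3)] by blast
    obtain p2 where p2: "p2 \<noteq> 0" "\<And>t. poly D t \<noteq> 0 \<Longrightarrow> poly p2 t \<noteq> 0 \<Longrightarrow> A t \<in> E2" using open_poly[OF E(2,4)] by blast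
    have "D * p1 * p2 \<noteq> 0" using D p1(1) p2(1) by simp
    then obtain t where "poly (D * p1 * p2) t \<noteq> 0"
      using poly_eq_0_if_cofinite[of "{}" "D * p1 * p2"] by blast
    then show ?thesis using p1(2)[of t] p2(2)[of t] by auto
  qed
  moreover have "?T \<subseteq> topspace (zariski_topology n)" using A topspace_zariski_topology by blast
  ultimately show ?thesis unfolding connectedin by auto
qed

section \<open>Reflection matrices and the identity component\<close>

context char2_forms
begin

text \<open>The coefficients of the linear form \<open>bil N u\<close>: the two halves of
  \<open>u\<close> exchanged, and 0 at z, whose axis is the radical of the polar form.\<close>

definition dual :: "(nat \<Rightarrow> 'k) \<Rightarrow> nat \<Rightarrow> 'k"
  where "dual u b = (if b < N then u (N + b) else if b < 2 * N then u (b - N) else 0)"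

definition refl_mat :: "(nat \<Rightarrow> 'k) \<Rightarrow> 'k mat"
  where "refl_mat u = mat dim dim (\<lambda>(a, b). (if a = b then 1 else 0) + u a * dual u b / q N u)"

lemma refl_mat_carrier [simp]: "refl_mat u \<in> carrier_mat dim dim"
  by (simp add: refl_mat_def)

lemma dim_refl_mat [simp]: "dim_row (refl_mat u) = dim" "dim_col (refl_mat u) = dim"
  by (simp_all add: refl_mat_def)

lemma sum_dual: "(\<Sum>b<dim. dual u b * v b) = bil N u v"
proof -
  have "(\<Sum>b<dim. dual u b * v b) = (\<Sum>b<2 * N. dual u b * v b)"
    by (rule sum.mono_neutral_right) (auto simp: dim_def dual_def)
  also have "\<dots> = (\<Sum>b<N. dual u b * v b) + (\<Sum>b=N..<N + N. dual u b * v b)"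
    by (simp add: mult_2 atLeast0LessThan[symmetric] sum.atLeastLessThan_concat)
  also have "(\<Sum>b=N..<N + N. dual u b * v b) = (\<Sum>b<N. dual u (N + b) * v (N + b))"
    using sum.shift_bounds_nat_ivl[of "\<lambda>b. dual u b * v b" 0 N N] by (simp add: atLeast0LessThan add.commute)
  also have "(\<Sum>b<N. dual u b * v b) = (\<Sum>b<N. u (N + b) * v b)"
    by (intro sum.cong refl) (simp add: dual_def)
  also have "(\<Sum>b<N. dual u (N + b) * v (N + b)) = (\<Sum>b<N. u b * v (N + b))"
    by (intro sum.cong refl) (simp add: dual_def)
  finally show ?thesis by (simp add: bil_def sum.distrib add.commute)
qed

lemma sum_refl_mat:
  assumes "a < dim"
  shows "(\<Sum>b<dim. refl_mat u $$ (a, b) * v b) = v a + bil N u v / q N u * u a"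
proof -
  have "(\<Sum>b<dim. refl_mat u $$ (a, b) * v b) =
      (\<Sum>b<dim. (if b = a then v b else 0) + u a / q N u * (dual u b * v b))"
    using assms by (intro sum.cong refl) (auto simp: refl_mat_def algebra_simps)
  also have "\<dots> = v a + u a / q N u * bil N u v"
    unfolding sum.distrib sum_distrib_left[symmetric] sum_dual using assms by simp
  finally show ?thesis by (simp add: mult.commute)
qed

lemma mat_act_refl_mat: "a < dim \<Longrightarrow> mat_act dim (refl_mat u) \<sigma> (i, a) = refl N u \<sigma> (i, a)"
  using sum_refl_mat[of a u "row \<sigma> i"] by (simp add: mat_act_def refl_apply)

lemma refl_mat_mult_vec:
  "v \<in> carrier_vec dim \<Longrightarrow> refl_mat u *\<^sub>v v = vec dim (\<lambda>a. v $ a + bil N u (($) v) / q N u * u a)"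
  using sum_refl_mat[of _ u "($) v"] refl_mat_carrier[of u]
  by (intro eq_vecI) (auto simp: scalar_prod_def atLeast0LessThan)

lemma refl_mat_square:
  assumes "q N u \<noteq> 0"
  shows "refl_mat u * refl_mat u = 1\<^sub>m dim"
proof (rule eq_matI)
  fix a c assume ac: "a < dim_row (1\<^sub>m dim :: 'k mat)" "c < dim_col (1\<^sub>m dim :: 'k mat)"
  let ?v = "\<lambda>b. refl_mat u $$ (b, c)"
  have v: "?v b = (if b = c then 1 else 0) + dual u c / q N u * u b" if "b < dim" for b
    using that ac by (simp add: refl_mat_def)
  have "bil N u ?v = bil N u (\<lambda>b. (if b = c then 1 else 0) + dual u c / q N u * u b)"
    by (rule bil_cong) (simp_all add: C_N v)
  also have "\<dots> = (\<Sum>b<dim. dual u b * (if b = c then 1 else 0))"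
    unfolding bil_add_scaled_right by (simp add: sum_dual)
  also have "\<dots> = dual u c" using ac by (simp add: sum.delta if_distrib cong: if_cong)
  finally have bil: "bil N u ?v = dual u c" .
  have "(refl_mat u * refl_mat u) $$ (a, c) = (\<Sum>b<dim. refl_mat u $$ (a, b) * ?v b)"
    using ac refl_mat_carrier[of u] by (simp add: scalar_prod_def atLeast0LessThan)
  also have "\<dots> = ?v a + dual u c / q N u * u a" using ac by (simp add: sum_refl_mat bil)
  also have "\<dots> = 1\<^sub>m dim $$ (a, c)" using ac by (simp add: v add.assoc)
  finally show "(refl_mat u * refl_mat u) $$ (a, c) = 1\<^sub>m dim $$ (a, c)" .
qed (simp_all add: refl_mat_def)

lemma refl_mat_orthogonal:
  assumes "q N u \<noteq> 0"
  shows "refl_mat u \<in> orthogonal_group dim"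
proof -
  have "qform dim (refl_mat u *\<^sub>v v) = qform dim v" if v: "v \<in> carrier_vec dim" for v
  proof -
    have "qform dim (refl_mat u *\<^sub>v v) = q N (\<lambda>a. v $ a + bil N u (($) v) / q N u * u a)"
      unfolding refl_mat_mult_vec[OF v] by (rule qform_vec)
    also have "\<dots> = q N (($) v)"
      using assms unfolding q_add_scaled by (simp add: power2_eq_square)
    also have "\<dots> = qform dim (vec dim (($) v))" by (rule qform_vec[symmetric])
    also have "vec dim (($) v) = v" using v by (intro eq_vecI) auto
    finally show ?thesis .
  qed
  moreover have "invertible_mat (refl_mat u)"
    unfolding invertible_mat_def inverts_mat_def
    using refl_mat_square[OF assms] by (intro conjI exI[of _ "refl_mat u"]) simp_all
  ultimately show ?thesis by (simp add: orthogonal_group_def)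
qed

lemma refl_mat_product_orthogonal:
  assumes u: "q N u \<noteq> 0" and w: "q N w \<noteq> 0"
  shows "refl_mat u * refl_mat w \<in> orthogonal_group dim"
proof -
  note c = refl_mat_carrier[of u] refl_mat_carrier[of w]
  have prod: "refl_mat u * refl_mat w * (refl_mat w * refl_mat u) = 1\<^sub>m dim"
    if "q N u \<noteq> 0" "q N w \<noteq> 0" for u w
  proof -
    note c = refl_mat_carrier[of u] refl_mat_carrier[of w]
    have "refl_mat u * refl_mat w * (refl_mat w * refl_mat u) = refl_mat u * (refl_mat w * (refl_mat w * refl_mat u))"
      by (rule assoc_mult_mat[OF c]) (use c in \<open>auto intro: mult_carrier_mat\<close>)
    also have "refl_mat w * (refl_mat w * refl_mat u) = refl_mat w * refl_mat w * refl_mat u"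
      by (rule assoc_mult_mat[OF c(2,2,1), symmetric])
    also have "\<dots> = refl_mat u" using c by (simp add: refl_mat_square that)
    also have "refl_mat u * refl_mat u = 1\<^sub>m dim" using that by (simp add: refl_mat_square)
    finally show ?thesis .
  qed
  have "invertible_mat (refl_mat u * refl_mat w)"
    unfolding invertible_mat_def inverts_mat_def
    using prod[OF u w] prod[OF w u] by (intro conjI exI[of _ "refl_mat w * refl_mat u"]) simp_all
  moreover have "qform dim (refl_mat u * refl_mat w *\<^sub>v v) = qform dim v" if v: "v \<in> carrier_vec dim" for v
  proof -
    have "refl_mat u * refl_mat w *\<^sub>v v = refl_mat u *\<^sub>v (refl_mat w *\<^sub>v v)" using c v by (rule assoc_mult_mat_vec)
    moreover have "refl_mat w *\<^sub>v v \<in> carrier_vec dim" using c(2) v by (rule mult_mat_vec_carrier)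
    ultimately show ?thesis using refl_mat_orthogonal[OF u] refl_mat_orthogonal[OF w] v by (simp add: orthogonal_group_def)
  qed
  moreover have "refl_mat u * refl_mat w \<in> carrier_mat dim dim" using c by (rule mult_carrier_mat)
  ultimately show ?thesis by (simp add: orthogonal_group_def)
qed

text \<open>The second vector moves along the line from \<open>u\<close> to \<open>w\<close>. The
  resulting products form a rational curve in the orthogonal group, which starts at the identity
  because reflections are involutions. Leaving out the parameters where \<open>l t\<close> is
  isotropic keeps it connected.\<close>

lemma refl_mat_product_special:
  assumes u: "q N u \<noteq> 0" and w: "q N w \<noteq> 0"
  shows "refl_mat u * refl_mat w \<in> special_orthogonal_group dim"
proof -
  define l where "l t c = u c + t * (w c + u c)" for t c
  define D where "D = [:q N u, bil N (\<lambda>c. w c + u c) u, q N (\<lambda>c. w c + u c):]"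
  have D: "poly D t = q N (l t)" for t
    unfolding l_def q_add_scaled by (simp add: D_def algebra_simps power2_eq_square)
  have l: "l 0 = u" "l 1 = w" by (auto simp: l_def add.commute add.left_commute)
  let ?A = "\<lambda>t. refl_mat u * refl_mat (l t)"
  let ?T = "?A ` {t. poly D t \<noteq> 0}"
  have "connectedin (zariski_topology dim) ?T"
  proof (rule connectedin_rational_curve)
    show "D \<noteq> 0" using D[of 0] u l by auto
    show "?A t \<in> carrier_mat dim dim" for t using refl_mat_carrier by (rule mult_carrier_mat) simp
    fix i j assume ij: "i < dim" "j < dim"
    have lin: "\<exists>p. \<forall>t. l t c = poly p t" for c
      by (rule exI[of _ "[:u c, w c + u c:]"]) (simp add: l_def)
    have "\<exists>p. \<forall>t. dual (l t) j = poly p t"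
      unfolding dual_def using lin by (cases "j < N"; cases "j < 2 * N") (auto intro: exI[of _ 0])
    then obtain d where d: "\<And>t. dual (l t) j = poly d t" by blast
    obtain e where e: "\<And>c t. l t c = poly (e c) t" using lin by metis
    have entry: "poly D t * refl_mat (l t) $$ (c, j) = poly (D * (if c = j then 1 else 0) + e c * d) t"
      if "poly D t \<noteq> 0" "c < dim" for t c
      using that ij by (auto simp: refl_mat_def D d e field_simps)
    have "poly D t ^ 1 * ?A t $$ (i, j) =
      poly (\<Sum>c<dim. [:refl_mat u $$ (i, c):] * (D * (if c = j then 1 else 0) + e c * d)) t"
      if t: "poly D t \<noteq> 0" for t
    proof -
      have "?A t $$ (i, j) = (\<Sum>c<dim. refl_mat u $$ (i, c) * refl_mat (l t) $$ (c, j))"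
        using ij refl_mat_carrier[of u] refl_mat_carrier[of "l t"] by (simp add: scalar_prod_def atLeast0LessThan)
      then have "poly D t * ?A t $$ (i, j) = (\<Sum>c<dim. refl_mat u $$ (i, c) * (poly D t * refl_mat (l t) $$ (c, j)))"
        by (simp add: sum_distrib_left mult.left_commute)
      also have "\<dots> = (\<Sum>c<dim. refl_mat u $$ (i, c) * poly (D * (if c = j then 1 else 0) + e c * d) t)"
        by (intro sum.cong refl) (simp only: entry[OF t] lessThan_iff)
      finally show ?thesis by (simp add: poly_sum)
    qed
    then show "\<exists>k p. \<forall>t. poly D t \<noteq> 0 \<longrightarrow> poly D t ^ k * ?A t $$ (i, j) = poly p t" by blast
  qed
  moreover have "?T \<subseteq> orthogonal_group dim"
    using u by (auto simp: D intro!: refl_mat_product_orthogonal)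
  ultimately have "connectedin (subtopology (zariski_topology dim) (orthogonal_group dim)) ?T"
    by (simp add: connectedin_subtopology)
  moreover have "1\<^sub>m dim \<in> ?T"
    using refl_mat_square[OF u] u by (intro image_eqI[of _ _ 0]) (simp_all add: D l)
  moreover have "refl_mat u * refl_mat w \<in> ?T"
    using w by (intro image_eqI[of _ _ 1]) (simp_all add: D l)
  ultimately show ?thesis
    unfolding special_orthogonal_group_def connected_component_of_def by blast
qed

lemma special_orthogonal_subset: "special_orthogonal_group n \<subseteq> (orthogonal_group n :: 'k mat set)"
  unfolding special_orthogonal_group_def
  using connected_component_of_subset_topspace[of "subtopology (zariski_topology n) (orthogonal_group n)"]
  by (auto simp: topspace_subtopology)

lemma orthogonal_vector_exists:
  fixes v :: "nat \<Rightarrow> nat \<Rightarrow> 'k"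
  assumes "m < 2 * N"
  shows "\<exists>w c. c < 2 * N \<and> w c \<noteq> 0 \<and> (\<forall>b\<ge>2 * N. w b = 0) \<and> (\<forall>i<m. bil N w (v i) = 0)"
proof -
  let ?n = "2 * N"
  \<comment> \<open>The zero last row forces the determinant to vanish; because
    \<open>m < 2 * N\<close>, it displaces none of the first \<open>m\<close> conditions.\<close>
  define A where "A = mat\<^sub>r ?n ?n (\<lambda>i. if i = ?n - 1 then 0\<^sub>v ?n else vec ?n (dual (v i)))"
  have "det A = 0" unfolding A_def by (rule det_row_0) (use assms in auto)
  moreover have A: "A \<in> carrier_mat ?n ?n" by (simp add: A_def)
  ultimately obtain x where x: "x \<in> carrier_vec ?n" "x \<noteq> 0\<^sub>v ?n" "A *\<^sub>v x = 0\<^sub>v ?n"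
    using det_0_iff_vec_prod_zero_field by blast
  define w where "w b = (if b < ?n then x $ b else 0)" for b
  obtain c where c: "c < ?n" "w c \<noteq> 0" using x(1,2) by (auto simp: w_def vec_eq_iff)
  have "bil N w (v i) = 0" if i: "i < m" for i
  proof -
    have "bil N w (v i) = (\<Sum>b<dim. dual (v i) b * w b)" by (simp add: sum_dual bil_sym)
    also have "\<dots> = (\<Sum>b<?n. dual (v i) b * w b)"
      by (rule sum.mono_neutral_right) (auto simp: dim_def w_def)
    also have "\<dots> = (A *\<^sub>v x) $ i"
      using x(1) i assms by (auto simp: A_def w_def scalar_prod_def mat_of_rows_def atLeast0LessThan intro!: sum.cong)
    also have "\<dots> = 0" using x(3) i assms by simp
    finally show ?thesis .
  qed
  then show ?thesis using c by (intro exI[of _ w] exI[of _ c]) (simp add: w_def)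
qed

text \<open>
  Fewer than \<open>n = 2\<nu>\<close> vectors are, up to a perturbation, fixed by a reflection, so that every
  reflection may be replaced by a product of two of them.
\<close>

lemma special_invariant_imp_reflection_invariant:
  assumes m: "m < 2 * N" and \<epsilon>: "\<not> \<epsilon>"
    and f: "f \<in> invariants dim m (special_orthogonal_group dim :: 'k mat set)"
  shows "reflection_invariant N (peval f)"
  unfolding reflection_invariant_def
proof (intro allI impI)
  fix u \<sigma> assume u: "q N u \<noteq> 0"
  have f_pf: "peval f \<in> pf ({..<m} \<times> {..<dim})" and
    f_inv: "\<And>A \<sigma>. A \<in> special_orthogonal_group dim \<Longrightarrow> peval f (mat_act dim A \<sigma>) = peval f \<sigma>"
    using f invariants_iff[OF subset_trans[OF special_orthogonal_subset orthogonal_group_carrier], of f dim m]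
    by (auto simp: poly_algebra_iff)
  obtain w c where w: "c < 2 * N" "w c \<noteq> 0" "\<And>b. b \<ge> 2 * N \<Longrightarrow> w b = 0" "\<And>i. i < m \<Longrightarrow> bil N w (row \<sigma> i) = 0"
    using orthogonal_vector_exists[OF m, of "row \<sigma>"] by (elim exE conjE) blast
  \<comment> \<open>\<open>d\<close> is a multiple of the coordinate vector paired with coordinate
    \<open>c\<close> of the form, so it is isotropic and its polar form with \<open>w\<close> is
    1.\<close>
  define c' where "c' = (if c < N then N + c else c - N)"
  define d where "d b = (if b = c' then 1 / w c else 0)" for b
  have "bil N d w = (\<Sum>b<dim. dual w b * d b)" by (simp add: sum_dual bil_sym)
  also have "\<dots> = dual w c' * d c'"
    using w(1) by (subst sum.remove[of _ c']) (auto simp: dim_def c'_def d_def intro!: sum.neutral)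
  also have "\<dots> = 1" using w(1,2) by (auto simp: dual_def c'_def d_def)
  finally have dw: "bil N d w = 1" .
  have dd: "d t * d (N + t) = 0" for t using w(1) by (auto simp: d_def c'_def)
  have qd: "q N d = 0" unfolding q_def dd using \<epsilon> by simp
  \<comment> \<open>\<open>w\<close> may be isotropic. Adding \<open>t * d\<close> changes its norm
    to \<open>q N w + t\<close>, and \<open>\<tau> t\<close> changes the rows by exactly the
    multiples of \<open>d\<close> that keep the first \<open>m\<close> of them orthogonal to
    \<open>wt t\<close>.\<close>
  define wt where "wt t b = w b + t * d b" for t b
  define \<tau> where "\<tau> t = (\<lambda>(i, b). \<sigma> (i, b) + t * (bil N d (row \<sigma> i) * d b))" for t
  have q_wt: "q N (wt t) = q N w + t" for t
    unfolding wt_def q_add_scaled by (simp add: dw qd)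
  have perp: "bil N (wt t) (row (\<tau> t) i) = 0" if "i < m" for i t
  proof -
    have rw: "row (\<tau> t) i = (\<lambda>b. row \<sigma> i b + (t * bil N d (row \<sigma> i)) * d b)"
      by (simp add: \<tau>_def fun_eq_iff mult.assoc)
    show ?thesis
      unfolding wt_def rw bil_add_scaled_left bil_add_scaled_right
      by (simp add: w(4)[OF that] dw bil_sym[of N w d] del: row_apply)
  qed
  define h where "h \<sigma> = peval f (refl N u \<sigma>) - peval f \<sigma>" for \<sigma>
  have "(\<lambda>\<sigma>. peval f (refl N u \<sigma>)) \<in> pf UNIV"
  proof (rule pf_comp[OF f_pf])
    fix x :: "nat \<times> nat"
    obtain i b where x: "x = (i, b)" by force
    have "(\<lambda>\<sigma>. bil N u (row \<sigma> i)) \<in> pf UNIV"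
      unfolding bil_def row_apply by (intro pf_intros) auto
    then show "(\<lambda>\<sigma>. refl N u \<sigma> x) \<in> pf UNIV"
      unfolding x refl_apply divide_inverse by (intro pf_intros) auto
  qed
  then have "h \<in> pf UNIV" unfolding h_def by (intro pf_diff pf_mono[OF f_pf]) auto
  then have "\<exists>p. \<forall>t. h (\<tau> t) = poly p t"
    unfolding pf_def
  proof (rule alg_uniform)
    fix s :: "(nat \<times> nat \<Rightarrow> 'k) \<Rightarrow> 'k" assume "s \<in> range (\<lambda>x \<sigma>. \<sigma> x)"
    then obtain i b where s: "s = (\<lambda>\<sigma>. \<sigma> (i, b))" by auto
    show "\<exists>p. \<forall>t. s (\<tau> t) = poly p t"
      by (rule exI[of _ "[:\<sigma> (i, b), bil N d (row \<sigma> i) * d b:]"]) (simp add: s \<tau>_def)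
  qed
  then obtain p where p: "\<And>t. h (\<tau> t) = poly p t" by blast
  \<comment> \<open>For these \<open>t\<close> the reflection in \<open>wt t\<close> exists and
    fixes the first \<open>m\<close> rows of \<open>\<tau> t\<close>, so on this tuple the product
    of two reflections acts like the one in \<open>u\<close>.\<close>
  have "poly p t = 0" if "t \<notin> {q N w}" for t
  proof -
    have wt0: "q N (wt t) \<noteq> 0" using that eq_iff_add_eq_0[of t "q N w"] by (simp add: q_wt add.commute)
    let ?M = "refl_mat u * refl_mat (wt t)"
    have "peval f (mat_act dim ?M (\<tau> t)) = peval f (\<tau> t)"
      by (rule f_inv[OF refl_mat_product_special[OF u wt0]])
    moreover have "peval f (mat_act dim ?M (\<tau> t)) = peval f (refl N u (\<tau> t))"
    proof (rule pf_cong[OF f_pf])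
      fix x assume "x \<in> {..<m} \<times> {..<dim}"
      then obtain i b where x: "x = (i, b)" "i < m" "b < dim" by auto
      have fixed: "mat_act dim (refl_mat (wt t)) (\<tau> t) (i, a) = \<tau> t (i, a)" if "a < dim" for a
        using that perp[OF x(2)] by (simp add: mat_act_refl_mat refl_apply)
      have "mat_act dim ?M (\<tau> t) (i, b) = mat_act dim (refl_mat u) (mat_act dim (refl_mat (wt t)) (\<tau> t)) (i, b)"
        by (rule mat_act_mult) (use x in auto)
      also have "\<dots> = mat_act dim (refl_mat u) (\<tau> t) (i, b)"
        using fixed by (simp add: mat_act_def)
      finally show "mat_act dim ?M (\<tau> t) x = refl N u (\<tau> t) x" using x by (simp add: mat_act_refl_mat)
    qed
    ultimately show ?thesis using p[of t] by (simp add: h_def)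
  qed
  then have "p = 0" by (intro poly_eq_0_if_cofinite[of "{q N w}"]) auto
  moreover have "\<tau> 0 = \<sigma>" by (simp add: \<tau>_def fun_eq_iff)
  ultimately have "h \<sigma> = 0" using p[of 0] by simp
  then show "peval f (refl N u \<sigma>) = peval f \<sigma>" by (simp add: h_def)
qed

lemma orthogonal_invariant_imp_reflection_invariant:
  assumes f: "f \<in> invariants dim m (orthogonal_group dim :: 'k mat set)"
  shows "reflection_invariant N (peval f)"
  unfolding reflection_invariant_def
proof (intro allI impI)
  fix u \<sigma> assume u: "q N u \<noteq> 0"
  have f_pf: "peval f \<in> pf ({..<m} \<times> {..<dim})" and
    f_inv: "\<And>A \<sigma>. A \<in> orthogonal_group dim \<Longrightarrow> peval f (mat_act dim A \<sigma>) = peval f \<sigma>"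
    using f by (auto simp: poly_algebra_iff invariants_iff[OF orthogonal_group_carrier])
  have "peval f (refl N u \<sigma>) = peval f (mat_act dim (refl_mat u) \<sigma>)"
    by (rule pf_cong[OF f_pf]) (auto simp: mat_act_refl_mat)
  then show "peval f (refl N u \<sigma>) = peval f \<sigma>" using f_inv refl_mat_orthogonal[OF u] by simp
qed

theorem orthogonal_invariants:
  assumes "m \<le> 2 * N"
  shows "invariants dim m (orthogonal_group dim :: 'k mat set) = subalgebra_generated (QB_inv dim ` QB_index m)"
proof
  show "invariants dim m (orthogonal_group dim :: 'k mat set) \<subseteq> subalgebra_generated (QB_inv dim ` QB_index m)"
    using reflection_invariant_imp_generated[OF assms _ orthogonal_invariant_imp_reflection_invariant]
    by (auto simp: invariants_def)
qed (use generated_imp_invariant in blast)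

theorem special_orthogonal_invariants:
  assumes "m < 2 * N" "\<not> \<epsilon>"
  shows "invariants dim m (special_orthogonal_group dim :: 'k mat set) = invariants dim m (orthogonal_group dim)"
proof
  show "invariants dim m (special_orthogonal_group dim :: 'k mat set) \<subseteq> invariants dim m (orthogonal_group dim)"
  proof
    fix f assume f: "f \<in> invariants dim m (special_orthogonal_group dim :: 'k mat set)"
    have "f \<in> poly_algebra dim m" using f by (simp add: invariants_def)
    moreover have "reflection_invariant N (peval f)"
      by (rule special_invariant_imp_reflection_invariant[OF assms f])
    ultimately show "f \<in> invariants dim m (orthogonal_group dim)"
      using reflection_invariant_imp_generated[of m f] generated_imp_invariant assms(1) by simp
  qed
qed (use special_orthogonal_subset in \<open>auto simp: invariants_def\<close>)

end

theorem theorem4p9: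
  fixes \<nu> n m :: nat
  assumes "CHAR('k::alg_closed_field) = 2"
    and "n = 2 * \<nu> \<or> n = 2 * \<nu> + 1"
    and "m \<le> 2 * \<nu>"
  shows "card (QB_inv n ` QB_index m :: (nat \<times> nat, 'k) mpoly set) = (m + 1) choose 2
    \<and> algebraically_independent (QB_index m) (QB_inv n :: _ \<Rightarrow> (nat \<times> nat, 'k) mpoly)
    \<and> invariants n m (orthogonal_group n :: 'k mat set) = subalgebra_generated (QB_inv n ` QB_index m)
    \<and> (m < 2 * \<nu> \<and> n = 2 * \<nu> \<longrightarrow>
         invariants n m (special_orthogonal_group n :: 'k mat set) = invariants n m (orthogonal_group n))"
proof -
  have "(of_nat 2 :: 'k) = 0" using of_nat_CHAR[where 'a = 'k] assms(1) by simp
  \<comment> \<open>Taking the parity of \<open>n\<close> for \<open>\<epsilon>\<close> treats both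
    shapes of \<open>n\<close> at once.\<close>
  then interpret char2_forms \<nu> "odd n" "TYPE('k)" by unfold_locales simp
  have n: "dim = n" using assms(2) by (auto simp: dim_def)
  note indep = QB_algebraically_independent[OF assms(3), unfolded n]
  have "card (QB_inv n ` QB_index m :: (nat \<times> nat, 'k) mpoly set) = (m + 1) choose 2"
    using card_image[OF algebraically_independent_imp_inj_on[OF indep]] card_QB_index by simp
  moreover have "invariants n m (special_orthogonal_group n :: 'k mat set) = invariants n m (orthogonal_group n)"
    if "m < 2 * \<nu>" "n = 2 * \<nu>"
  proof -
    have "\<not> odd n" using that(2) by simp
    from special_orthogonal_invariants[OF that(1) this] show ?thesis unfolding n .
  qed
  ultimately show ?thesis
    using indep orthogonal_invariants[OF assms(3)] unfolding n by blast
qed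

end
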